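(* Let $(\mathcal{M},g)$ be extremal Reissner--Nordström with mass $M>0$ and let $\Sigma_0$, $\mathcal{H}$, $\mathcal{A}$ and $Y=\partial_r$ be as described in the context. If $\psi$ is a solution of the wave equation $\Box_g\psi=0$ on $J^+(\Sigma_0)$ with smooth compactly supported initial data on $\Sigma_0$ for which $$H[\psi]:=\int_{\Sigma_0\cap\mathcal{H}}\Big(Y\psi+\frac1M\psi\Big)d\omega\neq0,$$ then $$\int_{\mathcal{A}}(Y\psi)^2\,dg_{\mathcal{A}}=\infty.$$
   Context: Spacetime. Extremal Reissner--Nordström of mass $M>0$: in ingoing Eddington--Finkelstein coordinates $(v,r,\theta,\varphi)$, $v\in\mathbb{R}$, $r>0$, $g=-D\,dv^2+2\,dv\,dr+r^2(d\theta^2+\sin^2\theta\,d\varphi^2)$ with $D=(r-M)^2/r^2$. The future event horizon is $\mathcal{H}=\{r=M\}$; only $r\ge M$ is considered. $d\omega=\sin\theta\,d\theta\,d\varphi$. $Y:=\partial_r$ with respect to the coordinates $(v,r,\theta,\varphi)$. On $r>M$ set $u=v-2r_*$, where $dr_*/dr=D^{-1}$. Hypersurfaces and regions. Let $\Sigma$ be a spherically symmetric asymptotically flat spacelike hypersurface meeting $\mathcal{H}$, and fix $M<R<R_2$ with $R<2M$. Let $v_\Sigma(r)$, $u_\Sigma(r)$ be the values of $v,u$ on $\Sigma$ at radius $r$. Then $\Sigma_0=(\Sigma\cap\{R\le r\le R_2\})\cup\{v=v_\Sigma(R),\,M\le r\le R\}\cup\{u=u_\Sigma(R_2),\,v\ge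 v_\Sigma(R_2)\}$. $\mathcal{A}=J^+(\Sigma_0)\cap\{M\le r\le R\}$, i.e. $\mathcal{A}=\{v\ge v_\Sigma(R),\ M\le r\le R\}$; $dg_{\mathcal{A}}=r^2\,dr\,dv\,d\omega$. The support of compactly supported data on $\Sigma_0$ may include the section $\Sigma_0\cap\mathcal{H}$. *)

theory Defs
  imports "HOL-Analysis.Analysis"
begin

section \<open>Smoothness\<close>

primrec Ck_on :: "nat \<Rightarrow> 'a::euclidean_space set \<Rightarrow> ('a \<Rightarrow> real) \<Rightarrow> bool" where
  "Ck_on 0 W f \<longleftrightarrow> continuous_on W f"
| "Ck_on (Suc k) W f \<longleftrightarrow>
     f differentiable_on W \<and> (\<forall>b\<in>Basis. Ck_on k W (\<lambda>x. frechet_derivative f (at x) b))"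

text \<open>
  Smoothness up to the boundary of \<open>S\<close>: \<open>f\<close> is already given as a smooth function on an open
  neighbourhood of \<open>S\<close>, so that all its derivatives at points of \<open>S\<close> are the usual ones.
\<close>

definition smooth_near :: "'a::euclidean_space set \<Rightarrow> ('a \<Rightarrow> real) \<Rightarrow> bool" where
  "smooth_near S f \<longleftrightarrow> (\<exists>W. open W \<and> S \<subseteq> W \<and> (\<forall>k. Ck_on k W f))"


section \<open>Extremal Reissner--Nordstroem\<close>

text \<open>
  A point of the manifold $\mathbb{R} \times (0,\infty) \times S^2$ is a triple \<open>(v, r, \<omega>)\<close> with
  \<open>\<omega>\<close> a unit vector of $\mathbb{R}^3$; the same type is used for tangent vectors
  \<open>(X\<^sub>v, X\<^sub>r, X\<^sub>\<omega>)\<close>, with \<open>X\<^sub>\<omega>\<close> orthogonal to \<open>\<omega>\<close>. The round metric on the sphere is the one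
  induced by the inner product.
\<close>

type_synonym point = "real \<times> real \<times> (real^3)"

definition spacetime :: "real \<Rightarrow> point set" where
  "spacetime M = {(v, r, \<omega>). M \<le> r \<and> \<omega> \<in> sphere 0 1}"

definition horizon :: "real \<Rightarrow> point set" where
  "horizon M = {(v, r, \<omega>). r = M \<and> \<omega> \<in> sphere 0 1}"

definition D :: "real \<Rightarrow> real \<Rightarrow> real" where
  "D M r = (r - M)\<^sup>2 / r\<^sup>2"

fun ern_metric :: "real \<Rightarrow> point \<Rightarrow> point \<Rightarrow> point \<Rightarrow> real" where
  "ern_metric M (v, r, \<omega>) (Xv, Xr, X\<omega>) (Zv, Zr, Z\<omega>) =
     - D M r * Xv * Zv + (Xv * Zr + Xr * Zv) + r\<^sup>2 * (X\<omega> \<bullet> Z\<omega>)"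

text \<open>Ingoing Eddington--Finkelstein coordinates \<open>q = (v, r, \<theta>, \<phi>)\<close>.\<close>

definition sph :: "real \<Rightarrow> real \<Rightarrow> real^3" where
  "sph \<theta> \<phi> = vector [sin \<theta> * cos \<phi>, sin \<theta> * sin \<phi>, cos \<theta>]"

definition EF :: "real^4 \<Rightarrow> point" where
  "EF q = (q$1, q$2, sph (q$3) (q$4))"

definition metric_EF :: "real \<Rightarrow> real^4 \<Rightarrow> real^4^4" where
  "metric_EF M q = vector
     [vector [- D M (q$2), 1, 0, 0],
      vector [1, 0, 0, 0],
      vector [0, 0, (q$2)\<^sup>2, 0],
      vector [0, 0, 0, (q$2)\<^sup>2 * (sin (q$3))\<^sup>2]]"

lemma vector_4:
  "(vector [w, x, y, z] :: 'a::zero^4) $ 1 = w"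
  "(vector [w, x, y, z] :: 'a::zero^4) $ 2 = x"
  "(vector [w, x, y, z] :: 'a::zero^4) $ 3 = y"
  "(vector [w, x, y, z] :: 'a::zero^4) $ 4 = z"
  unfolding vector_def by simp_all

text \<open>\<open>metric_EF\<close> consists of the components of \<open>ern_metric\<close> in the coordinate frame.\<close>

lemma EF_has_derivative:
  "(EF has_derivative
     (\<lambda>h. (h$1, h$2, h$3 *\<^sub>R vector [cos (q$3) * cos (q$4), cos (q$3) * sin (q$4), - sin (q$3)]
                   + h$4 *\<^sub>R vector [- sin (q$3) * sin (q$4), sin (q$3) * cos (q$4), 0])))
     (at q)"
proof -
  have nth: "((\<lambda>q::real^4. q $ i) has_derivative (\<lambda>h. h $ i)) (at q)" for i
    by (rule bounded_linear_imp_has_derivative) (rule bounded_linear_vec_nth)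
  have "((\<lambda>q. sph (q$3) (q$4)) has_derivative
     (\<lambda>h. h$3 *\<^sub>R vector [cos (q$3) * cos (q$4), cos (q$3) * sin (q$4), - sin (q$3)]
        + h$4 *\<^sub>R vector [- sin (q$3) * sin (q$4), sin (q$3) * cos (q$4), 0])) (at q)"
  proof (subst has_derivative_componentwise_within, rule ballI)
    fix b :: "real^3" assume "b \<in> Basis"
    then obtain i where b: "b = axis i 1" by (auto simp: Basis_vec_def)
    show "((\<lambda>x. sph (x$3) (x$4) \<bullet> b) has_derivative
      (\<lambda>x. (x$3 *\<^sub>R vector [cos (q$3) * cos (q$4), cos (q$3) * sin (q$4), - sin (q$3)]
        + x$4 *\<^sub>R vector [- sin (q$3) * sin (q$4), sin (q$3) * cos (q$4), 0]) \<bullet> b)) (at q)"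
      using exhaust_3[of i] unfolding b inner_axis sph_def
      by (auto simp: vector_3 fun_eq_iff algebra_simps intro!: derivative_eq_intros nth)
  qed
  then show ?thesis
    unfolding EF_def by (intro has_derivative_Pair nth)
qed

lemma metric_EF_components:
  "metric_EF M q $ i $ j =
     ern_metric M (EF q) (frechet_derivative EF (at q) (axis i 1)) (frechet_derivative EF (at q) (axis j 1))"
proof -
  define dth where "dth = (vector [cos (q$3) * cos (q$4), cos (q$3) * sin (q$4), - sin (q$3)] :: real^3)"
  define dph where "dph = (vector [- sin (q$3) * sin (q$4), sin (q$3) * cos (q$4), 0] :: real^3)"
  have "dth \<bullet> dth = (cos (q$3))\<^sup>2 * ((cos (q$4))\<^sup>2 + (sin (q$4))\<^sup>2) + (sin (q$3))\<^sup>2"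
    unfolding dth_def inner_vec_def sum_3 vector_3 inner_real_def by algebra
  then have 1: "dth \<bullet> dth = 1" by simp
  have "dph \<bullet> dph = (sin (q$3))\<^sup>2 * ((sin (q$4))\<^sup>2 + (cos (q$4))\<^sup>2)"
    unfolding dph_def inner_vec_def sum_3 vector_3 inner_real_def by algebra
  then have 2: "dph \<bullet> dph = (sin (q$3))\<^sup>2" by simp
  have 3: "dth \<bullet> dph = 0" "dph \<bullet> dth = 0"
    unfolding dth_def dph_def inner_vec_def sum_3 vector_3 by simp_all
  have fd: "frechet_derivative EF (at q) = (\<lambda>h. (h$1, h$2, h$3 *\<^sub>R dth + h$4 *\<^sub>R dph))"
    unfolding dth_def dph_def by (rule frechet_derivative_at[OF EF_has_derivative, symmetric])
  have "\<forall>i j. metric_EF M q $ i $ j =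
     ern_metric M (EF q) (frechet_derivative EF (at q) (axis i 1)) (frechet_derivative EF (at q) (axis j 1))"
    unfolding fd forall_4
    by (simp add: EF_def metric_EF_def vector_4 axis_def 1 2 3)
  then show ?thesis by blast
qed


section \<open>The wave operator\<close>

definition pd :: "4 \<Rightarrow> (real^4 \<Rightarrow> real) \<Rightarrow> real^4 \<Rightarrow> real" where
  "pd \<mu> f q = frechet_derivative f (at q) (axis \<mu> 1)"

definition box :: "(real^4 \<Rightarrow> real^4^4) \<Rightarrow> (real^4 \<Rightarrow> real) \<Rightarrow> real^4 \<Rightarrow> real" where
  "box g f q =
     (\<Sum>\<mu>\<in>UNIV. pd \<mu> (\<lambda>p. \<Sum>\<nu>\<in>UNIV. sqrt \<bar>det (g p)\<bar> * matrix_inv (g p) $ \<mu> $ \<nu> * pd \<nu> f p) q)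
       / sqrt \<bar>det (g q)\<bar>"

text \<open>
  The coordinates degenerate at the poles \<open>\<theta> \<in> {0, \<pi>}\<close>. For smooth \<open>\<psi>\<close> the wave equation there is
  equivalent, by continuity, to the wave equation at the neighbouring points.
\<close>

definition solves_wave :: "real \<Rightarrow> point set \<Rightarrow> (point \<Rightarrow> real) \<Rightarrow> bool" where
  "solves_wave M S \<psi> \<longleftrightarrow>
     (\<forall>q. 0 < q$3 \<and> q$3 < pi \<and> EF q \<in> S \<longrightarrow> box (metric_EF M) (\<psi> \<circ> EF) q = 0)"

definition Y :: "(point \<Rightarrow> real) \<Rightarrow> point \<Rightarrow> real" where
  "Y \<psi> = (\<lambda>(v, r, \<omega>). deriv (\<lambda>s. \<psi> (v, s, \<omega>)) r)"


section \<open>Causality\<close>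

text \<open>The time orientation is fixed by the timelike vector field $\partial_v - \partial_r$.\<close>

definition future_causal :: "real \<Rightarrow> point \<Rightarrow> point \<Rightarrow> bool" where
  "future_causal M p X \<longleftrightarrow> ern_metric M p X X \<le> 0 \<and> ern_metric M p X (1, -1, 0) < 0"

definition causal_future :: "real \<Rightarrow> point set \<Rightarrow> point set" where
  "causal_future M S = S \<union>
     {p. \<exists>\<gamma> F. valid_path \<gamma> \<and> pathstart \<gamma> \<in> S \<and> pathfinish \<gamma> = p \<and> path_image \<gamma> \<subseteq> spacetime M \<and>
        finite F \<and> (\<forall>t\<in>{0..1} - F. \<gamma> differentiable (at t) \<and>
                      future_causal M (\<gamma> t) (vector_derivative \<gamma> (at t)))}"


section \<open>The hypersurfaces and the region near the horizon\<close>

text \<open>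
  A spherically symmetric spacelike hypersurface is nowhere tangent to the causal vector field
  $\partial_v$, hence a graph \<open>v = v\<^sub>\<Sigma>(r)\<close>; here it runs from the horizon to infinity.
\<close>

definition Sigma :: "real \<Rightarrow> (real \<Rightarrow> real) \<Rightarrow> point set" where
  "Sigma M v\<^sub>\<Sigma> = {(v, r, \<omega>). M \<le> r \<and> v = v\<^sub>\<Sigma> r \<and> \<omega> \<in> sphere 0 1}"

definition spacelike_graph :: "real \<Rightarrow> (real \<Rightarrow> real) \<Rightarrow> bool" where
  "spacelike_graph M v\<^sub>\<Sigma> \<longleftrightarrow> smooth_near {M..} v\<^sub>\<Sigma> \<and>
     (\<forall>r\<ge>M. \<forall>\<omega>\<in>sphere 0 1. \<forall>a \<xi>. \<xi> \<bullet> \<omega> = 0 \<and> (a, \<xi>) \<noteq> (0, 0) \<longrightarrow>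
        0 < ern_metric M (v\<^sub>\<Sigma> r, r, \<omega>) (a * deriv v\<^sub>\<Sigma> r, a, \<xi>) (a * deriv v\<^sub>\<Sigma> r, a, \<xi>))"

text \<open>
  The induced metric on the graph is $h_{rr}(r)\,dr^2 + r^2 d\sigma_{S^2}$, and it tends to the
  Euclidean metric iff $h_{rr} \to 1$. The usual falloff conditions on the metric (and the second
  fundamental form) of an asymptotically flat hypersurface all imply this one.
\<close>

definition asymptotically_flat_graph :: "real \<Rightarrow> (real \<Rightarrow> real) \<Rightarrow> bool" where
  "asymptotically_flat_graph M v\<^sub>\<Sigma> \<longleftrightarrow> (\<forall>\<omega>\<in>sphere 0 1.
     ((\<lambda>r. ern_metric M (v\<^sub>\<Sigma> r, r, \<omega>) (deriv v\<^sub>\<Sigma> r, 1, 0) (deriv v\<^sub>\<Sigma> r, 1, 0)) \<longlongrightarrow> 1) at_top)"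

text \<open>
  \<open>rs\<close> is a tortoise coordinate \<open>r\<^sub>*\<close>, so that \<open>u = v - 2 * rs r\<close>; the additive constant left
  open by this condition does not affect \<open>Sigma0\<close>.
\<close>

definition tortoise :: "real \<Rightarrow> (real \<Rightarrow> real) \<Rightarrow> bool" where
  "tortoise M rs \<longleftrightarrow> (\<forall>r>M. (rs has_real_derivative 1 / D M r) (at r))"

definition Sigma0 :: "real \<Rightarrow> real \<Rightarrow> real \<Rightarrow> (real \<Rightarrow> real) \<Rightarrow> (real \<Rightarrow> real) \<Rightarrow> point set" where
  "Sigma0 M R R\<^sub>2 v\<^sub>\<Sigma> rs =
     (Sigma M v\<^sub>\<Sigma> \<inter> {(v, r, \<omega>). R \<le> r \<and> r \<le> R\<^sub>2})
   \<union> {(v, r, \<omega>). v = v\<^sub>\<Sigma> R \<and> M \<le> r \<and> r \<le> R \<and> \<omega> \<in> sphere 0 1}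
   \<union> {(v, r, \<omega>). M < r \<and> v - 2 * rs r = v\<^sub>\<Sigma> R\<^sub>2 - 2 * rs R\<^sub>2 \<and> v\<^sub>\<Sigma> R\<^sub>2 \<le> v \<and> \<omega> \<in> sphere 0 1}"

definition region_A :: "real \<Rightarrow> real \<Rightarrow> real \<Rightarrow> (real \<Rightarrow> real) \<Rightarrow> (real \<Rightarrow> real) \<Rightarrow> point set" where
  "region_A M R R\<^sub>2 v\<^sub>\<Sigma> rs =
     causal_future M (Sigma0 M R R\<^sub>2 v\<^sub>\<Sigma> rs) \<inter> {(v, r, \<omega>). M \<le> r \<and> r \<le> R}"

text \<open>
  Compact support of the data. On the null pieces of $\Sigma_0$ the data consist of \<open>\<psi>\<close> only; on
  the spacelike piece they include the normal derivative, but that piece is itself compact.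
\<close>

definition compactly_supported_on :: "point set \<Rightarrow> (point \<Rightarrow> real) \<Rightarrow> bool" where
  "compactly_supported_on S \<psi> \<longleftrightarrow> compact (closure {p \<in> S. \<psi> p \<noteq> 0})"


section \<open>Integration\<close>

text \<open>The measure $d\omega = \sin\theta\,d\theta\,d\varphi$ on the unit sphere.\<close>

definition sphere_measure :: "(real^3) measure" where
  "sphere_measure =
     distr (density lborel
              (\<lambda>(\<theta>, \<phi>). ennreal (sin \<theta>) * indicator ({0..pi} \<times> {0..2*pi}) (\<theta>, \<phi>)))
           borel (\<lambda>(\<theta>, \<phi>). sph \<theta> \<phi>)"

text \<open>The spacetime volume $r^2\,dr\,dv\,d\omega$.\<close>

definition volume_measure :: "point measure" where
  "volume_measure =
     density (lborel \<Otimes>\<^sub>M (lborel \<Otimes>\<^sub>M sphere_measure)) (\<lambda>(v, r, \<omega>). ennreal (r\<^sup>2))"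

text \<open>
  \<open>H[\<psi>]\<close> on the section \<open>v = v\<^sub>0\<close> of the horizon. The integral is restricted to the sphere
  explicitly, since \<open>\<psi>\<close> is unconstrained at \<open>(v, r, x)\<close> with \<open>x\<close> away from the unit sphere.
\<close>

definition horizon_charge :: "real \<Rightarrow> real \<Rightarrow> (point \<Rightarrow> real) \<Rightarrow> real" where
  "horizon_charge M v\<^sub>0 \<psi> =
     (LINT \<omega>:sphere 0 1|sphere_measure. Y \<psi> (v\<^sub>0, M, \<omega>) + 1 / M * \<psi> (v\<^sub>0, M, \<omega>))"

lemma Sigma0_Int_horizon:
  assumes "M < R"
  shows "Sigma0 M R R\<^sub>2 v\<^sub>\<Sigma> rs \<inter> horizon M = {v\<^sub>\<Sigma> R} \<times> {M} \<times> sphere 0 1"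
  using assms by (auto simp: Sigma0_def horizon_def)

end

theory Submission
  imports Defs
begin

text \<open>
  Suppose the integral is finite. The spherical mean \<open>f(v, r)\<close> of \<open>\<psi>\<close> solves
  \<open>2 r\<^sup>2 f\<^sub>v\<^sub>r + 2 r f\<^sub>v + ((r - M)\<^sup>2 f\<^sub>r)\<^sub>r = 0\<close>, so that \<open>2 M\<^sup>2 f\<^sub>r + 2 M f\<close> is constant along the horizon
  and equal to a nonzero multiple of \<open>H[\<psi>]\<close>; moreover \<open>f\<close> vanishes at late times on the outgoing cone
  bounding the domain. The identity
  \<open>(r\<^sup>2 f\<^sub>v\<^sup>2 + (r - M)\<^sup>2 f\<^sub>v f\<^sub>r)\<^sub>r = (r - M)\<^sup>2 f\<^sub>r f\<^sub>v\<^sub>r\<close> makes the integral of \<open>(r - M)\<^sup>2 f\<^sub>r\<^sup>2\<close> over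
  \<open>v = const\<close> a decreasing energy. It bounds \<open>f\<close> by a multiple of \<open>(r - M)\<^bsup>-1/2\<^esup>\<close> and, together with the
  flux through the horizon, shows that the average of \<open>f(v, R)\<close> over \<open>T \<le> v \<le> 2 T\<close> tends to zero.

  Let \<open>G\<close> be the primitive in \<open>r\<close> of \<open>2 r\<^sup>2 f\<^sub>r + 2 r f\<close> that vanishes at \<open>r = M\<close>, and let
  \<open>N(v)\<close> be the integral of \<open>G\<close> over the layer \<open>M \<le> r \<le> M + x\<close>. At a fixed time \<open>N\<close> is asymptotic to the horizon charge times \<open>x\<^sup>2 / 2\<close> as
  \<open>x \<longlonglongrightarrow> 0\<close>. With \<open>x = 1 / T\<close>, the square integrability of \<open>f\<^sub>r\<close> implies that \<open>N\<close> changes by only a small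
  multiple of \<open>x\<^sup>2\<close> until the time \<open>2 T\<close>, whereas its average over \<open>T \<le> v \<le> 2 T\<close> is comparable to \<open>x\<^sup>2\<close>
  times the average of \<open>f(v, R)\<close>, hence \<open>o(x\<^sup>2)\<close>: a contradiction.
\<close>

section \<open>Integrals depending on a parameter\<close>

text \<open>Two obstacles shape the argument. The energy carries the weight (r - M)^2 and says
  nothing about \<open>fr\<close> at the horizon; the assumed bound on \<open>fr\<close> does reach
  the horizon, but as a spacetime integral it gives nothing at a single radius or a single time. The
  time derivative of \<open>G\<close> is -(r - M)^2 \<open>fr\<close> at one radius, out of reach of
  that bound. Integrating over a layer of width x makes it a layer integral with a weight at most
  x^2, the size of \<open>N\<close> itself. By Cauchy-Schwarz the integral of |\<open>fr\<close>|
  over a layer of width x and duration of order T is at most a multiple of sqrt (x T) times an L2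
  norm, so x = 1 / T is the scale at which the drift is small as soon as the remaining L2 norm is.
  At the other end \<open>N\<close> is compared with \<open>f\<close> at \<open>R\<close> through
  integrals of |\<open>fr\<close>| as well, which is why only time averages occur. The horizon value
  of \<open>f\<close> may grow, but the finite flux limits it to o(v); integrated over a bounded
  range of radii this still gives o(T), and at a large radius \<open>f\<close> itself is
  small.\<close>

lemma integral_mono_continuous:
  fixes f g :: "real \<Rightarrow> real"
  assumes "continuous_on {a..b} f" "continuous_on {a..b} g" "\<And>x. x \<in> {a..b} \<Longrightarrow> f x \<le> g x"
  shows "integral {a..b} f \<le> integral {a..b} g"
  using assms by (intro integral_le integrable_continuous_real) auto

lemma abs_integral_le:
  fixes f g :: "real \<Rightarrow> real"
  assumes "continuous_on {a..b} f" "continuous_on {a..b} g" "\<And>x. x \<in> {a..b} \<Longrightarrow> \<bar>f x\<bar> \<le> g x"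
  shows "\<bar>integral {a..b} f\<bar> \<le> integral {a..b} g"
  using integral_norm_bound_integral[of f "{a..b}" g] assms
  by (auto intro: integrable_continuous_real)

lemma integral_FTC:
  fixes f :: "real \<Rightarrow> real"
  assumes "a \<le> b" "\<And>x. x \<in> {a..b} \<Longrightarrow> (f has_real_derivative f' x) (at x within {a..b})"
  shows "integral {a..b} f' = f b - f a"
  using fundamental_theorem_of_calculus[of a b f f'] assms
  by (auto simp: has_real_derivative_iff_has_vector_derivative intro: integral_unique)

text \<open>Takes the place of Cauchy-Schwarz throughout: the weight \<open>l\<close> stays free
  until the two terms have to be balanced.\<close>

lemma weighted_AM_GM:
  fixes x l :: real
  assumes "0 < l"
  shows "\<bar>x\<bar> \<le> l / 2 * x\<^sup>2 + 1 / (2 * l)"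
proof -
  have "0 \<le> (l * \<bar>x\<bar> - 1)\<^sup>2 / (2 * l)" using assms by simp
  also have "\<dots> = l / 2 * x\<^sup>2 + 1 / (2 * l) - \<bar>x\<bar>"
    using assms by (simp add: power2_eq_square field_simps)
  finally show ?thesis by simp
qed

lemma abs_integral_le_L2:
  fixes f :: "real \<Rightarrow> real"
  assumes "continuous_on {a..b} f" "0 < l" "a \<le> b"
  shows "integral {a..b} (\<lambda>x. \<bar>f x\<bar>) \<le> l / 2 * integral {a..b} (\<lambda>x. (f x)\<^sup>2) + (b - a) / (2 * l)"
proof -
  have "integral {a..b} (\<lambda>x. \<bar>f x\<bar>) \<le> integral {a..b} (\<lambda>x. l / 2 * (f x)\<^sup>2 + 1 / (2 * l))"
    using assms by (intro integral_mono_continuous continuous_intros weighted_AM_GM) auto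
  also have "\<dots> = integral {a..b} (\<lambda>x. l / 2 * (f x)\<^sup>2) + integral {a..b} (\<lambda>x. 1 / (2 * l))"
    using assms by (intro integral_add integrable_continuous_real continuous_intros) auto
  finally show ?thesis using assms by simp
qed

text \<open>The increment splits in two: at a fixed endpoint one differentiates under the integral;
  the remaining integral between \<open>\<rho> v\<close> and \<open>\<rho> w\<close> equals, by the
  mean value theorem, its width times the value of \<open>k w\<close> at a point squeezed to
  \<open>\<rho> v\<close>.\<close>

lemma has_real_derivative_integral_moving_endpoint:
  fixes k k' :: "real \<Rightarrow> real \<Rightarrow> real"
  assumes "open U"
    and k: "continuous_on U (\<lambda>(v, r). k v r)" and k': "continuous_on U (\<lambda>(v, r). k' v r)"
    and deriv: "\<And>v r. (v, r) \<in> U \<Longrightarrow> ((\<lambda>v. k v r) has_real_derivative k' v r) (at v)"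
    and sub: "{v} \<times> {a..\<rho> v} \<subseteq> U" and "a < \<rho> v"
    and \<rho>: "(\<rho> has_real_derivative \<rho>') (at v)"
  shows "((\<lambda>v. integral {a..\<rho> v} (k v)) has_real_derivative
           integral {a..\<rho> v} (k' v) + \<rho>' * k v (\<rho> v)) (at v)"
proof -
  have "(v, \<rho> v) \<in> U" using sub \<open>a < \<rho> v\<close> by auto
  then obtain e where e: "0 < e" "ball (v, \<rho> v) e \<subseteq> U"
    using \<open>open U\<close> open_contains_ball by blast
  \<comment> \<open>Room beyond \<open>\<rho> v\<close>: for \<open>w\<close> near \<open>v\<close>
    the endpoint \<open>\<rho> w\<close> may be the larger one, and \<open>k w\<close> must still be
    continuous up to there.\<close>
  define c where "c = \<rho> v + e / 2"
  have c: "\<rho> v < c" using e by (simp add: c_def)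
  have "(v, r) \<in> U" if "r \<in> {a..c}" for r
  proof (cases "r \<le> \<rho> v")
    case True then show ?thesis using sub that by auto
  next
    case False
    then have "(v, r) \<in> ball (v, \<rho> v) e"
      using that e(1) by (auto simp: dist_Pair_Pair dist_real_def c_def)
    then show ?thesis using e by auto
  qed
  then have "{v} \<times> {a..c} \<subseteq> U" by auto
  from Elementary_Topology.tube_lemma[OF compact_Icc \<open>open U\<close> this]
  obtain X where X: "open X" "v \<in> X" "X \<times> {a..c} \<subseteq> U" by (elim exE conjE)
  obtain d where d: "0 < d" "ball v d \<subseteq> X"
    using X(1,2) unfolding open_contains_ball by metis
  have box: "(w, r) \<in> U" if "w \<in> ball v d" "r \<in> {a..c}" for w r using that d X by blast
  have kc: "continuous_on {a..c} (k w)" if "w \<in> ball v d" for w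
  proof -
    have "continuous_on {a..c} (\<lambda>r. (\<lambda>(v, r). k v r) (w, r))"
      by (rule continuous_on_compose2[OF k]) (use box that in \<open>auto intro!: continuous_intros\<close>)
    then show ?thesis by simp
  qed
  have fixed: "((\<lambda>w. integral {a..\<rho> v} (k w)) has_real_derivative integral {a..\<rho> v} (k' v)) (at v)"
  proof -
    have "((\<lambda>w. integral (cbox a (\<rho> v)) (k w)) has_real_derivative integral (cbox a (\<rho> v)) (k' v))
            (at v within ball v d)"
    proof (rule leibniz_rule_field_derivative)
      show "((\<lambda>x. k x t) has_real_derivative k' w t) (at w within ball v d)"
        if "w \<in> ball v d" "t \<in> cbox a (\<rho> v)" for w t
        using deriv[OF box] that c by (auto intro: has_field_derivative_at_within)
      show "k w integrable_on cbox a (\<rho> v)" if "w \<in> ball v d" for w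
        using kc[OF that] c
        by (auto intro!: integrable_continuous_real intro: continuous_on_subset)
      show "continuous_on (ball v d \<times> cbox a (\<rho> v)) (\<lambda>(x, t). k' x t)"
        using k' by (rule continuous_on_subset) (use box c in auto)
    qed (use d in auto)
    then show ?thesis using d by (simp add: at_within_open[OF _ open_ball])
  qed
  \<comment> \<open>The thin strip with \<open>w\<close> frozen. Both orders of
    \<open>\<rho> v\<close> and \<open>\<rho> w\<close> occur, since \<open>\<rho>\<close> is only
    known to be differentiable at \<open>v\<close>.\<close>
  have "\<exists>\<xi>. \<xi> \<in> closed_segment (\<rho> v) (\<rho> w) \<and>
          integral {a..\<rho> w} (k w) - integral {a..\<rho> v} (k w) = (\<rho> w - \<rho> v) * k w \<xi>"
    if w: "w \<in> ball v d" "\<rho> w \<in> {a<..<c}" for w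
  proof -
    define K where "K x = integral {a..x} (k w)" for x
    have K: "(K has_real_derivative k w x) (at x)" if "x \<in> {a<..<c}" for x
    proof -
      have "(K has_real_derivative k w x) (at x within {a..c})"
        unfolding K_def using that by (intro integral_has_real_derivative kc w) auto
      then show ?thesis using that by (simp add: at_within_Icc_at)
    qed
    consider "\<rho> w = \<rho> v" | "\<rho> w < \<rho> v" | "\<rho> v < \<rho> w" by linarith
    then show ?thesis
    proof cases
      case 1 then show ?thesis by auto
    next
      case 2
      obtain z where "\<rho> w < z" "z < \<rho> v" "K (\<rho> v) - K (\<rho> w) = (\<rho> v - \<rho> w) * k w z"
        using MVT2[OF 2, of K "k w"] K w c \<open>a < \<rho> v\<close> by force
      then show ?thesis
        using 2 by (intro exI[of _ z]) (auto simp: closed_segment_eq_real_ivl K_def algebra_simps)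
    next
      case 3
      obtain z where "\<rho> v < z" "z < \<rho> w" "K (\<rho> w) - K (\<rho> v) = (\<rho> w - \<rho> v) * k w z"
        using MVT2[OF 3, of K "k w"] K w c \<open>a < \<rho> v\<close> by force
      then show ?thesis
        using 3 by (intro exI[of _ z]) (auto simp: closed_segment_eq_real_ivl K_def)
    qed
  qed
  then obtain \<xi> where \<xi>: "\<xi> w \<in> closed_segment (\<rho> v) (\<rho> w)"
    "integral {a..\<rho> w} (k w) - integral {a..\<rho> v} (k w) = (\<rho> w - \<rho> v) * k w (\<xi> w)"
    if "w \<in> ball v d" "\<rho> w \<in> {a<..<c}" for w by metis
  have \<rho>_lim: "(\<rho> \<longlongrightarrow> \<rho> v) (at v)"
    using DERIV_isCont[OF \<rho>] by (simp add: isCont_def)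
  have near: "\<forall>\<^sub>F w in at v. w \<in> ball v d \<and> \<rho> w \<in> {a<..<c}"
    using \<rho>_lim d \<open>a < \<rho> v\<close> c
    by (intro eventually_conj topological_tendstoD[OF \<rho>_lim] eventually_at_in_open') auto
  have "(\<xi> \<longlongrightarrow> \<rho> v) (at v)"
  proof (rule Lim_null_comparison[of "\<lambda>w. \<xi> w - \<rho> v" "\<lambda>w. \<bar>\<rho> w - \<rho> v\<bar>" "at v", THEN LIM_zero_cancel])
    show "\<forall>\<^sub>F w in at v. norm (\<xi> w - \<rho> v) \<le> \<bar>\<rho> w - \<rho> v\<bar>"
      using near by eventually_elim (use \<xi>(1) in \<open>fastforce simp: closed_segment_eq_real_ivl split: if_splits\<close>)
    show "((\<lambda>w. \<bar>\<rho> w - \<rho> v\<bar>) \<longlongrightarrow> 0) (at v)"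
      using \<rho>_lim by (auto intro!: tendsto_eq_intros)
  qed
  then have "((\<lambda>w. (w, \<xi> w)) \<longlongrightarrow> (v, \<rho> v)) (at v)" by (intro tendsto_intros)
  moreover have "isCont (\<lambda>(v, r). k v r) (v, \<rho> v)"
    using k \<open>open U\<close> \<open>(v, \<rho> v) \<in> U\<close> by (simp add: continuous_on_eq_continuous_at)
  ultimately have "((\<lambda>w. k w (\<xi> w)) \<longlongrightarrow> k v (\<rho> v)) (at v)"
    using isCont_tendsto_compose by fastforce
  moreover have "((\<lambda>w. (\<rho> w - \<rho> v) / (w - v)) \<longlongrightarrow> \<rho>') (at v)"
    using \<rho> by (simp add: has_field_derivative_iff)
  ultimately have "((\<lambda>w. (\<rho> w - \<rho> v) / (w - v) * k w (\<xi> w)) \<longlongrightarrow> \<rho>' * k v (\<rho> v)) (at v)"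
    by (intro tendsto_mult)
  then have "((\<lambda>w. (integral {a..\<rho> w} (k w) - integral {a..\<rho> v} (k w)) / (w - v)) \<longlongrightarrow> \<rho>' * k v (\<rho> v)) (at v)"
    by (rule Lim_transform_eventually) (use near in eventually_elim, simp add: \<xi>)
  then have "((\<lambda>w. integral {a..\<rho> w} (k w) - integral {a..\<rho> v} (k w)) has_real_derivative \<rho>' * k v (\<rho> v)) (at v)"
    by (simp add: has_field_derivative_iff)
  from DERIV_add[OF fixed this] show ?thesis by simp
qed

section \<open>The spherically symmetric equation near the horizon\<close>

text \<open>\<open>U\<close> is open and contains the horizon and the cone, so two-sided derivatives
  are available at \<open>r = M\<close> and at \<open>r = \<rho> v\<close>. The slope of
  \<open>\<rho>\<close> is half of \<open>D M (\<rho> v)\<close>, that of an outgoing null ray, and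
  \<open>v0\<close> lies after the support of the data on the cone; \<open>v0_nonneg\<close> lets
  growth bounds be stated in \<open>v\<close> itself.\<close>

locale horizon_energy =
  fixes M R v0 :: real and \<rho> :: "real \<Rightarrow> real" and U :: "(real \<times> real) set"
    and f fv fr fvr frr :: "real \<Rightarrow> real \<Rightarrow> real"
  assumes M_pos: "0 < M" and M_less_R: "M < R" and v0_nonneg: "0 \<le> v0"
    and open_U: "open U"
    and region: "\<And>v r. v0 \<le> v \<Longrightarrow> M \<le> r \<Longrightarrow> r \<le> \<rho> v \<Longrightarrow> (v, r) \<in> U"
    and \<rho>_deriv: "\<And>v. v0 \<le> v \<Longrightarrow> (\<rho> has_real_derivative (\<rho> v - M)\<^sup>2 / (2 * (\<rho> v)\<^sup>2)) (at v)"
    and R_less_\<rho>: "R < \<rho> v0"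
    and \<rho>_at_top: "filterlim \<rho> at_top at_top"
    and cont_f: "continuous_on U (\<lambda>(v, r). f v r)"
    and cont_fv: "continuous_on U (\<lambda>(v, r). fv v r)"
    and cont_fr: "continuous_on U (\<lambda>(v, r). fr v r)"
    and cont_fvr: "continuous_on U (\<lambda>(v, r). fvr v r)"
    and cont_frr: "continuous_on U (\<lambda>(v, r). frr v r)"
    and deriv_f_v: "\<And>v r. (v, r) \<in> U \<Longrightarrow> ((\<lambda>v. f v r) has_real_derivative fv v r) (at v)"
    and deriv_f_r: "\<And>v r. (v, r) \<in> U \<Longrightarrow> ((\<lambda>r. f v r) has_real_derivative fr v r) (at r)"
    and deriv_fr_v: "\<And>v r. (v, r) \<in> U \<Longrightarrow> ((\<lambda>v. fr v r) has_real_derivative fvr v r) (at v)"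
    and deriv_fv_r: "\<And>v r. (v, r) \<in> U \<Longrightarrow> ((\<lambda>r. fv v r) has_real_derivative fvr v r) (at r)"
    and deriv_fr_r: "\<And>v r. (v, r) \<in> U \<Longrightarrow> ((\<lambda>r. fr v r) has_real_derivative frr v r) (at r)"
    and wave: "\<And>v r. v0 \<le> v \<Longrightarrow> M \<le> r \<Longrightarrow> r \<le> \<rho> v \<Longrightarrow>
      2 * r\<^sup>2 * fvr v r + 2 * r * fv v r + (r - M)\<^sup>2 * frr v r + 2 * (r - M) * fr v r = 0"
    and zero: "\<And>v. v0 \<le> v \<Longrightarrow> f v (\<rho> v) = 0"
begin

section \<open>Continuity and integration on the region below the outgoing cone\<close>

lemma \<rho>_mono: "v0 \<le> v \<Longrightarrow> v \<le> w \<Longrightarrow> \<rho> v \<le> \<rho> w"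
  by (rule DERIV_nonneg_imp_nondecreasing[of v w \<rho>]) (auto intro!: exI \<rho>_deriv)

lemma R_less_\<rho>': "v0 \<le> v \<Longrightarrow> R < \<rho> v"
  using \<rho>_mono[of v0 v] R_less_\<rho> by simp

lemma cont_r:
  assumes "continuous_on U (\<lambda>(v, r). k v r)" "v0 \<le> v" "M \<le> a" "c \<le> \<rho> v"
  shows "continuous_on {a..c} (k v)"
proof -
  have "continuous_on {a..c} (\<lambda>r. (\<lambda>(v, r). k v r) (v, r))"
    by (rule continuous_on_compose2[OF assms(1)]) (use assms region in \<open>auto intro!: continuous_intros\<close>)
  then show ?thesis by simp
qed

lemma cont_v:
  assumes "continuous_on U (\<lambda>(v, r). k v r)" "v0 \<le> a" "M \<le> r" "r \<le> \<rho> a"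
  shows "continuous_on {a..b} (\<lambda>v. k v r)"
proof -
  have "continuous_on {a..b} (\<lambda>v. (\<lambda>(v, r). k v r) (v, r))"
    by (rule continuous_on_compose2[OF assms(1)])
       (use assms region \<rho>_mono[of a] in \<open>fastforce intro!: continuous_intros\<close>)+
  then show ?thesis by simp
qed

lemma rectangle:
  assumes "v0 \<le> a" "M \<le> l" "c \<le> \<rho> a"
  shows "{a..b} \<times> {l..c} \<subseteq> U"
  using assms region \<rho>_mono[of a] by fastforce

lemma cont_integral_r:
  fixes k :: "real \<Rightarrow> real \<Rightarrow> real"
  assumes "continuous_on U (\<lambda>(v, r). k v r)" "v0 \<le> a" "M \<le> l" "c \<le> \<rho> a"
  shows "continuous_on {a..b} (\<lambda>v. integral {l..c} (k v))"
proof -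
  have "continuous_on ({a..b} \<times> cbox l c) (\<lambda>(v, r). k v r)"
    using assms(1) by (rule continuous_on_subset) (use rectangle[OF assms(2-4)] in auto)
  from integral_continuous_on_param[OF this] show ?thesis by simp
qed

lemma deriv_integral_r:
  assumes "continuous_on U (\<lambda>(v, r). k v r)" "continuous_on U (\<lambda>(v, r). k' v r)"
    and "\<And>v r. (v, r) \<in> U \<Longrightarrow> ((\<lambda>v. k v r) has_real_derivative k' v r) (at v)"
    and "v0 \<le> a" "M \<le> l" "c \<le> \<rho> a" "v \<in> {a..b}"
  shows "((\<lambda>v. integral {l..c} (k v)) has_real_derivative integral {l..c} (k' v)) (at v within {a..b})"
proof -
  note sub = rectangle[OF assms(4-6), of b]
  have "((\<lambda>v. integral (cbox l c) (k v)) has_real_derivative integral (cbox l c) (k' v))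
      (at v within {a..b})"
  proof (rule leibniz_rule_field_derivative)
    show "((\<lambda>x. k x t) has_real_derivative k' w t) (at w within {a..b})"
      if "w \<in> {a..b}" "t \<in> cbox l c" for w t
      using that sub by (intro has_field_derivative_at_within[OF assms(3)]) auto
    show "k w integrable_on cbox l c" if "w \<in> {a..b}" for w
      using cont_r[OF assms(1), of w l c] assms that \<rho>_mono[of a w]
      by (auto intro!: integrable_continuous_real)
    show "continuous_on ({a..b} \<times> cbox l c) (\<lambda>(x, t). k' x t)"
      using assms(2) by (rule continuous_on_subset) (use sub in auto)
  qed (use assms in auto)
  then show ?thesis by simp
qed

lemma FTC_r:
  assumes "\<And>v r. (v, r) \<in> U \<Longrightarrow> ((\<lambda>r. k v r) has_real_derivative k' v r) (at r)"
    and "v0 \<le> v" "M \<le> a" "a \<le> c" "c \<le> \<rho> v"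
  shows "integral {a..c} (k' v) = k v c - k v a"
  using assms region by (intro integral_FTC has_field_derivative_at_within[OF assms(1)]) auto

text \<open>Up to a constant factor, the flux through \<open>v = const\<close> of the energy current
  of the Killing field of \<open>v\<close>-translations: the natural weight is r^2 times
  \<open>D\<close>, that is (r - M)^2. Its double zero is the degeneracy of the extremal
  horizon.\<close>

definition E :: "real \<Rightarrow> real" where
  "E v = integral {M..\<rho> v} (\<lambda>r. (r - M)\<^sup>2 * (fr v r)\<^sup>2)"

lemma E_nonneg: "v0 \<le> v \<Longrightarrow> 0 \<le> E v"
  unfolding E_def
  by (intro integral_nonneg integrable_continuous_real continuous_intros cont_r[OF cont_fr]) auto

text \<open>This is the derivative of \<open>f v (\<rho> v) = 0\<close> along the cone. On the cone
  \<open>f\<close> is written as its horizon value plus the integral of \<open>fr\<close> up to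
  \<open>\<rho> v\<close>, so the moving endpoint rule replaces a chain rule in two variables.
  Strictness of \<open>v0 < v\<close> gives vanishing on both sides of \<open>v\<close>.\<close>

lemma fv_at_cone:
  assumes "v0 < v"
  shows "fv v (\<rho> v) = - (\<rho> v - M)\<^sup>2 / (2 * (\<rho> v)\<^sup>2) * fr v (\<rho> v)"
proof -
  let ?d = "(\<rho> v - M)\<^sup>2 / (2 * (\<rho> v)\<^sup>2)"
  have \<rho>: "M < \<rho> w" if "v0 \<le> w" for w using R_less_\<rho>'[of w] M_less_R that by auto
  have d: "((\<lambda>w. f w M + integral {M..\<rho> w} (fr w)) has_real_derivative
          fv v M + (integral {M..\<rho> v} (fvr v) + ?d * fr v (\<rho> v))) (at v)"
    using assms region \<rho>[of v]
    by (intro DERIV_add deriv_f_v deriv_fr_v \<rho>_deriv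
         has_real_derivative_integral_moving_endpoint[OF open_U cont_fr cont_fvr]) auto
  have i: "integral {M..\<rho> v} (fvr v) = fv v (\<rho> v) - fv v M"
    using assms \<rho>[of v] by (intro FTC_r deriv_fv_r) auto
  have "\<forall>\<^sub>F w in nhds v. f w M + integral {M..\<rho> w} (fr w) = 0"
    using eventually_nhds_in_open[OF open_greaterThan, of v v0]
  proof (rule eventually_mono)
    show "f w M + integral {M..\<rho> w} (fr w) = 0" if "w \<in> {v0<..}" for w
      using that FTC_r[of f fr w M "\<rho> w", OF deriv_f_r] \<rho>[of w] zero[of w] by auto
  qed (use assms in auto)
  then have "((\<lambda>w. 0) has_real_derivative
      fv v M + (integral {M..\<rho> v} (fvr v) + ?d * fr v (\<rho> v))) (at v)"
    using d by (subst (asm) DERIV_cong_ev[OF refl _ refl])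
  from DERIV_unique[OF this DERIV_const] show ?thesis unfolding i by simp
qed

text \<open>Multiplying the wave equation by \<open>2 * fv\<close> turns the integrand of the
  derivative into a total \<open>r\<close>-derivative. At the cone its boundary term and the term
  from the moving endpoint cancel by \<open>fv_at_cone\<close>, because the cone is null and
  \<open>f\<close> vanishes on it; the flux through the horizon is all that is left.\<close>

lemma E_deriv:
  assumes "v0 < v"
  shows "(E has_real_derivative - 2 * M\<^sup>2 * (fv v M)\<^sup>2) (at v)"
proof -
  let ?d = "(\<rho> v - M)\<^sup>2 / (2 * (\<rho> v)\<^sup>2)"
  have \<rho>: "M < \<rho> v" "0 < \<rho> v" using R_less_\<rho>'[of v] M_less_R M_pos assms by auto
  have c1: "continuous_on U (\<lambda>(v, r). (r - M)\<^sup>2 * (fr v r)\<^sup>2)"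
    using cont_fr unfolding case_prod_beta by (intro continuous_intros)
  have c2: "continuous_on U (\<lambda>(v, r). (r - M)\<^sup>2 * (2 * fr v r * fvr v r))"
    using cont_fr cont_fvr unfolding case_prod_beta by (intro continuous_intros)
  have "(E has_real_derivative integral {M..\<rho> v} (\<lambda>r. (r - M)\<^sup>2 * (2 * fr v r * fvr v r))
          + ?d * ((\<rho> v - M)\<^sup>2 * (fr v (\<rho> v))\<^sup>2)) (at v)"
    unfolding E_def
    using assms region \<rho>
    by (intro has_real_derivative_integral_moving_endpoint[OF open_U c1 c2])
       (auto intro!: derivative_eq_intros deriv_fr_v \<rho>_deriv)
  moreover have "integral {M..\<rho> v} (\<lambda>r. (r - M)\<^sup>2 * (2 * fr v r * fvr v r)) =
     2 * ((\<rho> v)\<^sup>2 * (fv v (\<rho> v))\<^sup>2 + (\<rho> v - M)\<^sup>2 * fv v (\<rho> v) * fr v (\<rho> v)) - 2 * M\<^sup>2 * (fv v M)\<^sup>2"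
  proof (subst integral_FTC[where f="\<lambda>r. 2 * (r\<^sup>2 * (fv v r)\<^sup>2 + (r - M)\<^sup>2 * fv v r * fr v r)"])
    fix r assume r: "r \<in> {M..\<rho> v}"
    then have "(v, r) \<in> U" using region assms by auto
    have "((\<lambda>r. 2 * (r\<^sup>2 * (fv v r)\<^sup>2 + (r - M)\<^sup>2 * fv v r * fr v r)) has_real_derivative
        2 * (2 * r * (fv v r)\<^sup>2 + r\<^sup>2 * (2 * fv v r * fvr v r) + 2 * (r - M) * fv v r * fr v r
         + (r - M)\<^sup>2 * (fvr v r * fr v r + fv v r * frr v r))) (at r within {M..\<rho> v})"
      using \<open>(v, r) \<in> U\<close>
      by (auto intro!: derivative_eq_intros has_field_derivative_at_within[OF deriv_fv_r]
           has_field_derivative_at_within[OF deriv_fr_r] simp: algebra_simps power2_eq_square)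
    moreover have "2 * (2 * r * (fv v r)\<^sup>2 + r\<^sup>2 * (2 * fv v r * fvr v r) + 2 * (r - M) * fv v r * fr v r
         + (r - M)\<^sup>2 * (fvr v r * fr v r + fv v r * frr v r)) = (r - M)\<^sup>2 * (2 * fr v r * fvr v r)
         + 2 * fv v r * (2 * r\<^sup>2 * fvr v r + 2 * r * fv v r + (r - M)\<^sup>2 * frr v r + 2 * (r - M) * fr v r)"
      by algebra
    ultimately show "((\<lambda>r. 2 * (r\<^sup>2 * (fv v r)\<^sup>2 + (r - M)\<^sup>2 * fv v r * fr v r)) has_real_derivative
        (r - M)\<^sup>2 * (2 * fr v r * fvr v r)) (at r within {M..\<rho> v})"
      using wave[of v r] assms r by simp
  qed (use \<rho> in \<open>auto\<close>)
  moreover have "2 * ((\<rho> v)\<^sup>2 * (fv v (\<rho> v))\<^sup>2 + (\<rho> v - M)\<^sup>2 * fv v (\<rho> v) * fr v (\<rho> v))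
      + ?d * ((\<rho> v - M)\<^sup>2 * (fr v (\<rho> v))\<^sup>2) = 0"
    unfolding fv_at_cone[OF assms] using \<rho> by (simp add: field_simps power2_eq_square)
  ultimately show ?thesis by (elim DERIV_cong) linarith
qed


text \<open>\<open>E_deriv\<close> holds for times strictly after \<open>v0\<close>, while the
  balance law is integrated over a closed interval; hence the shift by one.\<close>

abbreviation w0 :: real where "w0 \<equiv> v0 + 1"

lemma E_balance:
  assumes "w0 \<le> v"
  shows "E v + 2 * M\<^sup>2 * integral {w0..v} (\<lambda>v. (fv v M)\<^sup>2) = E w0"
proof -
  have "integral {w0..v} (\<lambda>v. - 2 * M\<^sup>2 * (fv v M)\<^sup>2) = E v - E w0"
    using assms by (intro integral_FTC has_field_derivative_at_within[OF E_deriv]) auto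
  then show ?thesis by simp
qed

section \<open>Bounds for f away from the horizon and along it\<close>

lemma flux_bound:
  assumes "w0 \<le> v"
  shows "2 * M\<^sup>2 * integral {w0..v} (\<lambda>v. (fv v M)\<^sup>2) \<le> E w0"
  using E_balance[OF assms] E_nonneg[of v] assms by simp

lemma E_le:
  assumes "w0 \<le> v"
  shows "E v \<le> E w0"
proof -
  have "0 \<le> integral {w0..v} (\<lambda>v. (fv v M)\<^sup>2)"
    using R_less_\<rho>'[of w0] M_less_R
    by (intro integral_nonneg integrable_continuous_real continuous_intros cont_v[OF cont_fv]) auto
  then show ?thesis using E_balance[OF assms] by (simp add: algebra_simps) (smt (verit) mult_nonneg_nonneg zero_le_power2)
qed

lemma E_w0_nonneg: "0 \<le> E w0" by (rule E_nonneg) simp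

lemma weighted_integral_le_E:
  assumes "w0 \<le> v" "M \<le> a" "a \<le> c" "c \<le> \<rho> v"
  shows "integral {a..c} (\<lambda>r. (r - M)\<^sup>2 * (fr v r)\<^sup>2) \<le> E w0"
proof -
  have "integral {a..c} (\<lambda>r. (r - M)\<^sup>2 * (fr v r)\<^sup>2) \<le> E v"
    unfolding E_def using assms
    by (intro integral_subset_le integrable_continuous_real continuous_intros cont_r[OF cont_fr]) auto
  then show ?thesis using E_le[OF assms(1)] by simp
qed

text \<open>Integrate \<open>fr\<close> inwards from the cone, where \<open>f\<close> vanishes. The
  energy controls (s - M) \<open>fr\<close> in L2, and the inverse weight 1 / (s - M)^2 has integral
  at most 1 / (r - M).\<close>

lemma abs_f_le:
  assumes "w0 \<le> v" "M < r" "r \<le> \<rho> v"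
  shows "\<bar>f v r\<bar> \<le> (E w0 + 1) / (2 * sqrt (r - M))"
proof -
  \<comment> \<open>Balances the two halves: both \<open>e / 2\<close> and 1 / (2 e (r - M)) become
    1 / (2 sqrt (r - M)).\<close>
  define e where "e = 1 / sqrt (r - M)"
  have "0 < e" using assms by (simp add: e_def)
  have cfr: "continuous_on {r..\<rho> v} (fr v)" using assms by (intro cont_r[OF cont_fr]) auto
  have "integral {r..\<rho> v} (fr v) = f v (\<rho> v) - f v r"
    using assms by (intro FTC_r deriv_f_r) auto
  then have "\<bar>f v r\<bar> = \<bar>integral {r..\<rho> v} (fr v)\<bar>" using zero[of v] assms by simp
  also have "\<dots> \<le> integral {r..\<rho> v} (\<lambda>s. e / 2 * ((s - M)\<^sup>2 * (fr v s)\<^sup>2) + 1 / (2 * e) * (1 / (s - M)\<^sup>2))"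
  proof (intro abs_integral_le continuous_intros cfr)
    fix s assume s: "s \<in> {r..\<rho> v}"
    then have "0 < e * (s - M)\<^sup>2" using assms \<open>0 < e\<close> by auto
    from weighted_AM_GM[OF this, of "fr v s"]
    show "\<bar>fr v s\<bar> \<le> e / 2 * ((s - M)\<^sup>2 * (fr v s)\<^sup>2) + 1 / (2 * e) * (1 / (s - M)\<^sup>2)"
      by simp
  qed (use assms \<open>0 < e\<close> in auto)
  also have "\<dots> = e / 2 * integral {r..\<rho> v} (\<lambda>s. (s - M)\<^sup>2 * (fr v s)\<^sup>2)
                  + 1 / (2 * e) * integral {r..\<rho> v} (\<lambda>s. 1 / (s - M)\<^sup>2)"
    using assms \<open>0 < e\<close>
    by (subst integral_add)
       (auto simp del: times_divide_eq_right times_divide_eq_left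
          intro!: integrable_continuous_real continuous_intros cfr)
  also have "integral {r..\<rho> v} (\<lambda>s. 1 / (s - M)\<^sup>2) = - 1 / (\<rho> v - M) - - 1 / (r - M)"
    using assms
    by (intro integral_FTC) (auto intro!: derivative_eq_intros simp: power2_eq_square)
  also have "\<dots> \<le> 1 / (r - M)" using assms by simp
  also have "integral {r..\<rho> v} (\<lambda>s. (s - M)\<^sup>2 * (fr v s)\<^sup>2) \<le> E w0"
    using assms by (intro weighted_integral_le_E) auto
  finally have "\<bar>f v r\<bar> \<le> e / 2 * E w0 + 1 / (2 * e) * (1 / (r - M))"
    using \<open>0 < e\<close> by (simp add: divide_right_mono)
  also have "(1 / (r - M)) = e * e" using assms by (simp add: e_def)
  finally show ?thesis using \<open>0 < e\<close> by (simp add: e_def field_simps)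
qed

text \<open>The flux bounds the L2 norm of \<open>fv\<close> along the horizon, so the horizon value
  grows at most like the square root of time. The free \<open>l\<close> expresses this as linear
  growth with a slope as small as desired.\<close>

lemma abs_f_horizon_le:
  assumes "w0 \<le> v" "0 < l"
  shows "\<bar>f v M\<bar> \<le> \<bar>f w0 M\<bar> + l / (4 * M\<^sup>2) * E w0 + (v - w0) / (2 * l)"
proof -
  have M: "M \<le> \<rho> w" if "v0 \<le> w" for w using R_less_\<rho>'[of w] M_less_R that by simp
  have cfv: "continuous_on {w0..v} (\<lambda>v. fv v M)" by (rule cont_v[OF cont_fv]) (use M in auto)
  have "integral {w0..v} (\<lambda>v. fv v M) = f v M - f w0 M"
    using assms region M by (intro integral_FTC has_field_derivative_at_within[OF deriv_f_v]) auto
  then have "\<bar>f v M\<bar> \<le> \<bar>f w0 M\<bar> + \<bar>integral {w0..v} (\<lambda>v. fv v M)\<bar>" by simp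
  also have "\<bar>integral {w0..v} (\<lambda>v. fv v M)\<bar> \<le> integral {w0..v} (\<lambda>v. \<bar>fv v M\<bar>)"
    by (intro abs_integral_le continuous_intros cfv) auto
  also have "\<dots> \<le> l / 2 * integral {w0..v} (\<lambda>v. (fv v M)\<^sup>2) + (v - w0) / (2 * l)"
    using assms by (intro abs_integral_le_L2 cfv) auto
  also have "integral {w0..v} (\<lambda>v. (fv v M)\<^sup>2) \<le> E w0 / (2 * M\<^sup>2)"
    using flux_bound[OF assms(1)] M_pos by (simp add: field_simps)
  finally show ?thesis using assms M_pos by (simp add: field_simps)
qed

text \<open>By the wave equation the \<open>v\<close>-derivative of the integrand is the
  \<open>r\<close>-derivative of -(r - M)^2 \<open>fr\<close>, and at \<open>r = M\<close> the
  integrand is the conserved charge; both properties are used.\<close>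

definition G :: "real \<Rightarrow> real \<Rightarrow> real" where
  "G v r = integral {M..r} (\<lambda>s. 2 * s\<^sup>2 * fr v s + 2 * s * f v s)"

lemma G_deriv:
  assumes "v0 \<le> a" "M \<le> r" "r \<le> \<rho> a" "v \<in> {a..b}"
  shows "((\<lambda>v. G v r) has_real_derivative - ((r - M)\<^sup>2 * fr v r)) (at v within {a..b})"
proof -
  have v: "v0 \<le> v" "r \<le> \<rho> v" using assms \<rho>_mono[of a v] by auto
  have c1: "continuous_on U (\<lambda>(v, r). 2 * r\<^sup>2 * fr v r + 2 * r * f v r)"
    using cont_f cont_fr unfolding case_prod_beta by (intro continuous_intros)
  have c2: "continuous_on U (\<lambda>(v, r). 2 * r\<^sup>2 * fvr v r + 2 * r * fv v r)"
    using cont_fv cont_fvr unfolding case_prod_beta by (intro continuous_intros)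
  have "((\<lambda>v. G v r) has_real_derivative integral {M..r} (\<lambda>s. 2 * s\<^sup>2 * fvr v s + 2 * s * fv v s))
     (at v within {a..b})"
    unfolding G_def using assms
    by (intro deriv_integral_r[OF c1 c2]) (auto intro!: derivative_eq_intros deriv_fr_v deriv_f_v)
  moreover have "integral {M..r} (\<lambda>s. 2 * s\<^sup>2 * fvr v s + 2 * s * fv v s)
     = - ((r - M)\<^sup>2 * fr v r) - - ((M - M)\<^sup>2 * fr v M)"
  proof (rule integral_FTC)
    fix s assume s: "s \<in> {M..r}"
    then have "(v, s) \<in> U" using v by (intro region) auto
    then have "((\<lambda>s. - ((s - M)\<^sup>2 * fr v s)) has_real_derivative
       - (2 * (s - M) * fr v s + (s - M)\<^sup>2 * frr v s)) (at s within {M..r})"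
      by (auto intro!: derivative_eq_intros has_field_derivative_at_within[OF deriv_fr_r])
    then show "((\<lambda>s. - ((s - M)\<^sup>2 * fr v s)) has_real_derivative
       2 * s\<^sup>2 * fvr v s + 2 * s * fv v s) (at s within {M..r})"
      using wave[of v s] v s by (elim DERIV_cong) auto
  qed fact
  ultimately show ?thesis by simp
qed

text \<open>A bare integral of \<open>fr\<close> down to the horizon is not controlled by the
  energy. Splitting 2 s^2 into (s^2 + M^2) + (s^2 - M^2) makes the first part, together with 2 s
  \<open>f\<close>, an exact derivative and leaves in the second a factor that vanishes at the
  horizon.\<close>

lemma G_eq:
  assumes "v0 \<le> v" "M \<le> r" "r \<le> \<rho> v"
  shows "G v r = (r\<^sup>2 + M\<^sup>2) * f v r - 2 * M\<^sup>2 * f v M + integral {M..r} (\<lambda>s. (s\<^sup>2 - M\<^sup>2) * fr v s)"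
proof -
  have c: "continuous_on {M..r} (f v)" "continuous_on {M..r} (fr v)"
    using assms by (auto intro!: cont_r cont_f cont_fr)
  have "integral {M..r} (\<lambda>s. 2 * s * f v s + (s\<^sup>2 + M\<^sup>2) * fr v s)
     = (r\<^sup>2 + M\<^sup>2) * f v r - (M\<^sup>2 + M\<^sup>2) * f v M"
    using assms region
    by (intro integral_FTC)
       (auto intro!: derivative_eq_intros has_field_derivative_at_within[OF deriv_f_r])
  moreover have "G v r = integral {M..r} (\<lambda>s. 2 * s * f v s + (s\<^sup>2 + M\<^sup>2) * fr v s)
      + integral {M..r} (\<lambda>s. (s\<^sup>2 - M\<^sup>2) * fr v s)"
    unfolding G_def
    by (subst integral_add[symmetric])
       (auto intro!: integrable_continuous_real continuous_intros c arg_cong2[where f=integral]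
          simp: fun_eq_iff algebra_simps)
  ultimately show ?thesis by simp
qed

lemma abs_G_le:
  assumes "w0 \<le> v" "M < r" "r \<le> \<rho> v"
  shows "\<bar>G v r\<bar> \<le> (r\<^sup>2 + M\<^sup>2) * \<bar>f v r\<bar> + 2 * M\<^sup>2 * \<bar>f v M\<bar> + (r + M) / 2 * (E w0 + (r - M))"
proof -
  have c: "continuous_on {M..r} (fr v)" using assms by (auto intro!: cont_r cont_fr)
  have "\<bar>integral {M..r} (\<lambda>s. (s\<^sup>2 - M\<^sup>2) * fr v s)\<bar>
     \<le> integral {M..r} (\<lambda>s. (r + M) / 2 * ((s - M)\<^sup>2 * (fr v s)\<^sup>2 + 1))"
  proof (intro abs_integral_le continuous_intros c)
    fix s assume s: "s \<in> {M..r}"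
    have "\<bar>(s\<^sup>2 - M\<^sup>2) * fr v s\<bar> = (s + M) * \<bar>(s - M) * fr v s\<bar>"
      using s M_pos by (simp add: abs_mult power2_eq_square square_diff_square_factored)
    also have "\<dots> \<le> (r + M) * (1 / 2 * ((s - M) * fr v s)\<^sup>2 + 1 / 2)"
      using s M_pos weighted_AM_GM[of 1 "(s - M) * fr v s"] by (intro mult_mono) auto
    finally show "\<bar>(s\<^sup>2 - M\<^sup>2) * fr v s\<bar> \<le> (r + M) / 2 * ((s - M)\<^sup>2 * (fr v s)\<^sup>2 + 1)"
      unfolding power_mult_distrib by (simp add: distrib_left mult.assoc)
  qed
  also have "\<dots> = (r + M) / 2 * (integral {M..r} (\<lambda>s. (s - M)\<^sup>2 * (fr v s)\<^sup>2) + (r - M))"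
    using assms
    by (subst integral_mult_right, subst integral_add)
       (auto intro!: integrable_continuous_real continuous_intros c)
  also have "\<dots> \<le> (r + M) / 2 * (E w0 + (r - M))"
    using assms M_pos weighted_integral_le_E[of v M r] by (intro mult_left_mono add_mono) auto
  finally have 1: "\<bar>integral {M..r} (\<lambda>s. (s\<^sup>2 - M\<^sup>2) * fr v s)\<bar> \<le> (r + M) / 2 * (E w0 + (r - M))" .
  have "\<bar>G v r\<bar> \<le> \<bar>(r\<^sup>2 + M\<^sup>2) * f v r\<bar> + \<bar>2 * M\<^sup>2 * f v M\<bar> +
      \<bar>integral {M..r} (\<lambda>s. (s\<^sup>2 - M\<^sup>2) * fr v s)\<bar>"
    using assms by (subst G_eq) auto
  then show ?thesis using 1 by (simp add: abs_mult)
qed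


text \<open>Integrating the evolution of \<open>G\<close> over {T..2T} shows that the time integral
  of \<open>fr\<close> at radius r is a difference of two values of \<open>G\<close> divided by (r -
  M)^2. These are bounded by a constant plus a small multiple of T, so the time integral of
  \<open>f\<close> hardly changes between \<open>R\<close> and a distant radius, where
  \<open>f\<close> is small pointwise.\<close>

lemma mean_f_R:
  assumes "0 < \<epsilon>"
  shows "\<forall>\<^sub>F T in at_top. \<bar>integral {T..2 * T} (\<lambda>v. f v R)\<bar> \<le> \<epsilon> * T"
proof -
  define C1 where "C1 = E w0 + 1"
  have C1: "0 < C1" using E_w0_nonneg by (simp add: C1_def)
  \<comment> \<open>Far enough out for the bound of \<open>abs_f_le\<close> at radius
    \<open>K\<close> to be at most \<open>\<epsilon> / 2\<close>.\<close>
  define K where "K = R + 1 + (C1 / \<epsilon>)\<^sup>2"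
  have "0 \<le> (C1 / \<epsilon>)\<^sup>2" by simp
  then have K: "R < K" "M < K" using M_less_R unfolding K_def by linarith+
  have "C1 / \<epsilon> \<le> sqrt (K - M)"
    using M_less_R by (intro real_le_rsqrt) (simp add: K_def)
  then have sqrt_K: "C1 / (2 * sqrt (K - M)) \<le> \<epsilon> / 2"
    using assms K by (simp add: field_simps)
  \<comment> \<open>Chosen so that the part linear in T of the variation of \<open>h\<close> between
    \<open>R\<close> and \<open>K\<close> is exactly \<open>\<epsilon> / 4 * T\<close>.\<close>
  define l where "l = 16 * (K - R) * M\<^sup>2 / (\<epsilon> * (R - M)\<^sup>2)"
  have l: "0 < l" using assms K M_less_R M_pos by (simp add: l_def)
  define C2 where "C2 = (K\<^sup>2 + M\<^sup>2) * (C1 / (2 * sqrt (R - M)))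
     + 2 * M\<^sup>2 * (\<bar>f w0 M\<bar> + l / (4 * M\<^sup>2) * E w0) + (K + M) / 2 * (E w0 + (K - M))"
  have G: "\<bar>G v r\<bar> \<le> C2 + M\<^sup>2 * v / l" if "w0 \<le> v" "K \<le> \<rho> v" "r \<in> {R..K}" for v r
  proof -
    have "\<bar>f v r\<bar> \<le> C1 / (2 * sqrt (r - M))"
      using that M_less_R unfolding C1_def by (intro abs_f_le) auto
    also have "\<dots> \<le> C1 / (2 * sqrt (R - M))"
      using that M_less_R C1 by (intro divide_left_mono) auto
    finally have "\<bar>f v r\<bar> \<le> C1 / (2 * sqrt (R - M))" .
    then have 1: "(r\<^sup>2 + M\<^sup>2) * \<bar>f v r\<bar> \<le> (K\<^sup>2 + M\<^sup>2) * (C1 / (2 * sqrt (R - M)))"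
      using that M_less_R M_pos by (intro mult_mono add_mono power_mono) auto
    have "\<bar>f v M\<bar> \<le> \<bar>f w0 M\<bar> + l / (4 * M\<^sup>2) * E w0 + (v - w0) / (2 * l)"
      using that l by (intro abs_f_horizon_le) auto
    also have "\<dots> \<le> \<bar>f w0 M\<bar> + l / (4 * M\<^sup>2) * E w0 + v / (2 * l)"
      using l v0_nonneg by (simp add: divide_right_mono)
    finally have 2: "2 * M\<^sup>2 * \<bar>f v M\<bar> \<le> 2 * M\<^sup>2 * (\<bar>f w0 M\<bar> + l / (4 * M\<^sup>2) * E w0 + v / (2 * l))"
      using M_pos by (intro mult_left_mono) auto
    have 3: "(r + M) / 2 * (E w0 + (r - M)) \<le> (K + M) / 2 * (E w0 + (K - M))"
      using that K M_less_R M_pos E_w0_nonneg by (intro mult_mono) auto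
    have "\<bar>G v r\<bar> \<le> (r\<^sup>2 + M\<^sup>2) * \<bar>f v r\<bar> + 2 * M\<^sup>2 * \<bar>f v M\<bar> + (r + M) / 2 * (E w0 + (r - M))"
      using that M_less_R by (intro abs_G_le) auto
    also have "\<dots> \<le> C2 + M\<^sup>2 * v / l"
      using 1 2 3 unfolding C2_def distrib_left[of "2 * M\<^sup>2" _ "v / (2 * l)"] by simp
    finally show ?thesis .
  qed
  \<comment> \<open>The first condition absorbs the part of the variation of \<open>h\<close> that
    does not grow with T into \<open>\<epsilon> / 8 * T\<close>; the last one puts all radii up to
    \<open>K\<close> below the cone from time T on.\<close>
  have "\<forall>\<^sub>F T in at_top. (K - R) * (2 * C2 / (R - M)\<^sup>2) / (\<epsilon> / 8) \<le> T \<and> w0 \<le> T \<and> K \<le> \<rho> T"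
    using \<rho>_at_top unfolding filterlim_at_top by (intro eventually_conj eventually_ge_at_top) auto
  then show ?thesis
  proof eventually_elim
    fix T assume T: "(K - R) * (2 * C2 / (R - M)\<^sup>2) / (\<epsilon> / 8) \<le> T \<and> w0 \<le> T \<and> K \<le> \<rho> T"
    then have T0: "0 < T" "v0 \<le> T" "K \<le> \<rho> T" "w0 \<le> T" using v0_nonneg by auto
    have \<rho>T: "K \<le> \<rho> v" if "T \<le> v" for v using \<rho>_mono[of T v] that T0 by simp
    define h where "h r = integral {T..2 * T} (\<lambda>v. f v r)" for r
    define h' where "h' r = integral {T..2 * T} (\<lambda>v. fr v r)" for r
    have sub: "(v, r) \<in> U" if "v \<in> {T..2 * T}" "r \<in> {R..K}" for v r
      using that T0 M_less_R \<rho>T[of v] by (intro region) auto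
    have h: "(h has_real_derivative h' r) (at r within {R..K})" if r: "r \<in> {R..K}" for r
    proof -
      have "((\<lambda>r. integral (cbox T (2 * T)) (\<lambda>v. f v r)) has_real_derivative
         integral (cbox T (2 * T)) (\<lambda>v. fr v r)) (at r within {R..K})"
      proof (rule leibniz_rule_field_derivative)
        show "((\<lambda>x. f t x) has_real_derivative fr t s) (at s within {R..K})"
          if "s \<in> {R..K}" "t \<in> cbox T (2 * T)" for s t
          using that sub by (intro has_field_derivative_at_within[OF deriv_f_r]) auto
        show "(\<lambda>v. f v s) integrable_on cbox T (2 * T)" if "s \<in> {R..K}" for s
          using cont_v[OF cont_f, of T s "2 * T"] that T0 M_less_R
          by (auto intro!: integrable_continuous_real)
        have "continuous_on ({R..K} \<times> cbox T (2 * T)) (\<lambda>p. (\<lambda>(v, r). fr v r) (snd p, fst p))"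
          by (rule continuous_on_compose2[OF cont_fr]) (use sub in \<open>auto intro!: continuous_intros\<close>)
        then show "continuous_on ({R..K} \<times> cbox T (2 * T)) (\<lambda>(x, t). fr t x)"
          by (simp add: case_prod_beta)
      qed (use r in auto)
      then show ?thesis by (simp add: h_def[abs_def] h'_def)
    qed
    have h'_le: "\<bar>h' r\<bar> \<le> 2 * (C2 + M\<^sup>2 * (2 * T) / l) / (R - M)\<^sup>2" if r: "r \<in> {R..K}" for r
    proof -
      have "integral {T..2 * T} (\<lambda>v. - ((r - M)\<^sup>2 * fr v r)) = G (2 * T) r - G T r"
        using T0 r M_less_R by (intro integral_FTC G_deriv) auto
      then have "(r - M)\<^sup>2 * h' r = G T r - G (2 * T) r" by (simp add: h'_def)
      then have "(r - M)\<^sup>2 * \<bar>h' r\<bar> = \<bar>G T r - G (2 * T) r\<bar>"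
        by (metis abs_mult abs_power2)
      also have "\<dots> \<le> \<bar>G T r\<bar> + \<bar>G (2 * T) r\<bar>" by simp
      also have "\<dots> \<le> (C2 + M\<^sup>2 * T / l) + (C2 + M\<^sup>2 * (2 * T) / l)"
        using T0 r \<rho>T by (intro add_mono G) auto
      also have "\<dots> \<le> 2 * (C2 + M\<^sup>2 * (2 * T) / l)"
      proof -
        have "M\<^sup>2 * T / l \<le> M\<^sup>2 * (2 * T) / l"
          using l T0 by (intro divide_right_mono mult_left_mono) auto
        from add_mono[OF add_left_mono[OF this] order_refl] show ?thesis by (simp only: mult_2)
      qed
      finally have "(r - M)\<^sup>2 * \<bar>h' r\<bar> \<le> 2 * (C2 + M\<^sup>2 * (2 * T) / l)" .
      moreover have "(R - M)\<^sup>2 * \<bar>h' r\<bar> \<le> (r - M)\<^sup>2 * \<bar>h' r\<bar>"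
        using r M_less_R by (intro mult_right_mono power_mono) auto
      ultimately show ?thesis using M_less_R by (simp add: pos_le_divide_eq mult.commute)
    qed
    have "norm (h K - h R) \<le> 2 * (C2 + M\<^sup>2 * (2 * T) / l) / (R - M)\<^sup>2 * norm (K - R)"
      by (rule field_differentiable_bound[where S="{R..K}"]) (use h h'_le K in auto)
    then have "\<bar>h R\<bar> \<le> \<bar>h K\<bar> + (K - R) * (2 * (C2 + M\<^sup>2 * (2 * T) / l) / (R - M)\<^sup>2)"
      using K by (simp add: mult.commute)
    also have "(K - R) * (2 * (C2 + M\<^sup>2 * (2 * T) / l) / (R - M)\<^sup>2)
        = (K - R) * (2 * C2 / (R - M)\<^sup>2) + (K - R) * (4 * M\<^sup>2) * T / (l * (R - M)\<^sup>2)"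
      using M_less_R l by (simp add: field_simps)
    also have "(K - R) * (4 * M\<^sup>2) * T / (l * (R - M)\<^sup>2) = \<epsilon> / 4 * T"
      using K M_less_R M_pos assms by (simp add: l_def field_simps)
    also have "(K - R) * (2 * C2 / (R - M)\<^sup>2) \<le> \<epsilon> / 8 * T"
      using T pos_divide_le_eq[of "\<epsilon> / 8"] assms by (simp only: mult.commute)
    also have "\<bar>h K\<bar> \<le> \<epsilon> / 2 * T"
    proof -
      have "\<bar>h K\<bar> \<le> integral {T..2 * T} (\<lambda>v. \<epsilon> / 2)"
        unfolding h_def
      proof (intro abs_integral_le cont_v[OF cont_f])
        fix v assume v: "v \<in> {T..2 * T}"
        have "\<bar>f v K\<bar> \<le> C1 / (2 * sqrt (K - M))"
          unfolding C1_def using v T0 K \<rho>T[of v] by (intro abs_f_le) auto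
        then show "\<bar>f v K\<bar> \<le> \<epsilon> / 2" using sqrt_K by simp
      qed (use T0 K in auto)
      then show ?thesis using T0 by (simp add: mult.commute)
    qed
    finally have "\<bar>h R\<bar> \<le> \<epsilon> / 2 * T + (\<epsilon> / 8 * T + \<epsilon> / 4 * T)" by simp
    also have "\<dots> \<le> \<epsilon> * T" using assms T0 by simp
    finally show "\<bar>integral {T..2 * T} (\<lambda>v. f v R)\<bar> \<le> \<epsilon> * T" by (simp add: h_def)
  qed
qed


text \<open>For the spherical integral of \<psi> this is \<open>2 * M\<^sup>2\<close> times
  H[\<psi>]; with this normalisation it is the value at \<open>r = M\<close> of the integrand of
  \<open>G\<close>.\<close>

definition charge :: real where
  "charge = 2 * M\<^sup>2 * fr v0 M + 2 * M * f v0 M"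

text \<open>At \<open>r = M\<close> the double zero removes the terms with \<open>frr\<close> and
  \<open>fr\<close> from the wave equation, and what remains is a
  \<open>v\<close>-derivative.\<close>

lemma charge_conserved:
  assumes "v0 \<le> v"
  shows "2 * M\<^sup>2 * fr v M + 2 * M * f v M = charge"
proof -
  have M: "M \<le> \<rho> w" if "v0 \<le> w" for w using R_less_\<rho>'[of w] M_less_R that by simp
  have "integral {v0..v} (\<lambda>v. 0) = (2 * M\<^sup>2 * fr v M + 2 * M * f v M) - (2 * M\<^sup>2 * fr v0 M + 2 * M * f v0 M)"
  proof (rule integral_FTC)
    fix w assume w: "w \<in> {v0..v}"
    then have "(w, M) \<in> U" using M region by auto
    then have "((\<lambda>v. 2 * M\<^sup>2 * fr v M + 2 * M * f v M) has_real_derivative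
      2 * M\<^sup>2 * fvr w M + 2 * M * fv w M) (at w within {v0..v})"
      by (auto intro!: derivative_eq_intros has_field_derivative_at_within[OF deriv_f_v]
           has_field_derivative_at_within[OF deriv_fr_v])
    then show "((\<lambda>v. 2 * M\<^sup>2 * fr v M + 2 * M * f v M) has_real_derivative 0) (at w within {v0..v})"
      using wave[of w M] w M by (elim DERIV_cong) auto
  qed fact
  then show ?thesis by (simp add: charge_def)
qed

section \<open>Square integrability of fr near the horizon\<close>

definition q :: "real \<Rightarrow> real" where
  "q v = integral {M..R} (\<lambda>r. (fr v r)\<^sup>2)"

lemma cont_q: "v0 \<le> a \<Longrightarrow> continuous_on {a..b} q"
proof -
  assume a: "v0 \<le> a"
  have "continuous_on U (\<lambda>(v, r). (fr v r)\<^sup>2)"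
    using cont_fr unfolding case_prod_beta by (intro continuous_intros)
  from cont_integral_r[OF this a, of M R b] show ?thesis
    using R_less_\<rho>'[OF a] unfolding q_def[abs_def] by simp
qed

lemma q_nonneg: "v0 \<le> v \<Longrightarrow> 0 \<le> q v"
  unfolding q_def using R_less_\<rho>'[of v]
  by (intro integral_nonneg integrable_continuous_real continuous_intros cont_r[OF cont_fr]) auto

text \<open>The partial integrals increase and are bounded, so past a time where they are within
  \<open>\<delta>\<close> of their supremum at most \<open>\<delta>\<close> is left.\<close>

lemma L2_tail:
  assumes "\<And>V. v0 \<le> V \<Longrightarrow> integral {v0..V} q \<le> I" and "0 < \<delta>"
  shows "\<exists>v1\<ge>w0. \<forall>a b. v1 \<le> a \<longrightarrow> a \<le> b \<longrightarrow> integral {a..b} q \<le> \<delta>"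
proof -
  define S where "S = (\<lambda>V. integral {v0..V} q) ` {v0..}"
  have bdd: "bdd_above S" using assms(1) by (auto simp: S_def bdd_above_def)
  have "S \<noteq> {}" by (auto simp: S_def)
  then obtain V where V: "v0 \<le> V" "Sup S - \<delta> < integral {v0..V} q"
    using less_cSup_iff[OF _ bdd, of "Sup S - \<delta>"] \<open>0 < \<delta>\<close> by (auto simp: S_def)
  have split: "integral {v0..a} q + integral {a..b} q = integral {v0..b} q" if "v0 \<le> a" "a \<le> b" for a b
    using that by (intro Henstock_Kurzweil_Integration.integral_combine integrable_continuous_real cont_q) auto
  have nonneg: "0 \<le> integral {a..b} q" if "v0 \<le> a" for a b
    using that by (intro integral_nonneg integrable_continuous_real cont_q q_nonneg) auto
  show ?thesis
  proof (intro exI[of _ "max w0 V"] conjI allI impI)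
    fix a b assume ab: "max w0 V \<le> a" "a \<le> b"
    have "integral {v0..b} q \<le> Sup S" using ab V by (intro cSup_upper bdd) (auto simp: S_def)
    then show "integral {a..b} q \<le> \<delta>"
      using split[of a b] split[of V a] nonneg[of V a] V ab by simp
  qed simp
qed

lemma integral_abs_fr_le:
  assumes "v0 \<le> a" "a \<le> b" "M \<le> c" "c \<le> R" "0 < l"
  shows "integral {a..b} (\<lambda>v. integral {M..c} (\<lambda>r. \<bar>fr v r\<bar>))
     \<le> l / 2 * integral {a..b} q + (c - M) * (b - a) / (2 * l)"
proof -
  have c1: "continuous_on U (\<lambda>(v, r). \<bar>fr v r\<bar>)"
    using cont_fr unfolding case_prod_beta by (intro continuous_intros)
  have "integral {a..b} (\<lambda>v. integral {M..c} (\<lambda>r. \<bar>fr v r\<bar>))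
      \<le> integral {a..b} (\<lambda>v. l / 2 * q v + (c - M) / (2 * l))"
  proof (intro integral_mono_continuous continuous_intros cont_q cont_integral_r[OF c1])
    fix v assume v: "v \<in> {a..b}"
    then have cfr: "continuous_on {M..R} (fr v)"
      using R_less_\<rho>'[of v] assms by (intro cont_r cont_fr) auto
    then have "integral {M..c} (\<lambda>r. \<bar>fr v r\<bar>) \<le> l / 2 * integral {M..c} (\<lambda>r. (fr v r)\<^sup>2) + (c - M) / (2 * l)"
      using assms by (intro abs_integral_le_L2 continuous_on_subset[OF cfr]) auto
    moreover have "integral {M..c} (\<lambda>r. (fr v r)\<^sup>2) \<le> q v"
      unfolding q_def using assms
      by (intro integral_subset_le integrable_continuous_real continuous_intros
           continuous_on_subset[OF cfr]) auto
    ultimately show "integral {M..c} (\<lambda>r. \<bar>fr v r\<bar>) \<le> l / 2 * q v + (c - M) / (2 * l)"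
      using assms by (smt (verit) divide_pos_pos mult_left_mono)
  qed (use assms R_less_\<rho>'[of a] in auto)
  also have "\<dots> = l / 2 * integral {a..b} q + (c - M) * (b - a) / (2 * l)"
    using assms
    by (subst integral_add)
       (auto intro!: integrable_continuous_real continuous_intros cont_q)
  finally show ?thesis .
qed

definition N :: "real \<Rightarrow> real \<Rightarrow> real" where
  "N x v = integral {M..M + x} (G v)"

lemma cont_G:
  assumes "v0 \<le> v"
  shows "continuous_on {M..R} (G v)"
  unfolding G_def[abs_def]
  using assms R_less_\<rho>'[of v]
  by (intro indefinite_integral_continuous_1 integrable_continuous_real continuous_intros
      cont_r[OF cont_fr] cont_r[OF cont_f]) auto

text \<open>The integrand of \<open>G\<close> is continuous in the radius and equals
  \<open>charge\<close> at \<open>r = M\<close>, so \<open>G\<close> is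
  \<open>charge * (r - M)\<close> to first order, and one more integration gives x^2 / 2. How small
  x must be depends on \<open>v\<close>; \<open>N_drift\<close> carries the result to late
  times.\<close>

lemma N_initial:
  assumes "v0 \<le> v" "0 < \<epsilon>"
  shows "\<forall>\<^sub>F x in at_right 0. \<bar>N x v - charge * x\<^sup>2 / 2\<bar> \<le> \<epsilon> * x\<^sup>2 / 2"
proof -
  define g where "g s = 2 * s\<^sup>2 * fr v s + 2 * s * f v s" for s
  have g: "continuous_on {M..R} g"
    unfolding g_def using assms R_less_\<rho>'[of v]
    by (intro continuous_intros cont_r[OF cont_fr] cont_r[OF cont_f]) auto
  have gM: "g M = charge" using charge_conserved[OF assms(1)] by (simp add: g_def)
  obtain d where d: "0 < d" "\<forall>s\<in>{M..R}. dist s M < d \<longrightarrow> dist (g s) (g M) < \<epsilon>"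
    using g[unfolded continuous_on_iff, rule_format, of M \<epsilon>] assms M_less_R by auto
  have near: "\<bar>g s - charge\<bar> \<le> \<epsilon>" if "s \<in> {M..R}" "\<bar>s - M\<bar> < d" for s
    using d(2) that gM by (auto simp: dist_real_def intro: less_imp_le)
  have "\<forall>\<^sub>F x in at_right 0. x \<in> {0<..<min d (R - M)}"
    using d M_less_R by (intro eventually_at_right_real) auto
  then show ?thesis
  proof eventually_elim
    fix x assume x: "x \<in> {0<..<min d (R - M)}"
    have G: "\<bar>G v r - charge * (r - M)\<bar> \<le> \<epsilon> * (r - M)" if r: "r \<in> {M..M + x}" for r
    proof -
      have c: "continuous_on {M..r} g" using g by (rule continuous_on_subset) (use r x in auto)
      have "G v r - charge * (r - M) = integral {M..r} (\<lambda>s. g s - charge)"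
        using r by (subst integral_diff) (auto simp: G_def g_def[abs_def] intro!: integrable_continuous_real c[unfolded g_def[abs_def]])
      also have "\<bar>\<dots>\<bar> \<le> integral {M..r} (\<lambda>s. \<epsilon>)"
        by (intro abs_integral_le continuous_intros c near) (use r x in auto)
      finally show ?thesis using r by (simp add: mult.commute)
    qed
    have lin: "integral {M..M + x} (\<lambda>r. c * (r - M)) = c * x\<^sup>2 / 2" for c
    proof -
      have "integral {M..M + x} (\<lambda>r. c * (r - M)) = c * (M + x - M)\<^sup>2 / 2 - c * (M - M)\<^sup>2 / 2"
        using x by (intro integral_FTC) (auto intro!: derivative_eq_intros)
      then show ?thesis by simp
    qed
    have c: "continuous_on {M..M + x} (G v)"
      using cont_G[OF assms(1)] by (rule continuous_on_subset) (use x in auto)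
    have "N x v - charge * x\<^sup>2 / 2 = integral {M..M + x} (\<lambda>r. G v r - charge * (r - M))"
      unfolding N_def lin[symmetric]
      by (intro integral_diff[symmetric] integrable_continuous_real continuous_intros c)
    also have "\<bar>\<dots>\<bar> \<le> integral {M..M + x} (\<lambda>r. \<epsilon> * (r - M))"
      by (intro abs_integral_le continuous_intros c G) auto
    finally show "\<bar>N x v - charge * x\<^sup>2 / 2\<bar> \<le> \<epsilon> * x\<^sup>2 / 2" unfolding lin .
  qed
qed

lemma N_deriv:
  assumes "v0 \<le> a" "0 < x" "x \<le> R - M" "v \<in> {a..b}"
  shows "(N x has_real_derivative - integral {M..M + x} (\<lambda>r. (r - M)\<^sup>2 * fr v r)) (at v within {a..b})"
proof -
  have \<rho>: "M + x \<le> \<rho> w" if "v0 \<le> w" for w using R_less_\<rho>'[of w] that assms by simp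
  have "((\<lambda>v. integral (cbox M (M + x)) (G v)) has_real_derivative
      integral (cbox M (M + x)) (\<lambda>r. - ((r - M)\<^sup>2 * fr v r))) (at v within {a..b})"
  proof (rule leibniz_rule_field_derivative)
    show "((\<lambda>w. G w r) has_real_derivative - ((r - M)\<^sup>2 * fr w r)) (at w within {a..b})"
      if "w \<in> {a..b}" "r \<in> cbox M (M + x)" for w r
      using that assms \<rho>[of a] by (intro G_deriv) auto
    show "G w integrable_on cbox M (M + x)" if "w \<in> {a..b}" for w
      using that assms
      by (auto intro!: integrable_continuous_real continuous_on_subset[OF cont_G])
    have "continuous_on ({a..b} \<times> cbox M (M + x)) (\<lambda>(v, r). fr v r)"
      using cont_fr by (rule continuous_on_subset)
        (use rectangle[of a M "M + x" b] assms \<rho>[of a] in auto)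
    then show "continuous_on ({a..b} \<times> cbox M (M + x)) (\<lambda>(v, r). - ((r - M)\<^sup>2 * fr v r))"
      unfolding case_prod_beta by (intro continuous_intros)
  qed (use assms in auto)
  then show ?thesis by (simp add: N_def[abs_def])
qed

lemma cont_N:
  assumes "v0 \<le> a" "0 < x" "x \<le> R - M"
  shows "continuous_on {a..b} (N x)"
  using N_deriv[OF assms] by (rule DERIV_continuous_on)

text \<open>The weight (r - M)^2 is at most x^2 on the layer, leaving the L1 norm of
  \<open>fr\<close> over a rectangle. If \<open>b - a\<close> is comparable to 1 / x, its area is of
  order one: a large \<open>l\<close> controls the second term, and then a small tail of
  \<open>q\<close> the first.\<close>

lemma N_drift:
  assumes "v0 \<le> a" "a \<le> b" "0 < x" "x \<le> R - M" "0 < l"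
  shows "\<bar>N x b - N x a\<bar> \<le> x\<^sup>2 * (l / 2 * integral {a..b} q + x * (b - a) / (2 * l))"
proof -
  have \<rho>: "M + x \<le> \<rho> w" if "v0 \<le> w" for w using R_less_\<rho>'[of w] that assms by simp
  have c1: "continuous_on U (\<lambda>(v, r). \<bar>fr v r\<bar>)" "continuous_on U (\<lambda>(v, r). (r - M)\<^sup>2 * fr v r)"
    using cont_fr unfolding case_prod_beta by (auto intro!: continuous_intros)
  have "integral {a..b} (\<lambda>v. - integral {M..M + x} (\<lambda>r. (r - M)\<^sup>2 * fr v r)) = N x b - N x a"
    using assms by (intro integral_FTC N_deriv) auto
  then have "\<bar>N x b - N x a\<bar> = \<bar>integral {a..b} (\<lambda>v. integral {M..M + x} (\<lambda>r. (r - M)\<^sup>2 * fr v r))\<bar>"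
    by simp
  also have "\<dots> \<le> integral {a..b} (\<lambda>v. x\<^sup>2 * integral {M..M + x} (\<lambda>r. \<bar>fr v r\<bar>))"
  proof (intro abs_integral_le continuous_intros cont_integral_r c1)
    fix v assume v: "v \<in> {a..b}"
    have cfr: "continuous_on {M..M + x} (fr v)" using v assms \<rho>[of v] by (intro cont_r cont_fr) auto
    have "\<bar>integral {M..M + x} (\<lambda>r. (r - M)\<^sup>2 * fr v r)\<bar> \<le> integral {M..M + x} (\<lambda>r. x\<^sup>2 * \<bar>fr v r\<bar>)"
      by (intro abs_integral_le continuous_intros cfr)
         (auto simp: abs_mult intro!: mult_right_mono power_mono)
    then show "\<bar>integral {M..M + x} (\<lambda>r. (r - M)\<^sup>2 * fr v r)\<bar> \<le> x\<^sup>2 * integral {M..M + x} (\<lambda>r. \<bar>fr v r\<bar>)"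
      by simp
  qed (use assms \<rho>[of a] in auto)
  also have "\<dots> = x\<^sup>2 * integral {a..b} (\<lambda>v. integral {M..M + x} (\<lambda>r. \<bar>fr v r\<bar>))" by simp
  also have "\<dots> \<le> x\<^sup>2 * (l / 2 * integral {a..b} q + x * (b - a) / (2 * l))"
    using integral_abs_fr_le[of a b "M + x" l] assms by (intro mult_left_mono) auto
  finally show ?thesis .
qed

text \<open>Dropping \<open>fr\<close> from the integrand of \<open>G\<close> and freezing
  \<open>f\<close> at \<open>R\<close> would give exactly (r^2 - M^2) \<open>f v R\<close>. The
  first change costs the L1 norm of \<open>fr\<close> over the thin layer; the second costs it over
  all of {M..R}, but with the factor \<open>c\<close>, which is of order x^2.\<close>

lemma N_approx:
  assumes "v0 \<le> v" "0 < x" "x \<le> R - M"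
  defines "c \<equiv> integral {M..M + x} (\<lambda>r. r\<^sup>2 - M\<^sup>2)"
  shows "\<bar>N x v - c * f v R\<bar> \<le> 2 * R\<^sup>2 * x * integral {M..M + x} (\<lambda>r. \<bar>fr v r\<bar>)
     + c * integral {M..R} (\<lambda>r. \<bar>fr v r\<bar>)"
proof -
  define I where "I r = integral {M..r} (\<lambda>r. \<bar>fr v r\<bar>)" for r
  have \<rho>: "R \<le> \<rho> v" using R_less_\<rho>'[of v] assms by simp
  have c: "continuous_on {M..R} (f v)" "continuous_on {M..R} (fr v)"
    using assms \<rho> by (auto intro!: cont_r cont_f cont_fr)
  have cs: "continuous_on {a..b} (f v)" "continuous_on {a..b} (fr v)" if "M \<le> a" "b \<le> R" for a b
    using that by (auto intro: continuous_on_subset[OF c(1)] continuous_on_subset[OF c(2)])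
  have I_mono: "I r \<le> I s" if "M \<le> r" "r \<le> s" "s \<le> R" for r s
    unfolding I_def using that
    by (intro integral_subset_le integrable_continuous_real continuous_intros cs) auto
  have I0: "0 \<le> I r" if "M \<le> r" "r \<le> R" for r
    using I_mono[of M r] that by (simp add: I_def)
  have f_near: "\<bar>f v s - f v R\<bar> \<le> I R" if s: "s \<in> {M..R}" for s
  proof -
    have "integral {s..R} (fr v) = f v R - f v s"
      using s assms \<rho> by (intro FTC_r deriv_f_r) auto
    then have "\<bar>f v s - f v R\<bar> = \<bar>integral {s..R} (fr v)\<bar>" by simp
    also have "\<dots> \<le> integral {s..R} (\<lambda>r. \<bar>fr v r\<bar>)"
      using s by (intro abs_integral_le continuous_intros cs) auto
    also have "\<dots> \<le> I R"
      unfolding I_def using s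
      by (intro integral_subset_le integrable_continuous_real continuous_intros cs) auto
    finally show ?thesis .
  qed
  have sq: "integral {M..r} (\<lambda>s. 2 * s) = r\<^sup>2 - M\<^sup>2" if "M \<le> r" for r
    using that by (intro integral_FTC) (auto intro!: derivative_eq_intros)
  have G: "\<bar>G v r - (r\<^sup>2 - M\<^sup>2) * f v R\<bar> \<le> 2 * R\<^sup>2 * I (M + x) + (r\<^sup>2 - M\<^sup>2) * I R"
    if r: "r \<in> {M..M + x}" for r
  proof -
    have "(r\<^sup>2 - M\<^sup>2) * f v R = integral {M..r} (\<lambda>s. 2 * s * f v R)"
      using sq[of r] r by simp
    then have "G v r - (r\<^sup>2 - M\<^sup>2) * f v R = integral {M..r} (\<lambda>s. 2 * s\<^sup>2 * fr v s + 2 * s * f v s - 2 * s * f v R)"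
      unfolding G_def using r assms
      by (subst integral_diff) (auto intro!: integrable_continuous_real continuous_intros cs)
    then have "\<bar>G v r - (r\<^sup>2 - M\<^sup>2) * f v R\<bar>
       = \<bar>integral {M..r} (\<lambda>s. 2 * s\<^sup>2 * fr v s + 2 * s * f v s - 2 * s * f v R)\<bar>"
      by (rule arg_cong)
    also have "\<dots> \<le> integral {M..r} (\<lambda>s. 2 * R\<^sup>2 * \<bar>fr v s\<bar> + I R * (2 * s))"
    proof (intro abs_integral_le continuous_intros cs)
      fix s assume s: "s \<in> {M..r}"
      then have sR: "s \<in> {M..R}" using r assms by auto
      have "\<bar>2 * s\<^sup>2 * fr v s + 2 * s * f v s - 2 * s * f v R\<bar>
          = \<bar>2 * s\<^sup>2 * fr v s + (2 * s) * (f v s - f v R)\<bar>" by (simp add: algebra_simps)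
      also have "\<dots> \<le> 2 * s\<^sup>2 * \<bar>fr v s\<bar> + (2 * s) * \<bar>f v s - f v R\<bar>"
        using sR M_pos by (intro order_trans[OF abs_triangle_ineq]) (simp add: abs_mult)
      also have "\<dots> \<le> 2 * R\<^sup>2 * \<bar>fr v s\<bar> + (2 * s) * I R"
        using sR M_pos f_near[OF sR] by (intro add_mono mult_right_mono mult_left_mono power_mono) auto
      finally show "\<bar>2 * s\<^sup>2 * fr v s + 2 * s * f v s - 2 * s * f v R\<bar> \<le> 2 * R\<^sup>2 * \<bar>fr v s\<bar> + I R * (2 * s)"
        by (simp add: mult.commute)
    qed (use r assms(3) in auto)
    also have "\<dots> = 2 * R\<^sup>2 * I r + I R * integral {M..r} (\<lambda>s. 2 * s)"
    proof -
      have "(\<lambda>s. 2 * R\<^sup>2 * \<bar>fr v s\<bar>) integrable_on {M..r}" "(\<lambda>s. I R * (2 * s)) integrable_on {M..r}"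
        by (intro integrable_continuous_real continuous_intros cs; use r assms(3) in simp)+
      from integral_add[OF this] show ?thesis by (simp add: I_def)
    qed
    also have "\<dots> \<le> 2 * R\<^sup>2 * I (M + x) + I R * (r\<^sup>2 - M\<^sup>2)"
      using r assms(3) I_mono[of r "M + x"] I0[of R] M_less_R sq[of r] by (intro add_mono mult_left_mono) auto
    finally show ?thesis by (simp add: mult.commute)
  qed
  have cG: "continuous_on {M..M + x} (G v)"
    using cont_G[OF assms(1)] by (rule continuous_on_subset) (use assms in auto)
  have "N x v - c * f v R = integral {M..M + x} (\<lambda>r. G v r - (r\<^sup>2 - M\<^sup>2) * f v R)"
    unfolding N_def c_def
    by (subst integral_diff) (auto intro!: integrable_continuous_real continuous_intros cG)
  then have "\<bar>N x v - c * f v R\<bar> = \<bar>integral {M..M + x} (\<lambda>r. G v r - (r\<^sup>2 - M\<^sup>2) * f v R)\<bar>"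
    by (rule arg_cong)
  also have "\<dots> \<le> integral {M..M + x} (\<lambda>r. 2 * R\<^sup>2 * I (M + x) + (r\<^sup>2 - M\<^sup>2) * I R)"
    by (intro abs_integral_le continuous_intros cG G) auto
  also have "\<dots> = 2 * R\<^sup>2 * x * I (M + x) + c * I R"
  proof -
    have "(\<lambda>r. 2 * R\<^sup>2 * I (M + x)) integrable_on {M..M + x}" "(\<lambda>r. (r\<^sup>2 - M\<^sup>2) * I R) integrable_on {M..M + x}"
      by (intro integrable_continuous_real continuous_intros)+
    from integral_add[OF this] show ?thesis using assms(2) by (simp add: c_def)
  qed
  finally show ?thesis unfolding I_def by simp
qed


text \<open>In units of \<open>\<eta> * x\<close>, the integral of \<open>N x\<close> over {T..2T}
  is at least 1/4 by near-conservation of the charge and at most 3/16 by the smallness of the mean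
  of \<open>f\<close> at \<open>R\<close>.\<close>

theorem charge_eq_0_if_L2:
  assumes L2: "\<And>V. v0 \<le> V \<Longrightarrow> integral {v0..V} q \<le> I"
  shows "charge = 0"
proof (rule ccontr)
  assume "charge \<noteq> 0"
  define \<eta> where "\<eta> = \<bar>charge\<bar>"
  have \<eta>: "0 < \<eta>" using \<open>charge \<noteq> 0\<close> by (simp add: \<eta>_def)
  have R: "0 < R" using M_pos M_less_R by simp
  \<comment> \<open>The order of choices matters: \<open>l\<close> makes the area terms, which carry
    1 / l, at most \<open>\<eta> / 16\<close>; then \<open>\<delta>\<close>, depending on
    \<open>l\<close>, makes the L2 terms, which carry l \<delta>, equally small; then
    \<open>v1\<close>, and T last.\<close>
  define l where "l = 16 / \<eta> * (1 + 2 * R\<^sup>2 + R * (R - M))"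
  have "0 \<le> R * (R - M)" using R M_less_R by simp
  then have l_ge: "16 / \<eta> * 1 \<le> l" "16 / \<eta> * (2 * R\<^sup>2 + R * (R - M)) \<le> l"
    unfolding l_def using \<eta> by (intro mult_left_mono; simp)+
  have l: "0 < l" using l_ge(1) \<eta> by (smt (verit) divide_pos_pos mult_cancel_left1)
  have l1: "1 / l \<le> \<eta> / 16" using l_ge(1) l \<eta> by (simp add: field_simps)
  have l2: "(2 * R\<^sup>2 + R * (R - M)) / (2 * l) \<le> \<eta> / 16"
  proof -
    have "(2 * R\<^sup>2 + R * (R - M)) / l \<le> \<eta> / 16" using l_ge(2) l \<eta> by (simp add: field_simps)
    moreover have "(2 * R\<^sup>2 + R * (R - M)) / (2 * l) \<le> (2 * R\<^sup>2 + R * (R - M)) / l"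
      using l \<open>0 \<le> R * (R - M)\<close> by (intro divide_left_mono) auto
    ultimately show ?thesis by linarith
  qed
  define \<delta> where "\<delta> = \<eta> / (8 * l * (1 + 2 * R\<^sup>2 + R))"
  have pos: "0 < 1 + 2 * R\<^sup>2 + R" using R by (simp add: add_pos_nonneg)
  have \<delta>: "0 < \<delta>" unfolding \<delta>_def using \<eta> l pos by simp
  have \<delta>_eq: "(1 + 2 * R\<^sup>2 + R) * (l / 2 * \<delta>) = \<eta> / 16"
    unfolding \<delta>_def using l pos by (simp add: divide_simps)
  have \<delta>1: "l / 2 * \<delta> \<le> \<eta> / 16" "(2 * R\<^sup>2 + R) * (l / 2 * \<delta>) \<le> \<eta> / 16"
  proof -
    have "0 \<le> l / 2 * \<delta>" using l \<delta> by simp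
    moreover have "1 * (l / 2 * \<delta>) \<le> (1 + 2 * R\<^sup>2 + R) * (l / 2 * \<delta>)"
      using R \<open>0 \<le> l / 2 * \<delta>\<close> by (intro mult_right_mono) auto
    moreover have "(2 * R\<^sup>2 + R) * (l / 2 * \<delta>) \<le> (1 + 2 * R\<^sup>2 + R) * (l / 2 * \<delta>)"
      using R \<open>0 \<le> l / 2 * \<delta>\<close> by (intro mult_right_mono) auto
    ultimately show "l / 2 * \<delta> \<le> \<eta> / 16" "(2 * R\<^sup>2 + R) * (l / 2 * \<delta>) \<le> \<eta> / 16"
      unfolding \<delta>_eq by simp_all
  qed
  obtain v1 where v1: "w0 \<le> v1" and tail: "\<And>a b. v1 \<le> a \<Longrightarrow> a \<le> b \<Longrightarrow> integral {a..b} q \<le> \<delta>"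
    using L2_tail[OF L2 \<delta>] by blast
  \<comment> \<open>The asymptotics in x are used at the single time \<open>v1\<close>, which stays
    put while T grows.\<close>
  have "\<forall>\<^sub>F T in at_top. \<bar>N (1 / T) v1 - charge * (1 / T)\<^sup>2 / 2\<bar> \<le> \<eta> / 8 * (1 / T)\<^sup>2 / 2"
  proof -
    have "filterlim (\<lambda>T::real. 1 / T) (at_right 0) at_top"
      using filterlim_inverse_at_right_top by (simp add: inverse_eq_divide)
    moreover have "\<forall>\<^sub>F x in at_right 0. \<bar>N x v1 - charge * x\<^sup>2 / 2\<bar> \<le> \<eta> / 8 * x\<^sup>2 / 2"
      using v1 \<eta> by (intro N_initial) auto
    ultimately show ?thesis by (rule eventually_compose_filterlim[rotated])
  qed
  moreover have "\<forall>\<^sub>F T in at_top. \<bar>integral {T..2 * T} (\<lambda>v. f v R)\<bar> \<le> \<eta> / (16 * R) * T"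
    using \<eta> R by (intro mean_f_R) simp
  ultimately have "\<forall>\<^sub>F T in at_top. \<bar>N (1 / T) v1 - charge * (1 / T)\<^sup>2 / 2\<bar> \<le> \<eta> / 8 * (1 / T)\<^sup>2 / 2
     \<and> \<bar>integral {T..2 * T} (\<lambda>v. f v R)\<bar> \<le> \<eta> / (16 * R) * T
     \<and> 1 \<le> T \<and> v1 \<le> T \<and> 1 / (R - M) \<le> T"
    by (intro eventually_conj eventually_ge_at_top)
  then obtain T where T: "\<bar>N (1 / T) v1 - charge * (1 / T)\<^sup>2 / 2\<bar> \<le> \<eta> / 8 * (1 / T)\<^sup>2 / 2"
     "\<bar>integral {T..2 * T} (\<lambda>v. f v R)\<bar> \<le> \<eta> / (16 * R) * T"
     "1 \<le> T" "v1 \<le> T" "1 / (R - M) \<le> T"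
    using eventually_happens'[OF trivial_limit_at_top_linorder] by blast
  define x where "x = 1 / T"
  have x: "0 < x" "x \<le> R - M" "x * T = 1" "x \<le> 1"
    using T M_less_R by (auto simp: x_def field_simps)
  have vT: "v0 \<le> T" using v1 T by simp
  have cN: "continuous_on {T..2 * T} (N x)" using x vT by (intro cont_N) auto
  have N_near: "\<bar>N x v - charge * x\<^sup>2 / 2\<bar> \<le> \<eta> / 4 * x\<^sup>2" if v: "v \<in> {T..2 * T}" for v
  proof -
    have "\<bar>N x v - N x v1\<bar> \<le> x\<^sup>2 * (l / 2 * integral {v1..v} q + x * (v - v1) / (2 * l))"
      using v v1 T x l by (intro N_drift) auto
    also have "\<dots> \<le> x\<^sup>2 * (\<eta> / 16 + \<eta> / 16)"
    proof (intro mult_left_mono add_mono)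
      have "l / 2 * integral {v1..v} q \<le> l / 2 * \<delta>"
        using v T l by (intro mult_left_mono tail) auto
      then show "l / 2 * integral {v1..v} q \<le> \<eta> / 16" using \<delta>1(1) by (rule order_trans)
      have "x * (v - v1) \<le> x * (2 * T)" using v x v1 v0_nonneg by (intro mult_left_mono) auto
      also have "x * (2 * T) = 2" using x(3) by (metis mult.left_commute mult.right_neutral)
      finally have "x * (v - v1) / (2 * l) \<le> 2 / (2 * l)" using l by (intro divide_right_mono) auto
      also have "2 / (2 * l) = 1 / l" by simp
      finally show "x * (v - v1) / (2 * l) \<le> \<eta> / 16" using l1 by (rule order_trans)
    qed simp
    finally have "\<bar>N x v - N x v1\<bar> \<le> \<eta> / 8 * x\<^sup>2" by (simp add: mult.commute)
    moreover have "\<bar>N x v1 - charge * x\<^sup>2 / 2\<bar> \<le> \<eta> / 16 * x\<^sup>2" using T(1) by (simp add: x_def)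
    moreover have "\<eta> / 8 * x\<^sup>2 + \<eta> / 16 * x\<^sup>2 \<le> \<eta> / 4 * x\<^sup>2" using \<eta> by simp
    ultimately show ?thesis by linarith
  qed
  \<comment> \<open>The charge contributes \<open>\<eta> / 2 * x\<close>, since T x^2 = x, and the
    deviation \<open>N_near\<close> takes away at most half of it.\<close>
  have lower: "\<eta> / 4 * x \<le> \<bar>integral {T..2 * T} (N x)\<bar>"
  proof -
    have "integral {T..2 * T} (N x) - T * (charge * x\<^sup>2 / 2) = integral {T..2 * T} (\<lambda>v. N x v - charge * x\<^sup>2 / 2)"
      using T(3) by (subst integral_diff) (auto intro!: integrable_continuous_real cN)
    then have "\<bar>integral {T..2 * T} (N x) - T * (charge * x\<^sup>2 / 2)\<bar>
       = \<bar>integral {T..2 * T} (\<lambda>v. N x v - charge * x\<^sup>2 / 2)\<bar>" by (rule arg_cong)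
    also have "\<dots> \<le> integral {T..2 * T} (\<lambda>v. \<eta> / 4 * x\<^sup>2)"
      by (intro abs_integral_le continuous_intros cN N_near)
    also have "\<dots> = \<eta> / 4 * x * (x * T)" using T(3) by (simp add: power2_eq_square)
    finally have "\<bar>integral {T..2 * T} (N x) - T * (charge * x\<^sup>2 / 2)\<bar> \<le> \<eta> / 4 * x" using x(3) by simp
    moreover have "\<bar>T * (charge * x\<^sup>2 / 2)\<bar> = \<eta> * x / 2"
    proof -
      have "T * (charge * x\<^sup>2 / 2) = charge * x / 2 * (x * T)" by (simp add: power2_eq_square)
      also have "\<dots> = charge * x / 2" unfolding x(3) by simp
      finally show ?thesis using x(1) by (simp only: \<eta>_def) (simp add: abs_mult)
    qed
    ultimately show ?thesis by linarith
  qed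
  define c where "c = integral {M..M + x} (\<lambda>r. r\<^sup>2 - M\<^sup>2)"
  have c: "0 \<le> c" "c \<le> R * x\<^sup>2"
  proof -
    have cont: "continuous_on {M..M + x} (\<lambda>r. r\<^sup>2 - M\<^sup>2)" by (intro continuous_intros)
    show "0 \<le> c" unfolding c_def
      using M_pos by (intro integral_nonneg integrable_continuous_real cont) (auto intro: power_mono)
    have "c \<le> integral {M..M + x} (\<lambda>r. R * (2 * (r - M)))"
      unfolding c_def
    proof (intro integral_mono_continuous cont continuous_intros)
      fix r assume r: "r \<in> {M..M + x}"
      then have "(r + M) * (r - M) \<le> (2 * R) * (r - M)"
        using x M_less_R by (intro mult_right_mono) auto
      also have "(2 * R) * (r - M) = R * (2 * (r - M))" by (simp only: mult_ac)
      finally show "r\<^sup>2 - M\<^sup>2 \<le> R * (2 * (r - M))"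
        by (simp only: power2_eq_square square_diff_square_factored)
    qed
    also have "\<dots> = R * (M + x - M)\<^sup>2 - R * (M - M)\<^sup>2"
      using x by (intro integral_FTC) (auto intro!: derivative_eq_intros)
    finally show "c \<le> R * x\<^sup>2" by simp
  qed
  define J where "J y = integral {T..2 * T} (\<lambda>v. integral {M..y} (\<lambda>r. \<bar>fr v r\<bar>))" for y
  have J: "J y \<le> l / 2 * \<delta> + (y - M) * T / (2 * l)" if "M \<le> y" "y \<le> R" for y
  proof -
    have "J y \<le> l / 2 * integral {T..2 * T} q + (y - M) * (2 * T - T) / (2 * l)"
      unfolding J_def using that T(3) vT l by (intro integral_abs_fr_le) auto
    moreover have "l / 2 * integral {T..2 * T} q \<le> l / 2 * \<delta>"
      using T l by (intro mult_left_mono tail) auto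
    ultimately show ?thesis by simp
  qed
  \<comment> \<open>Three shares of \<open>\<eta> / 16\<close>: the tail of \<open>q\<close>, the
    area terms with 1 / l, and the mean of \<open>f\<close> at \<open>R\<close>.\<close>
  have upper: "\<bar>integral {T..2 * T} (N x)\<bar> \<le> 3 * (\<eta> / 16) * x"
  proof -
    have c1: "continuous_on U (\<lambda>(v, r). \<bar>fr v r\<bar>)"
      using cont_fr unfolding case_prod_beta by (intro continuous_intros)
    have cJ: "continuous_on {T..2 * T} (\<lambda>v. integral {M..y} (\<lambda>r. \<bar>fr v r\<bar>))" if "y \<le> R" for y
      using that vT R_less_\<rho>'[OF vT] by (intro cont_integral_r c1) auto
    have cf: "continuous_on {T..2 * T} (\<lambda>v. f v R)"
      using vT R_less_\<rho>'[OF vT] M_less_R by (intro cont_v cont_f) auto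
    have xR: "M + x \<le> R" using x by simp
    have "integral {T..2 * T} (N x) - c * integral {T..2 * T} (\<lambda>v. f v R)
       = integral {T..2 * T} (\<lambda>v. N x v - c * f v R)"
      by (subst integral_diff) (auto intro!: integrable_continuous_real cN cf continuous_intros)
    then have "\<bar>integral {T..2 * T} (N x) - c * integral {T..2 * T} (\<lambda>v. f v R)\<bar>
       = \<bar>integral {T..2 * T} (\<lambda>v. N x v - c * f v R)\<bar>" by (rule arg_cong)
    also have "\<dots> \<le> integral {T..2 * T} (\<lambda>v. 2 * R\<^sup>2 * x * integral {M..M + x} (\<lambda>r. \<bar>fr v r\<bar>)
         + c * integral {M..R} (\<lambda>r. \<bar>fr v r\<bar>))"
      unfolding c_def using vT x
      by (intro abs_integral_le continuous_intros cN cf cJ xR order_refl N_approx) auto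
    also have "\<dots> = 2 * R\<^sup>2 * x * J (M + x) + c * J R"
    proof -
      have "(\<lambda>v. 2 * R\<^sup>2 * x * integral {M..M + x} (\<lambda>r. \<bar>fr v r\<bar>)) integrable_on {T..2 * T}"
        "(\<lambda>v. c * integral {M..R} (\<lambda>r. \<bar>fr v r\<bar>)) integrable_on {T..2 * T}"
        by (intro integrable_continuous_real continuous_intros cJ xR order_refl)+
      from integral_add[OF this] show ?thesis by (simp add: J_def)
    qed
    \<comment> \<open>Both areas are tamed by x T = 1: the thin rectangle has area 1, and the full
      strip has area (R - M) T, but its prefactor x^2 gives back one power of T.\<close>
    also have "\<dots> \<le> 2 * R\<^sup>2 * x * (l / 2 * \<delta> + x * T / (2 * l)) + (R * x\<^sup>2) * (l / 2 * \<delta> + (R - M) * T / (2 * l))"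
    proof (intro add_mono mult_left_mono mult_mono)
      show "J (M + x) \<le> l / 2 * \<delta> + x * T / (2 * l)" using J[of "M + x"] x by simp
      show "J R \<le> l / 2 * \<delta> + (R - M) * T / (2 * l)" using J[of R] M_less_R by simp
      show "0 \<le> J R" unfolding J_def
        using vT M_less_R less_imp_le[OF R_less_\<rho>']
        by (intro integral_nonneg integrable_continuous_real cJ order_refl continuous_intros cont_r[OF cont_fr]) auto
    qed (use x c R in auto)
    also have "\<dots> = x * (2 * R\<^sup>2 * (l / 2 * \<delta>) + R * (l / 2 * \<delta>) * x
        + ((x * T) * (2 * R\<^sup>2) / (2 * l) + (x * T) * (R * (R - M)) / (2 * l)))"
      by (simp add: algebra_simps power2_eq_square)
    also have "\<dots> = x * (2 * R\<^sup>2 * (l / 2 * \<delta>) + R * (l / 2 * \<delta>) * x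
        + (2 * R\<^sup>2 + R * (R - M)) / (2 * l))"
      using x by (simp add: add_divide_distrib)
    also have "\<dots> \<le> x * (\<eta> / 16 + \<eta> / 16)"
    proof (intro mult_left_mono add_mono l2)
      have "R * (l / 2 * \<delta>) * x \<le> R * (l / 2 * \<delta>)" using R l \<delta> x by (intro mult_left_le) auto
      then show "2 * R\<^sup>2 * (l / 2 * \<delta>) + R * (l / 2 * \<delta>) * x \<le> \<eta> / 16"
        using \<delta>1(2) unfolding distrib_right by (meson add_left_mono order_trans)
    qed (use x in auto)
    finally have 1: "\<bar>integral {T..2 * T} (N x) - c * integral {T..2 * T} (\<lambda>v. f v R)\<bar> \<le> x * (\<eta> / 16 + \<eta> / 16)" .
    have "\<bar>c * integral {T..2 * T} (\<lambda>v. f v R)\<bar> \<le> (R * x\<^sup>2) * (\<eta> / (16 * R) * T)"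
      unfolding abs_mult using c T(2) by (intro mult_mono) auto
    also have "\<dots> = \<eta> / 16 * x * (x * T)" using R by (simp add: power2_eq_square)
    finally have 2: "\<bar>c * integral {T..2 * T} (\<lambda>v. f v R)\<bar> \<le> \<eta> / 16 * x" using x by simp
    have "x * (\<eta> / 16 + \<eta> / 16) = 2 * (\<eta> / 16 * x)" by (simp only: mult_2 distrib_left mult.commute)
    moreover have "3 * (\<eta> / 16) * x = 3 * (\<eta> / 16 * x)" by (simp only: mult.assoc)
    ultimately show ?thesis using 1 2 by linarith
  qed
  have "0 < \<eta> * x" using \<eta> x by simp
  then show False using lower upper by simp
qed

end

section \<open>Smooth functions and the wave operator in coordinates\<close>

lemma frechet_derivative_cong_open:
  assumes "open W" "x \<in> W" "\<And>y. y \<in> W \<Longrightarrow> f y = g y"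
  shows "frechet_derivative f (at x) = frechet_derivative g (at x)"
proof -
  have "(f has_derivative D) (at x) \<longleftrightarrow> (g has_derivative D) (at x)" for D
    using has_derivative_transform_within_open[OF _ assms(1,2)] assms(3) by metis
  then show ?thesis by (simp add: frechet_derivative_def)
qed

lemma differentiable_on_cong_open:
  assumes "open W" "\<And>y. y \<in> W \<Longrightarrow> f y = g y"
  shows "f differentiable_on W \<longleftrightarrow> g differentiable_on W"
proof -
  have "f differentiable at x \<longleftrightarrow> g differentiable at x" if "x \<in> W" for x
    using has_derivative_transform_within_open[OF _ assms(1) that] assms(2)
    unfolding differentiable_def by metis
  then show ?thesis by (simp add: differentiable_on_eq_differentiable_at[OF assms(1)])
qed

lemma Ck_on_cong:
  assumes "open W" "\<And>y. y \<in> W \<Longrightarrow> f y = g y"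
  shows "Ck_on k W f \<longleftrightarrow> Ck_on k W g"
  using assms(2)
proof (induction k arbitrary: f g)
  case 0
  then show ?case by (simp cong: continuous_on_cong)
next
  case (Suc k)
  show ?case
    using Suc.IH[of "\<lambda>x. frechet_derivative f (at x) b" "\<lambda>x. frechet_derivative g (at x) b" for b]
      differentiable_on_cong_open[OF assms(1), of f g]
      frechet_derivative_cong_open[OF assms(1), of _ f g] Suc.prems
    by simp
qed

lemma Ck_on_Suc_imp: "Ck_on (Suc k) W f \<Longrightarrow> Ck_on k W f"
  by (induction k arbitrary: f) (auto simp: differentiable_imp_continuous_on)

lemma has_derivative_if_differentiable_on:
  assumes "open W" "f differentiable_on W" "x \<in> W"
  shows "(f has_derivative frechet_derivative f (at x)) (at x)"
  using assms by (simp add: differentiable_on_eq_differentiable_at frechet_derivative_works[symmetric])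

text \<open>On an open set any explicit formula for the derivative may stand in for
  \<open>frechet_derivative\<close>, because \<open>Ck_on\<close> depends only on values on that
  set.\<close>

lemma Ck_on_SucI:
  fixes f :: "'a::euclidean_space \<Rightarrow> real"
  assumes "open W" "\<And>x. x \<in> W \<Longrightarrow> (f has_derivative f' x) (at x)"
    "\<And>b. b \<in> Basis \<Longrightarrow> Ck_on k W (\<lambda>x. f' x b)"
  shows "Ck_on (Suc k) W f"
proof -
  have "f differentiable_on W"
    using assms by (auto simp: differentiable_on_eq_differentiable_at differentiable_def)
  moreover have "Ck_on k W (\<lambda>x. frechet_derivative f (at x) b)" if "b \<in> Basis" for b
    using Ck_on_cong[OF assms(1), of "\<lambda>x. f' x b" "\<lambda>x. frechet_derivative f (at x) b" k]
      assms(3)[OF that] by (simp add: frechet_derivative_at[OF assms(2)])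
  ultimately show ?thesis by simp
qed

section \<open>Smoothness under sums, products and composition\<close>

lemma Ck_on_const: "Ck_on k W (\<lambda>x. c)"
  by (induction k arbitrary: c) simp_all

lemma Ck_on_add:
  assumes "open W"
  shows "Ck_on k W f \<Longrightarrow> Ck_on k W g \<Longrightarrow> Ck_on k W (\<lambda>x. f x + g x)"
proof (induction k arbitrary: f g)
  case 0
  then show ?case by (auto intro: continuous_intros)
next
  case (Suc k)
  have "((\<lambda>x. f x + g x) has_derivative
      (\<lambda>h. frechet_derivative f (at x) h + frechet_derivative g (at x) h)) (at x)" if "x \<in> W" for x
    using Suc.prems that
    by (intro has_derivative_add has_derivative_if_differentiable_on[OF assms]) auto
  then show ?case by (rule Ck_on_SucI[OF assms]) (use Suc in auto)
qed

lemma Ck_on_mult: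
  assumes "open W"
  shows "Ck_on k W f \<Longrightarrow> Ck_on k W g \<Longrightarrow> Ck_on k W (\<lambda>x. f x * g x)"
proof (induction k arbitrary: f g)
  case 0
  then show ?case by (auto intro: continuous_intros)
next
  case (Suc k)
  have "((\<lambda>x. f x * g x) has_derivative
      (\<lambda>h. f x * frechet_derivative g (at x) h + frechet_derivative f (at x) h * g x)) (at x)" if "x \<in> W" for x
    using Suc.prems that
    by (intro has_derivative_mult has_derivative_if_differentiable_on[OF assms]) auto
  then show ?case
    by (rule Ck_on_SucI[OF assms])
       (use Suc Ck_on_Suc_imp[OF Suc.prems(1)] Ck_on_Suc_imp[OF Suc.prems(2)]
         in \<open>auto intro!: Ck_on_add[OF assms]\<close>)
qed

lemma Ck_on_sum:
  assumes "open W" "\<And>i. i \<in> I \<Longrightarrow> Ck_on k W (f i)"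
  shows "Ck_on k W (\<lambda>x. \<Sum>i\<in>I. f i x)"
proof (cases "finite I")
  case True
  then show ?thesis using assms(2)
    by (induction I) (auto intro!: Ck_on_add[OF assms(1)] Ck_on_const)
qed (simp add: Ck_on_const)

text \<open>By the chain rule each directional derivative of the composite is a finite sum of
  products, each of a derivative of a component of \<open>g\<close> and a first derivative of
  \<open>f\<close> evaluated at \<open>g x\<close>. The latter is again a composite, one order
  lower, so the induction has to run over all \<open>f\<close>.\<close>

lemma Ck_on_compose:
  fixes f :: "'b::euclidean_space \<Rightarrow> real" and g :: "'a::euclidean_space \<Rightarrow> 'b"
  assumes "open V" "open W" "g ` V \<subseteq> W"
  shows "Ck_on k W f \<Longrightarrow> (\<And>c. c \<in> Basis \<Longrightarrow> Ck_on k V (\<lambda>x. g x \<bullet> c)) \<Longrightarrow> Ck_on k V (\<lambda>x. f (g x))"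
proof (induction k arbitrary: f)
  case 0
  then have "continuous_on V g" by (subst continuous_on_componentwise) simp
  with 0 show ?case using assms(3) by (auto intro: continuous_on_compose2)
next
  case (Suc k)
  define g' where "g' x h = (\<Sum>c\<in>Basis. frechet_derivative (\<lambda>x. g x \<bullet> c) (at x) h *\<^sub>R c)" for x h
  have g'_inner: "g' x h \<bullet> c = frechet_derivative (\<lambda>x. g x \<bullet> c) (at x) h" if "c \<in> Basis" for x h c
    using that unfolding g'_def by (simp add: inner_sum_left inner_Basis if_distrib cong: if_cong)
  have g: "(g has_derivative g' x) (at x)" if "x \<in> V" for x
  proof (subst has_derivative_componentwise_within, rule ballI)
    fix c :: 'b assume c: "c \<in> Basis"
    have "((\<lambda>x. g x \<bullet> c) has_derivative frechet_derivative (\<lambda>x. g x \<bullet> c) (at x)) (at x)"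
      using Suc.prems(2)[OF c] that by (intro has_derivative_if_differentiable_on[OF assms(1)]) auto
    then show "((\<lambda>x. g x \<bullet> c) has_derivative (\<lambda>h. g' x h \<bullet> c)) (at x)"
      by (simp add: g'_inner[OF c])
  qed
  have deriv: "((\<lambda>x. f (g x)) has_derivative (\<lambda>h. frechet_derivative f (at (g x)) (g' x h))) (at x)"
    if "x \<in> V" for x
    using Suc.prems that assms
    by (intro has_derivative_compose[OF g, of x f] has_derivative_if_differentiable_on[OF assms(2)]) auto
  have eq: "frechet_derivative f (at (g x)) (g' x h) =
     (\<Sum>c\<in>Basis. frechet_derivative (\<lambda>x. g x \<bullet> c) (at x) h * frechet_derivative f (at (g x)) c)"
    if "x \<in> V" for x h
  proof -
    have "(f has_derivative frechet_derivative f (at (g x))) (at (g x))"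
      using Suc.prems that assms by (intro has_derivative_if_differentiable_on[OF assms(2)]) auto
    then have "linear (frechet_derivative f (at (g x)))" by (rule has_derivative_linear)
    then show ?thesis unfolding g'_def by (simp add: linear_sum linear_cmul)
  qed
  have sum: "Ck_on k V (\<lambda>x. \<Sum>c\<in>Basis. frechet_derivative (\<lambda>x. g x \<bullet> c) (at x) b
      * frechet_derivative f (at (g x)) c)" if "b \<in> Basis" for b
  proof (intro Ck_on_sum[OF assms(1)] Ck_on_mult[OF assms(1)])
    fix c :: 'b assume c: "c \<in> Basis"
    show "Ck_on k V (\<lambda>x. frechet_derivative (\<lambda>x. g x \<bullet> c) (at x) b)"
      using Suc.prems(2)[OF c] that by simp
    show "Ck_on k V (\<lambda>x. frechet_derivative f (at (g x)) c)"
    proof (rule Suc.IH)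
      show "Ck_on k W (\<lambda>y. frechet_derivative f (at y) c)" using Suc.prems(1) c by simp
      show "Ck_on k V (\<lambda>x. g x \<bullet> c')" if "c' \<in> Basis" for c'
        by (rule Ck_on_Suc_imp[OF Suc.prems(2)[OF that]])
    qed
  qed
  show ?case
  proof (rule Ck_on_SucI[OF assms(1) deriv])
    fix b :: 'a assume "b \<in> Basis"
    from Ck_on_cong[OF assms(1) eq] sum[OF this]
    show "Ck_on k V (\<lambda>x. frechet_derivative f (at (g x)) (g' x b))" by (rule iffD2)
  qed
qed

lemma Ck_on_bounded_linear:
  assumes "open W" "bounded_linear f"
  shows "Ck_on k W f"
proof (cases k)
  case 0
  then show ?thesis using assms by (simp add: linear_continuous_on)
next
  case (Suc n)
  show ?thesis unfolding Suc
    by (rule Ck_on_SucI[OF assms(1) bounded_linear_imp_has_derivative[OF assms(2)] Ck_on_const])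
qed

text \<open>One induction for both, since each is, up to sign, the derivative of the other.\<close>

lemma Ck_on_sin_cos: "Ck_on k UNIV (sin :: real \<Rightarrow> real) \<and> Ck_on k UNIV (cos :: real \<Rightarrow> real)"
proof (induction k)
  case 0
  show ?case by (auto intro: continuous_intros)
next
  case (Suc k)
  have s: "(sin has_derivative (\<lambda>h. h * cos x)) (at x)"
    and c: "(cos has_derivative (\<lambda>h. h * (- 1 * sin x))) (at x)" for x :: real
    by (auto intro!: derivative_eq_intros)
  show ?case
    by (intro conjI Ck_on_SucI[OF open_UNIV s] Ck_on_SucI[OF open_UNIV c] Ck_on_mult Ck_on_const)
       (use Suc in auto)
qed

lemma Ck_on_EF_component:
  assumes "open V" "c \<in> Basis"
  shows "Ck_on k V (\<lambda>q. EF q \<bullet> c)"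
proof -
  have co: "Ck_on k V (\<lambda>q::real^4. q $ i)" for i
    by (intro Ck_on_bounded_linear assms bounded_linear_vec_nth)
  have si: "Ck_on k V (\<lambda>q::real^4. sin (q $ i))" and cs: "Ck_on k V (\<lambda>q::real^4. cos (q $ i))" for i
    by (rule Ck_on_compose[OF assms(1) open_UNIV]; use Ck_on_sin_cos[of k] co[of i] in simp)+
  have sph: "Ck_on k V (\<lambda>q. sph (q$3) (q$4) $ j)" for j
    using exhaust_3[of j]
    by (auto simp: sph_def vector_3 intro!: Ck_on_mult[OF assms(1)] si cs)
  show ?thesis
    using assms(2) co sph
    by (auto simp: EF_def Basis_prod_def Basis_vec_def inner_axis)
qed

lemma continuous_EF: "continuous_on UNIV EF"
proof -
  have "\<forall>c\<in>Basis. continuous_on UNIV (\<lambda>q. EF q \<bullet> c)"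
    using Ck_on_EF_component[OF open_UNIV, where k=0] unfolding Ck_on.simps(1) by blast
  then show ?thesis by (simp only: continuous_on_componentwise[of _ EF])
qed

lemma open_vimage_EF: "open W \<Longrightarrow> open (EF -` W)"
  by (rule open_vimage[OF _ continuous_EF])

lemma Ck_on_comp_EF:
  assumes "open W" "Ck_on k W \<psi>"
  shows "Ck_on k (EF -` W) (\<psi> \<circ> EF)"
proof -
  note o = open_vimage_EF[OF assms(1)]
  show ?thesis
    unfolding comp_def
    by (rule Ck_on_compose[OF o assms(1) image_vimage_subset assms(2) Ck_on_EF_component[OF o]])
qed

lemma pd_eqI: "(f has_derivative f') (at q) \<Longrightarrow> pd \<mu> f q = f' (axis \<mu> 1)"
  by (simp add: pd_def frechet_derivative_at[symmetric])

lemma pd_cong_open: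
  assumes "open V" "q \<in> V" "\<And>p. p \<in> V \<Longrightarrow> f p = g p"
  shows "pd \<mu> f q = pd \<mu> g q"
  unfolding pd_def by (simp add: frechet_derivative_cong_open[OF assms])

lemma Ck_on_pd: "Ck_on (Suc k) V f \<Longrightarrow> Ck_on k V (pd \<mu> f)"
  by (simp add: pd_def[abs_def] axis_in_Basis_iff)

lemma Ck_on_has_derivative:
  "open V \<Longrightarrow> Ck_on (Suc 0) V f \<Longrightarrow> q \<in> V \<Longrightarrow> (f has_derivative frechet_derivative f (at q)) (at q)"
  by (rule has_derivative_if_differentiable_on) simp_all

section \<open>The wave operator of the metric in coordinates\<close>

lemma matrix_inv_eqI:
  fixes A B :: "'a::semiring_1^'n^'n"
  assumes "A ** B = mat 1" "B ** A = mat 1"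
  shows "matrix_inv A = B"
proof -
  have "\<exists>C. A ** C = mat 1 \<and> C ** A = mat 1" using assms by blast
  then have C: "A ** matrix_inv A = mat 1"
    unfolding matrix_inv_def by (rule someI2_ex) simp
  have "matrix_inv A = (B ** A) ** matrix_inv A" by (simp add: assms)
  also have "\<dots> = B" by (simp add: matrix_mul_assoc[symmetric] C)
  finally show ?thesis .
qed

text \<open>Swapping the first two rows makes the matrix lower triangular with diagonal 1, 1, r^2,
  r^2 sin^2; the absolute value hides the sign of the swap.\<close>

lemma abs_det_metric_EF: "\<bar>det (metric_EF M q)\<bar> = (q$2)^4 * (sin (q$3))\<^sup>2"
proof -
  let ?g = "metric_EF M q"
  let ?p = "Transposition.transpose 1 (2::4)"
  have p: "?p 1 = 2" "?p 2 = 1" "?p 3 = 3" "?p 4 = 4"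
    by (simp_all add: Transposition.transpose_def)
  \<comment> \<open>The swapped matrix keeps one off-diagonal entry, in row 2 and column 1, so
    triangularity depends on how the index type orders 1 and 2.\<close>
  have lt: "\<not> (2::4) < 1" by (simp add: less_bit0_def bit0.Rep_numeral bit0.Rep_1)
  have "det (\<chi> i. ?g $ ?p i) = of_int (sign ?p) * det ?g"
    by (intro det_permute_rows permutes_swap_id) auto
  then have "\<bar>det ?g\<bar> = \<bar>det (\<chi> i. ?g $ ?p i)\<bar>" by (simp add: sign_swap_id abs_mult)
  also have "det (\<chi> i. ?g $ ?p i) = (\<Prod>i\<in>UNIV. (\<chi> i. ?g $ ?p i) $ i $ i)"
  proof (rule det_lowerdiagonal)
    fix i j :: 4 assume "i < j"
    then show "(\<chi> i. ?g $ ?p i) $ i $ j = 0"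
      using exhaust_4[of i] exhaust_4[of j] lt
      by (auto simp: p metric_EF_def vector_4)
  qed
  also have "\<dots> = (q$2)^4 * (sin (q$3))\<^sup>2"
    unfolding UNIV_4 by (simp add: p metric_EF_def vector_4)
  finally show ?thesis by simp
qed

lemma matrix_inv_metric_EF:
  assumes "q$2 \<noteq> 0" "sin (q$3) \<noteq> 0"
  shows "matrix_inv (metric_EF M q) = vector
     [vector [0, 1, 0, 0],
      vector [1, D M (q$2), 0, 0],
      vector [0, 0, 1 / (q$2)\<^sup>2, 0],
      vector [0, 0, 0, 1 / ((q$2)\<^sup>2 * (sin (q$3))\<^sup>2)]]"
  using assms
  by (intro matrix_inv_eqI)
     (auto simp: metric_EF_def matrix_matrix_mult_def mat_def vec_eq_iff forall_4 sum_4 vector_4)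

text \<open>The factor r^2 sin \<theta> clears the volume density. The \<open>\<theta>\<close>-terms
  then form the derivative of sin \<theta> times \<open>pd 3 F\<close>, and the only singular
  coefficient stands in front of the second \<open>\<phi>\<close>-derivative. Both orders of the
  mixed derivative are kept; they are identified after integration over the sphere.\<close>

lemma box_metric_EF:
  fixes F :: "real^4 \<Rightarrow> real"
  assumes V: "open V" and F: "Ck_on 2 V F"
    and q: "q \<in> V" "0 < q$2" "0 < q$3" "q$3 < pi"
  defines "r \<equiv> q$2" and "\<theta> \<equiv> q$3"
  shows "r\<^sup>2 * sin \<theta> * box (metric_EF M) F q =
     sin \<theta> * (r\<^sup>2 * pd 1 (pd 2 F) q + 2 * r * pd 1 F q + r\<^sup>2 * pd 2 (pd 1 F) q
       + 2 * (r - M) * pd 2 F q + (r - M)\<^sup>2 * pd 2 (pd 2 F) q)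
     + (cos \<theta> * pd 3 F q + sin \<theta> * pd 3 (pd 3 F) q) + pd 4 (pd 4 F) q / sin \<theta>"
proof -
  \<comment> \<open>\<open>box\<close> differentiates the inverse metric, so its explicit form is
    needed on a neighbourhood of \<open>q\<close>, where r and sin \<theta> stay positive.\<close>
  define V' where "V' = V \<inter> {q. 0 < q$2} \<inter> {q. 0 < q$3} \<inter> {q. q$3 < pi}"
  have V': "open V'" "q \<in> V'"
    using q unfolding V'_def
    by (auto intro!: open_Int V open_Collect_less continuous_intros)
  define J where "J \<mu> p = (\<Sum>\<nu>\<in>UNIV. sqrt \<bar>det (metric_EF M p)\<bar> * matrix_inv (metric_EF M p) $ \<mu> $ \<nu> * pd \<nu> F p)" for \<mu> p
  have sq: "sqrt \<bar>det (metric_EF M p)\<bar> = (p$2)\<^sup>2 * sin (p$3)"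
    and J: "J 1 p = (p$2)\<^sup>2 * sin (p$3) * pd 2 F p"
      "J 2 p = sin (p$3) * ((p$2)\<^sup>2 * pd 1 F p + (p$2 - M)\<^sup>2 * pd 2 F p)"
      "J 3 p = sin (p$3) * pd 3 F p"
      "J 4 p = 1 / sin (p$3) * pd 4 F p" if "p \<in> V'" for p
  proof -
    have p: "0 < p$2" "0 < sin (p$3)" using that by (auto simp: V'_def sin_gt_zero)
    have "sqrt ((p$2)^4 * (sin (p$3))\<^sup>2) = (p$2)\<^sup>2 * sin (p$3)"
      using p by (intro real_sqrt_unique) (auto simp: power_mult_distrib simp flip: power_mult)
    then show s: "sqrt \<bar>det (metric_EF M p)\<bar> = (p$2)\<^sup>2 * sin (p$3)"
      by (simp add: abs_det_metric_EF)
    have "matrix_inv (metric_EF M p) = vector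
     [vector [0, 1, 0, 0],
      vector [1, D M (p$2), 0, 0],
      vector [0, 0, 1 / (p$2)\<^sup>2, 0],
      vector [0, 0, 0, 1 / ((p$2)\<^sup>2 * (sin (p$3))\<^sup>2)]]"
      using p by (intro matrix_inv_metric_EF) auto
    then show "J 1 p = (p$2)\<^sup>2 * sin (p$3) * pd 2 F p"
      "J 2 p = sin (p$3) * ((p$2)\<^sup>2 * pd 1 F p + (p$2 - M)\<^sup>2 * pd 2 F p)"
      "J 3 p = sin (p$3) * pd 3 F p"
      "J 4 p = 1 / sin (p$3) * pd 4 F p"
      using p by (simp_all add: J_def sum_4 vector_4 s D_def field_simps power2_eq_square)
  qed
  have Ck1: "Ck_on (Suc 0) V (pd \<mu> F)" for \<mu>
    using Ck_on_pd[of "Suc 0" V F \<mu>] F by (simp add: numeral_2_eq_2)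
  have d: "(pd \<mu> F has_derivative frechet_derivative (pd \<mu> F) (at q)) (at q)" for \<mu>
    by (rule Ck_on_has_derivative[OF V Ck1 q(1)])
  have nth: "((\<lambda>q::real^4. q $ i) has_derivative (\<lambda>h. h $ i)) (at q)" for i
    by (rule bounded_linear_imp_has_derivative) (rule bounded_linear_vec_nth)
  have pdJ: "pd \<mu> (J \<mu>) q = pd \<mu> g q" if "\<And>p. p \<in> V' \<Longrightarrow> J \<mu> p = g p" for \<mu> g
    using that by (intro pd_cong_open[OF V'])
  have s0: "0 < sin \<theta>" using q by (simp add: \<theta>_def sin_gt_zero)
  then have s1: "sin (q$3) \<noteq> 0" by (simp add: \<theta>_def)
  have "pd 1 (J 1) q = r\<^sup>2 * sin \<theta> * pd 1 (pd 2 F) q"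
    by (rule trans[OF pdJ[OF J(1)]], assumption, rule trans[OF pd_eqI], (rule derivative_intros d nth)+)
       (simp add: pd_def[of _ "pd _ F"] axis_def r_def \<theta>_def algebra_simps)
  moreover have "pd 2 (J 2) q = sin \<theta> * (2 * r * pd 1 F q + r\<^sup>2 * pd 2 (pd 1 F) q
       + 2 * (r - M) * pd 2 F q + (r - M)\<^sup>2 * pd 2 (pd 2 F) q)"
    by (rule trans[OF pdJ[OF J(2)]], assumption, rule trans[OF pd_eqI], (rule derivative_intros d nth)+)
       (simp add: pd_def[of _ "pd _ F"] axis_def r_def \<theta>_def algebra_simps)
  moreover have "pd 3 (J 3) q = cos \<theta> * pd 3 F q + sin \<theta> * pd 3 (pd 3 F) q"
    by (rule trans[OF pdJ[OF J(3)]], assumption, rule trans[OF pd_eqI], (rule derivative_intros d nth)+)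
       (simp add: pd_def[of _ "pd _ F"] axis_def r_def \<theta>_def algebra_simps)
  moreover have "pd 4 (J 4) q = pd 4 (pd 4 F) q / sin \<theta>"
    by (rule trans[OF pdJ[OF J(4)]], assumption, rule trans[OF pd_eqI], (rule derivative_intros d nth s1)+)
       (simp add: pd_def[of _ "pd _ F"] axis_def r_def \<theta>_def algebra_simps)
  moreover have "r\<^sup>2 * sin \<theta> * box (metric_EF M) F q = (\<Sum>\<mu>\<in>UNIV. pd \<mu> (J \<mu>) q)"
    using sq[OF V'(2)] s0 q(2) by (simp add: box_def J_def[abs_def] r_def \<theta>_def)
  ultimately show ?thesis by (simp add: sum_4 algebra_simps)
qed

section \<open>Spherical means\<close>

lemma leibniz_rule_open:
  fixes k k' :: "real \<Rightarrow> real \<Rightarrow> real"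
  assumes "open T" "t \<in> T"
    and deriv: "\<And>t s. t \<in> T \<Longrightarrow> s \<in> {a..b} \<Longrightarrow> ((\<lambda>t. k t s) has_real_derivative k' t s) (at t)"
    and cont: "\<And>t. t \<in> T \<Longrightarrow> continuous_on {a..b} (k t)"
    and cont': "continuous_on (T \<times> {a..b}) (\<lambda>(t, s). k' t s)"
  shows "((\<lambda>t. integral {a..b} (k t)) has_real_derivative integral {a..b} (k' t)) (at t)"
proof -
  obtain d where d: "0 < d" "ball t d \<subseteq> T" using assms(1,2) unfolding open_contains_ball by metis
  have "((\<lambda>t. integral (cbox a b) (k t)) has_real_derivative integral (cbox a b) (k' t)) (at t within ball t d)"
  proof (rule leibniz_rule_field_derivative)
    show "((\<lambda>t. k t s) has_real_derivative k' x s) (at x within ball t d)"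
      if "x \<in> ball t d" "s \<in> cbox a b" for x s
      using that d by (intro has_field_derivative_at_within[OF deriv]) auto
    show "k x integrable_on cbox a b" if "x \<in> ball t d" for x
      using that d cont by (auto intro!: integrable_continuous_real)
    show "continuous_on (ball t d \<times> cbox a b) (\<lambda>(x, t). k' x t)"
      using cont' by (rule continuous_on_subset) (use d in auto)
  qed (use d in auto)
  then show ?thesis using d by (simp add: at_within_open[OF _ open_ball])
qed

lemma has_real_derivative_iterated_integral:
  fixes K K' :: "real \<Rightarrow> real \<Rightarrow> real \<Rightarrow> real"
  assumes T: "open T" "t \<in> T"
    and K: "continuous_on ((T \<times> {a..b}) \<times> {c..d}) (\<lambda>((t, x), y). K t x y)"
    and K': "continuous_on ((T \<times> {a..b}) \<times> {c..d}) (\<lambda>((t, x), y). K' t x y)"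
    and deriv: "\<And>t x y. t \<in> T \<Longrightarrow> x \<in> {a..b} \<Longrightarrow> y \<in> {c..d} \<Longrightarrow>
       ((\<lambda>t. K t x y) has_real_derivative K' t x y) (at t)"
    and w: "continuous_on {a..b} w"
  shows "((\<lambda>t. integral {a..b} (\<lambda>x. w x * integral {c..d} (K t x))) has_real_derivative
          integral {a..b} (\<lambda>x. w x * integral {c..d} (K' t x))) (at t)"
proof -
  have param: "continuous_on (T \<times> {a..b}) (\<lambda>(t, x). integral {c..d} (L t x))"
    if "continuous_on ((T \<times> {a..b}) \<times> {c..d}) (\<lambda>((t, x), y). L t x y)" for L :: "real \<Rightarrow> real \<Rightarrow> real \<Rightarrow> real"
    using integral_continuous_on_param[of "T \<times> {a..b}" c d "\<lambda>p y. L (fst p) (snd p) y"] that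
    by (simp add: case_prod_beta)
  show ?thesis
  proof (rule leibniz_rule_open[OF T])
    fix t x assume t: "t \<in> T" and x: "x \<in> {a..b}"
    have "((\<lambda>t. integral {c..d} (K t x)) has_real_derivative integral {c..d} (K' t x)) (at t)"
    proof (rule leibniz_rule_open[OF T(1) t])
      show "((\<lambda>t. K t x s) has_real_derivative K' t x s) (at t)" if "t \<in> T" "s \<in> {c..d}" for t s
        using that x by (intro deriv)
      show "continuous_on {c..d} (K t x)" if "t \<in> T" for t
      proof -
        have "continuous_on {c..d} (\<lambda>y. (\<lambda>((t, x), y). K t x y) ((t, x), y))"
          using that x by (intro continuous_on_compose2[OF K]) (auto intro!: continuous_intros)
        then show ?thesis by simp
      qed
      have "continuous_on (T \<times> {c..d}) (\<lambda>p. (\<lambda>((t, x), y). K' t x y) ((fst p, x), snd p))"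
        using x by (intro continuous_on_compose2[OF K']) (auto intro!: continuous_intros)
      then show "continuous_on (T \<times> {c..d}) (\<lambda>(t, y). K' t x y)" by (simp add: case_prod_beta)
    qed
    then show "((\<lambda>t. w x * integral {c..d} (K t x)) has_real_derivative w x * integral {c..d} (K' t x)) (at t)"
      by (rule DERIV_cmult)
  next
    fix t assume t: "t \<in> T"
    have "continuous_on {a..b} (\<lambda>x. (\<lambda>(t, x). integral {c..d} (K t x)) (t, x))"
      using t by (intro continuous_on_compose2[OF param[OF K]]) (auto intro!: continuous_intros)
    then show "continuous_on {a..b} (\<lambda>x. w x * integral {c..d} (K t x))"
      by (intro continuous_on_mult w) simp
  next
    have "continuous_on (T \<times> {a..b}) (\<lambda>p. w (snd p))"
      by (rule continuous_on_compose2[OF w]) (auto intro!: continuous_intros)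
    with param[OF K'] show "continuous_on (T \<times> {a..b}) (\<lambda>(t, x). w x * integral {c..d} (K' t x))"
      unfolding case_prod_beta by (intro continuous_on_mult)
  qed
qed

text \<open>Differentiating f(w, s) - f(w, r), the integral of \<open>fr\<close>, with respect to w
  shows that \<open>A\<close> and \<open>B\<close> have the same integral over every interval
  {r..s}. The one-sided derivative of these integrals at s = r then gives equality at the
  point.\<close>

lemma mixed_partials_eq:
  fixes f fv fr A B :: "real \<Rightarrow> real \<Rightarrow> real"
  assumes U: "open U" "(v, r) \<in> U"
    and cont: "continuous_on U (\<lambda>(v, r). fr v r)"
      "continuous_on U (\<lambda>(v, r). A v r)" "continuous_on U (\<lambda>(v, r). B v r)"
    and f_v: "\<And>v r. (v, r) \<in> U \<Longrightarrow> ((\<lambda>v. f v r) has_real_derivative fv v r) (at v)"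
    and f_r: "\<And>v r. (v, r) \<in> U \<Longrightarrow> ((\<lambda>r. f v r) has_real_derivative fr v r) (at r)"
    and fr_v: "\<And>v r. (v, r) \<in> U \<Longrightarrow> ((\<lambda>v. fr v r) has_real_derivative A v r) (at v)"
    and fv_r: "\<And>v r. (v, r) \<in> U \<Longrightarrow> ((\<lambda>r. fv v r) has_real_derivative B v r) (at r)"
  shows "A v r = B v r"
proof -
  obtain T S where TS: "open T" "open S" "(v, r) \<in> T \<times> S" "T \<times> S \<subseteq> U"
    using U by (rule open_prod_elim)
  obtain e where e: "0 < e" "cball r e \<subseteq> S" using TS unfolding open_contains_cball by blast
  define b where "b = r + e"
  have b: "r < b" "{r..b} \<subseteq> S" using e by (auto simp: b_def cball_def dist_real_def subset_iff)
  have TbU: "(w, x) \<in> U" if "w \<in> T" "x \<in> {r..b}" for w x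
    using that TS(4) b(2) by blast
  have sec: "continuous_on {r..s} (k w)" if "continuous_on U (\<lambda>(v, r). k v r)" "w \<in> T" "s \<le> b"
    for k :: "real \<Rightarrow> real \<Rightarrow> real" and w s
  proof -
    have "continuous_on {r..s} (\<lambda>x. (\<lambda>(v, r). k v r) (w, x))"
      using that TbU by (intro continuous_on_compose2[OF that(1)]) (auto intro!: continuous_intros)
    then show ?thesis by simp
  qed
  have eq: "integral {r..s} (A v) = integral {r..s} (B v)" if s: "s \<in> {r..b}" for s
  proof -
    have TsU: "(w, x) \<in> U" if "w \<in> T" "x \<in> {r..s}" for w x using that TbU s by auto
    have "((\<lambda>w. integral {r..s} (fr w)) has_real_derivative integral {r..s} (A v)) (at v)"
    proof (rule leibniz_rule_open)
      show "continuous_on (T \<times> {r..s}) (\<lambda>(t, s). A t s)"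
        using cont(2) by (rule continuous_on_subset) (use TsU in auto)
    qed (use TS TsU s in \<open>auto intro!: fr_v sec cont\<close>)
    moreover have "v \<in> T" using TS by simp
    moreover have "integral {r..s} (fr w) = f w s - f w r" if "w \<in> T" for w
      using s that TsU by (intro integral_FTC has_field_derivative_at_within[OF f_r]) auto
    ultimately have "((\<lambda>w. f w s - f w r) has_real_derivative integral {r..s} (A v)) (at v)"
      by (rule has_field_derivative_transform_within_open[OF _ TS(1)])
    moreover have "((\<lambda>w. f w s - f w r) has_real_derivative fv v s - fv v r) (at v)"
      using s TS TsU by (intro DERIV_diff f_v) auto
    ultimately have "integral {r..s} (A v) = fv v s - fv v r" by (rule DERIV_unique)
    also have "\<dots> = integral {r..s} (B v)"
      using s TS TsU by (intro integral_FTC[symmetric] has_field_derivative_at_within[OF fv_r]) auto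
    finally show ?thesis .
  qed
  have d: "((\<lambda>s. integral {r..s} (k v)) has_real_derivative k v r) (at r within {r..b})"
    if "continuous_on U (\<lambda>(v, r). k v r)" for k :: "real \<Rightarrow> real \<Rightarrow> real"
    using that TS b(1) by (intro integral_has_real_derivative sec) auto
  have "((\<lambda>s. integral {r..s} (B v)) has_real_derivative A v r) (at r within {r..b})"
    using d[OF cont(2)] unfolding has_field_derivative_def
    by (rule has_derivative_transform[rotated 2]) (use b(1) eq in auto)
  moreover note d[OF cont(3)]
  moreover have "at r within {r..b} \<noteq> bot" using b(1) by (simp add: at_within_Icc_at_right)
  ultimately show ?thesis by (rule has_field_derivative_unique)
qed

section \<open>Integrals over circles and spheres\<close>

definition coords :: "real \<Rightarrow> real \<Rightarrow> real \<Rightarrow> real \<Rightarrow> real^4" where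
  "coords v r \<theta> \<phi> = vector [v, r, \<theta>, \<phi>]"

lemma coords_nth [simp]:
  "coords v r \<theta> \<phi> $ 1 = v" "coords v r \<theta> \<phi> $ 2 = r" "coords v r \<theta> \<phi> $ 3 = \<theta>" "coords v r \<theta> \<phi> $ 4 = \<phi>"
  by (simp_all add: coords_def vector_4)

lemma EF_coords [simp]: "EF (coords v r \<theta> \<phi>) = (v, r, sph \<theta> \<phi>)"
  by (simp add: EF_def)

lemma continuous_on_coords [continuous_intros]:
  assumes "continuous_on S a" "continuous_on S b" "continuous_on S c" "continuous_on S d"
  shows "continuous_on S (\<lambda>x. coords (a x) (b x) (c x) (d x))"
proof -
  have "continuous_on S (\<lambda>x. coords (a x) (b x) (c x) (d x) $ i)" for i
    using exhaust_4[of i] assms by auto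
  then have "continuous_on S (\<lambda>x. \<chi> i. coords (a x) (b x) (c x) (d x) $ i)"
    by (rule continuous_on_vec_lambda)
  then show ?thesis by simp
qed

lemma coords_has_derivative:
  "(coords v r \<theta> has_derivative (\<lambda>h. h *\<^sub>R axis 4 1)) (at \<phi>)"
  "((\<lambda>\<theta>. coords v r \<theta> \<phi>) has_derivative (\<lambda>h. h *\<^sub>R axis 3 1)) (at \<theta>)"
  "((\<lambda>r. coords v r \<theta> \<phi>) has_derivative (\<lambda>h. h *\<^sub>R axis 2 1)) (at r)"
  "((\<lambda>v. coords v r \<theta> \<phi>) has_derivative (\<lambda>h. h *\<^sub>R axis 1 1)) (at v)"
proof -
  have *: "coords v r \<theta> \<phi> = v *\<^sub>R axis 1 1 + r *\<^sub>R axis 2 1 + \<theta> *\<^sub>R axis 3 1 + \<phi> *\<^sub>R axis 4 1" for v r \<theta> \<phi>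
    by (simp add: vec_eq_iff forall_4 axis_def)
  show "(coords v r \<theta> has_derivative (\<lambda>h. h *\<^sub>R axis 4 1)) (at \<phi>)"
    unfolding *[abs_def] by (auto intro!: derivative_eq_intros)
  show "((\<lambda>\<theta>. coords v r \<theta> \<phi>) has_derivative (\<lambda>h. h *\<^sub>R axis 3 1)) (at \<theta>)"
    "((\<lambda>r. coords v r \<theta> \<phi>) has_derivative (\<lambda>h. h *\<^sub>R axis 2 1)) (at r)"
    "((\<lambda>v. coords v r \<theta> \<phi>) has_derivative (\<lambda>h. h *\<^sub>R axis 1 1)) (at v)"
    unfolding * by (auto intro!: derivative_eq_intros)
qed

lemma pd_partial:
  assumes "open V" "Ck_on (Suc 0) V h" "coords v r \<theta> \<phi> \<in> V"
  shows "((\<lambda>v. h (coords v r \<theta> \<phi>)) has_real_derivative pd 1 h (coords v r \<theta> \<phi>)) (at v)"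
    "((\<lambda>r. h (coords v r \<theta> \<phi>)) has_real_derivative pd 2 h (coords v r \<theta> \<phi>)) (at r)"
    "((\<lambda>\<theta>. h (coords v r \<theta> \<phi>)) has_real_derivative pd 3 h (coords v r \<theta> \<phi>)) (at \<theta>)"
    "((\<lambda>\<phi>. h (coords v r \<theta> \<phi>)) has_real_derivative pd 4 h (coords v r \<theta> \<phi>)) (at \<phi>)"
proof -
  let ?q = "coords v r \<theta> \<phi>"
  note d = Ck_on_has_derivative[OF assms]
  have lin: "frechet_derivative h (at ?q) (x *\<^sub>R axis i 1) = pd i h ?q * x" for x i
    using linear_cmul[OF has_derivative_linear[OF d]] by (simp add: pd_def mult.commute)
  note c = has_derivative_compose[of _ _ _ UNIV h "frechet_derivative h (at ?q)"]
  show "((\<lambda>v. h (coords v r \<theta> \<phi>)) has_real_derivative pd 1 h ?q) (at v)"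
    "((\<lambda>r. h (coords v r \<theta> \<phi>)) has_real_derivative pd 2 h ?q) (at r)"
    "((\<lambda>\<theta>. h (coords v r \<theta> \<phi>)) has_real_derivative pd 3 h ?q) (at \<theta>)"
    "((\<lambda>\<phi>. h (coords v r \<theta> \<phi>)) has_real_derivative pd 4 h ?q) (at \<phi>)"
    unfolding has_field_derivative_def
    using c[OF coords_has_derivative(4) d] c[OF coords_has_derivative(3) d]
      c[OF coords_has_derivative(2) d] c[OF coords_has_derivative(1) d]
    by (simp_all add: lin)
qed

text \<open>The inner integral gets its own name because the \<open>\<phi>\<close>-term of the wave
  operator has to be integrated away at each fixed \<open>\<theta>\<close>, before its factor 1 /
  sin \<theta> reaches the poles.\<close>

definition circle_integral :: "(real^4 \<Rightarrow> real) \<Rightarrow> real \<Rightarrow> real \<Rightarrow> real \<Rightarrow> real" where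
  "circle_integral h v r \<theta> = integral {0..2*pi} (\<lambda>\<phi>. h (coords v r \<theta> \<phi>))"

definition sphere_integral :: "(real^4 \<Rightarrow> real) \<Rightarrow> real \<Rightarrow> real \<Rightarrow> real" where
  "sphere_integral h v r = integral {0..pi} (\<lambda>\<theta>. sin \<theta> * circle_integral h v r \<theta>)"

locale coordinate_domain =
  fixes V :: "(real^4) set" and U :: "(real \<times> real) set"
  assumes open_V: "open V" and open_U: "open U"
    and coords_in: "\<And>v r \<theta> \<phi>. (v, r) \<in> U \<Longrightarrow> coords v r \<theta> \<phi> \<in> V"
begin

lemma cont_pd: "Ck_on (Suc 0) V h \<Longrightarrow> continuous_on V (pd \<mu> h)"
  using Ck_on_pd[of 0 V h \<mu>] by simp

lemma cont_coords:
  assumes "continuous_on V h" "(v, r) \<in> U"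
  shows "continuous_on S (\<lambda>\<phi>. h (coords v r \<theta> \<phi>))"
  using coords_in[OF assms(2)]
  by (intro continuous_on_compose2[OF assms(1)] continuous_intros) auto

lemma has_integral_circle_integral:
  assumes "continuous_on V h" "(v, r) \<in> U"
  shows "((\<lambda>\<phi>. h (coords v r \<theta> \<phi>)) has_integral circle_integral h v r \<theta>) {0..2*pi}"
  unfolding circle_integral_def
  by (intro integrable_integral integrable_continuous_real cont_coords assms)

lemma cont_circle_integral:
  assumes "continuous_on V h" "(v, r) \<in> U"
  shows "continuous_on S (circle_integral h v r)"
proof -
  have "continuous_on (S \<times> cbox 0 (2*pi)) (\<lambda>p. h (coords v r (fst p) (snd p)))"
    using coords_in[OF assms(2)]
    by (intro continuous_on_compose2[OF assms(1)] continuous_intros) auto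
  then have "continuous_on (S \<times> cbox 0 (2*pi)) (\<lambda>(\<theta>, \<phi>). h (coords v r \<theta> \<phi>))"
    by (simp add: case_prod_beta)
  from integral_continuous_on_param[OF this] show ?thesis
    by (simp add: circle_integral_def[abs_def])
qed

lemma circle_integral_deriv:
  assumes h: "Ck_on (Suc 0) V h" and "(v, r) \<in> U"
  shows "(circle_integral h v r has_real_derivative circle_integral (pd 3 h) v r \<theta>) (at \<theta>)"
  unfolding circle_integral_def[abs_def]
proof (rule leibniz_rule_open[OF open_UNIV UNIV_I])
  show "((\<lambda>\<theta>. h (coords v r \<theta> s)) has_real_derivative pd 3 h (coords v r \<theta> s)) (at \<theta>)" for \<theta> s
    by (rule pd_partial(3)[OF open_V h coords_in[OF assms(2)]])
  show "continuous_on {0..2*pi} (\<lambda>\<phi>. h (coords v r \<theta> \<phi>))" for \<theta>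
    using Ck_on_Suc_imp[OF h] assms(2) by (intro cont_coords) simp_all
  have "continuous_on (UNIV \<times> {0..2*pi}) (\<lambda>p. pd 3 h (coords v r (fst p) (snd p)))"
    using coords_in[OF assms(2)]
    by (intro continuous_on_compose2[OF cont_pd[OF h, of 3]] continuous_intros) auto
  then show "continuous_on (UNIV \<times> {0..2*pi}) (\<lambda>(\<theta>, \<phi>). pd 3 h (coords v r \<theta> \<phi>))"
    by (simp add: case_prod_beta)
qed

lemma has_integral_sphere_integral:
  assumes "continuous_on V h" "(v, r) \<in> U"
  shows "((\<lambda>\<theta>. sin \<theta> * circle_integral h v r \<theta>) has_integral sphere_integral h v r) {0..pi}"
  unfolding sphere_integral_def
  by (intro integrable_integral integrable_continuous_real continuous_intros cont_circle_integral assms)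

lemma cont_sphere_integral:
  assumes "continuous_on V h"
  shows "continuous_on U (\<lambda>(v, r). sphere_integral h v r)"
proof -
  have "continuous_on ((U \<times> cbox 0 pi) \<times> cbox 0 (2*pi))
      (\<lambda>p. h (coords (fst (fst (fst p))) (snd (fst (fst p))) (snd (fst p)) (snd p)))"
    using coords_in by (intro continuous_on_compose2[OF assms] continuous_intros) auto
  then have "continuous_on ((U \<times> cbox 0 pi) \<times> cbox 0 (2*pi))
      (\<lambda>(p, \<phi>). h (coords (fst (fst p)) (snd (fst p)) (snd p) \<phi>))"
    by (simp add: case_prod_beta)
  from integral_continuous_on_param[OF this]
  have "continuous_on (U \<times> cbox 0 pi) (\<lambda>p. circle_integral h (fst (fst p)) (snd (fst p)) (snd p))"
    by (simp add: circle_integral_def)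
  then have "continuous_on (U \<times> cbox 0 pi) (\<lambda>(p, \<theta>). sin \<theta> * circle_integral h (fst p) (snd p) \<theta>)"
    unfolding case_prod_beta by (intro continuous_intros)
  from integral_continuous_on_param[OF this] show ?thesis
    by (simp add: sphere_integral_def case_prod_beta)
qed

lemma sphere_integral_deriv_v:
  assumes h: "Ck_on (Suc 0) V h" and vr: "(v, r) \<in> U"
  shows "((\<lambda>v. sphere_integral h v r) has_real_derivative sphere_integral (pd 1 h) v r) (at v)"
  unfolding sphere_integral_def circle_integral_def
proof (rule has_real_derivative_iterated_integral[where T="{v. (v, r) \<in> U}"])
  have "open ((\<lambda>v. (v, r)) -` U)" by (intro open_vimage open_U continuous_intros)
  then show "open {v. (v, r) \<in> U}" by (simp add: vimage_def)
  have *: "continuous_on (({v. (v, r) \<in> U} \<times> {0..pi}) \<times> {0..2*pi}) (\<lambda>((v, \<theta>), \<phi>). g (coords v r \<theta> \<phi>))"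
    if "continuous_on V g" for g :: "real^4 \<Rightarrow> real"
    unfolding case_prod_beta
    using coords_in by (intro continuous_on_compose2[OF that] continuous_intros) auto
  show "continuous_on (({v. (v, r) \<in> U} \<times> {0..pi}) \<times> {0..2*pi}) (\<lambda>((v, \<theta>), \<phi>). h (coords v r \<theta> \<phi>))"
    using Ck_on_Suc_imp[OF h] by (intro *) simp
  show "continuous_on (({v. (v, r) \<in> U} \<times> {0..pi}) \<times> {0..2*pi}) (\<lambda>((v, \<theta>), \<phi>). pd 1 h (coords v r \<theta> \<phi>))"
    by (intro * cont_pd h)
  show "((\<lambda>v. h (coords v r \<theta> \<phi>)) has_real_derivative pd 1 h (coords v r \<theta> \<phi>)) (at v)"
    if "v \<in> {v. (v, r) \<in> U}" for v \<theta> \<phi>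
    using that by (intro pd_partial[OF open_V h] coords_in) auto
qed (use vr in \<open>auto intro!: continuous_intros\<close>)

lemma sphere_integral_deriv_r:
  assumes h: "Ck_on (Suc 0) V h" and vr: "(v, r) \<in> U"
  shows "((\<lambda>r. sphere_integral h v r) has_real_derivative sphere_integral (pd 2 h) v r) (at r)"
  unfolding sphere_integral_def circle_integral_def
proof (rule has_real_derivative_iterated_integral[where T="{r. (v, r) \<in> U}"])
  have "open ((\<lambda>r. (v, r)) -` U)" by (intro open_vimage open_U continuous_intros)
  then show "open {r. (v, r) \<in> U}" by (simp add: vimage_def)
  have *: "continuous_on (({r. (v, r) \<in> U} \<times> {0..pi}) \<times> {0..2*pi}) (\<lambda>((r, \<theta>), \<phi>). g (coords v r \<theta> \<phi>))"
    if "continuous_on V g" for g :: "real^4 \<Rightarrow> real"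
    unfolding case_prod_beta
    using coords_in by (intro continuous_on_compose2[OF that] continuous_intros) auto
  show "continuous_on (({r. (v, r) \<in> U} \<times> {0..pi}) \<times> {0..2*pi}) (\<lambda>((r, \<theta>), \<phi>). h (coords v r \<theta> \<phi>))"
    using Ck_on_Suc_imp[OF h] by (intro *) simp
  show "continuous_on (({r. (v, r) \<in> U} \<times> {0..pi}) \<times> {0..2*pi}) (\<lambda>((r, \<theta>), \<phi>). pd 2 h (coords v r \<theta> \<phi>))"
    by (intro * cont_pd h)
  show "((\<lambda>r. h (coords v r \<theta> \<phi>)) has_real_derivative pd 2 h (coords v r \<theta> \<phi>)) (at r)"
    if "r \<in> {r. (v, r) \<in> U}" for r \<theta> \<phi>
    using that by (intro pd_partial[OF open_V h] coords_in) auto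
qed (use vr in \<open>auto intro!: continuous_intros\<close>)

lemma sphere_integral_mixed:
  assumes h: "Ck_on 2 V h" and "(v, r) \<in> U"
  shows "sphere_integral (pd 2 (pd 1 h)) v r = sphere_integral (pd 1 (pd 2 h)) v r"
proof -
  have h1: "Ck_on (Suc 0) V h" "Ck_on (Suc 0) V (pd \<mu> h)" for \<mu>
    using h Ck_on_Suc_imp[of "Suc 0" V h] Ck_on_pd[of "Suc 0" V h \<mu>] by (simp_all add: numeral_2_eq_2)
  show ?thesis
    by (rule mixed_partials_eq[OF open_U assms(2), symmetric,
          of "sphere_integral (pd 2 h)" _ _ "sphere_integral h" "sphere_integral (pd 1 h)"])
       (auto intro!: cont_sphere_integral cont_pd h1 sphere_integral_deriv_v sphere_integral_deriv_r)
qed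

text \<open>The spherical Laplacian has integral zero over the sphere, so only the \<open>v\<close>-
  and \<open>r\<close>-derivatives survive; the poles are dealt with through the factor sin
  \<theta>.\<close>

lemma sphere_integral_wave:
  assumes F: "Ck_on 2 V F" and vr: "(v, r) \<in> U" and "0 < r"
    and periodic: "\<And>\<theta> \<phi>. F (coords v r \<theta> (\<phi> + 2*pi)) = F (coords v r \<theta> \<phi>)"
    and wave: "\<And>\<theta> \<phi>. 0 < \<theta> \<Longrightarrow> \<theta> < pi \<Longrightarrow> box (metric_EF M) F (coords v r \<theta> \<phi>) = 0"
  shows "2 * r\<^sup>2 * sphere_integral (pd 1 (pd 2 F)) v r + 2 * r * sphere_integral (pd 1 F) v r
       + (r - M)\<^sup>2 * sphere_integral (pd 2 (pd 2 F)) v r + 2 * (r - M) * sphere_integral (pd 2 F) v r = 0"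
proof -
  have F1: "Ck_on (Suc 0) V F" "Ck_on (Suc 0) V (pd \<mu> F)" for \<mu>
    using F Ck_on_Suc_imp[of "Suc 0" V F] Ck_on_pd[of "Suc 0" V F \<mu>] by (simp_all add: numeral_2_eq_2)
  have cont: "continuous_on V (pd \<mu> F)" "continuous_on V (pd \<nu> (pd \<mu> F))" for \<mu> \<nu>
    by (intro cont_pd F1)+
  define L where "L q = r\<^sup>2 * pd 1 (pd 2 F) q + 2 * r * pd 1 F q + r\<^sup>2 * pd 2 (pd 1 F) q
       + 2 * (r - M) * pd 2 F q + (r - M)\<^sup>2 * pd 2 (pd 2 F) q" for q
  define C where "C h \<theta> = circle_integral h v r \<theta>" for h \<theta>
  define CL where "CL \<theta> = r\<^sup>2 * C (pd 1 (pd 2 F)) \<theta> + 2 * r * C (pd 1 F) \<theta> + r\<^sup>2 * C (pd 2 (pd 1 F)) \<theta>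
       + 2 * (r - M) * C (pd 2 F) \<theta> + (r - M)\<^sup>2 * C (pd 2 (pd 2 F)) \<theta>" for \<theta>
  have hC: "((\<lambda>\<phi>. h (coords v r \<theta> \<phi>)) has_integral C h \<theta>) {0..2*pi}" if "continuous_on V h" for h \<theta>
    unfolding C_def by (rule has_integral_circle_integral[OF that vr])
  \<comment> \<open>The \<open>\<phi>\<close>-derivative inherits the period 2 pi, so its own
    derivative integrates to zero over a full circle.\<close>
  have C44: "C (pd 4 (pd 4 F)) \<theta> = 0" for \<theta>
  proof -
    have d: "((\<lambda>\<phi>. F (coords v r \<theta> \<phi>)) has_real_derivative pd 4 F (coords v r \<theta> \<phi>)) (at \<phi>)" for \<phi>
      by (rule pd_partial(4)[OF open_V F1(1) coords_in[OF vr]])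
    have "((\<lambda>\<phi>. F (coords v r \<theta> (\<phi> + 2*pi))) has_real_derivative pd 4 F (coords v r \<theta> (0 + 2*pi))) (at 0)"
      using d[of "0 + 2*pi"] unfolding DERIV_shift .
    then have "pd 4 F (coords v r \<theta> (2*pi)) = pd 4 F (coords v r \<theta> 0)"
      unfolding periodic using d[of 0] DERIV_unique by fastforce
    moreover have "C (pd 4 (pd 4 F)) \<theta> = pd 4 F (coords v r \<theta> (2*pi)) - pd 4 F (coords v r \<theta> 0)"
      unfolding C_def circle_integral_def
      by (intro integral_FTC has_field_derivative_at_within[OF pd_partial(4)[OF open_V F1(2) coords_in[OF vr]]]) auto
    ultimately show ?thesis by simp
  qed
  have ode: "cos \<theta> * C (pd 3 F) \<theta> + sin \<theta> * C (pd 3 (pd 3 F)) \<theta> = - (sin \<theta> * CL \<theta>)"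
    if \<theta>: "0 < \<theta>" "\<theta> < pi" for \<theta>
  proof -
    have "sin \<theta> * L (coords v r \<theta> \<phi>)
     + (cos \<theta> * pd 3 F (coords v r \<theta> \<phi>) + sin \<theta> * pd 3 (pd 3 F) (coords v r \<theta> \<phi>))
     + pd 4 (pd 4 F) (coords v r \<theta> \<phi>) * (1 / sin \<theta>) = 0" for \<phi>
      using box_metric_EF[OF open_V F coords_in[OF vr], of \<theta> \<phi> M] wave[OF \<theta>, of \<phi>] \<theta> \<open>0 < r\<close>
      by (simp add: L_def)
    moreover have "((\<lambda>\<phi>. sin \<theta> * L (coords v r \<theta> \<phi>)
     + (cos \<theta> * pd 3 F (coords v r \<theta> \<phi>) + sin \<theta> * pd 3 (pd 3 F) (coords v r \<theta> \<phi>))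
     + pd 4 (pd 4 F) (coords v r \<theta> \<phi>) * (1 / sin \<theta>)) has_integral
      sin \<theta> * CL \<theta> + (cos \<theta> * C (pd 3 F) \<theta> + sin \<theta> * C (pd 3 (pd 3 F)) \<theta>)
       + C (pd 4 (pd 4 F)) \<theta> * (1 / sin \<theta>)) {0..2*pi}"
      unfolding L_def CL_def
      by (intro has_integral_add has_integral_mult_right has_integral_mult_left hC cont)
    ultimately have "((\<lambda>\<phi>. 0) has_integral
      sin \<theta> * CL \<theta> + (cos \<theta> * C (pd 3 F) \<theta> + sin \<theta> * C (pd 3 (pd 3 F)) \<theta>)
       + C (pd 4 (pd 4 F)) \<theta> * (1 / sin \<theta>)) {0..2*pi}" by simp
    from has_integral_unique[OF this has_integral_0] show ?thesis by (simp add: C44)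
  qed
  \<comment> \<open>The primitive sin \<theta> times \<open>C (pd 3 F)\<close> vanishes at both
    poles. The equation is available for 0 < \<theta> < pi only, hence the form of the fundamental
    theorem that asks for derivatives in the interior.\<close>
  have "((\<lambda>\<theta>. - (sin \<theta> * CL \<theta>)) has_integral sin pi * C (pd 3 F) pi - sin 0 * C (pd 3 F) 0) {0..pi}"
  proof (rule fundamental_theorem_of_calculus_interior)
    show "continuous_on {0..pi} (\<lambda>\<theta>. sin \<theta> * C (pd 3 F) \<theta>)"
      unfolding C_def by (intro continuous_intros cont_circle_integral cont vr)
    fix \<theta> assume "\<theta> \<in> {0<..<pi}"
    then have "0 < \<theta>" "\<theta> < pi" by auto
    moreover have "(C (pd 3 F) has_real_derivative C (pd 3 (pd 3 F)) \<theta>) (at \<theta>)"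
      unfolding C_def[abs_def] by (intro circle_integral_deriv F1 vr)
    then have "((\<lambda>\<theta>. sin \<theta> * C (pd 3 F) \<theta>) has_real_derivative
       cos \<theta> * C (pd 3 F) \<theta> + sin \<theta> * C (pd 3 (pd 3 F)) \<theta>) (at \<theta>)"
      by (auto intro!: derivative_eq_intros)
    ultimately show "((\<lambda>\<theta>. sin \<theta> * C (pd 3 F) \<theta>) has_vector_derivative - (sin \<theta> * CL \<theta>)) (at \<theta>)"
      by (simp add: ode has_real_derivative_iff_has_vector_derivative)
  qed simp
  from has_integral_neg[OF this] have 0: "((\<lambda>\<theta>. sin \<theta> * CL \<theta>) has_integral 0) {0..pi}" by simp
  have hS: "((\<lambda>\<theta>. sin \<theta> * C h \<theta>) has_integral sphere_integral h v r) {0..pi}" if "continuous_on V h" for h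
    unfolding C_def by (rule has_integral_sphere_integral[OF that vr])
  have "((\<lambda>\<theta>. r\<^sup>2 * (sin \<theta> * C (pd 1 (pd 2 F)) \<theta>) + 2 * r * (sin \<theta> * C (pd 1 F) \<theta>)
        + r\<^sup>2 * (sin \<theta> * C (pd 2 (pd 1 F)) \<theta>)
        + 2 * (r - M) * (sin \<theta> * C (pd 2 F) \<theta>) + (r - M)\<^sup>2 * (sin \<theta> * C (pd 2 (pd 2 F)) \<theta>)) has_integral
     r\<^sup>2 * sphere_integral (pd 1 (pd 2 F)) v r + 2 * r * sphere_integral (pd 1 F) v r
        + r\<^sup>2 * sphere_integral (pd 2 (pd 1 F)) v r
        + 2 * (r - M) * sphere_integral (pd 2 F) v r + (r - M)\<^sup>2 * sphere_integral (pd 2 (pd 2 F)) v r) {0..pi}"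
    by (intro has_integral_add has_integral_mult_right hS cont)
  also have "(\<lambda>\<theta>. r\<^sup>2 * (sin \<theta> * C (pd 1 (pd 2 F)) \<theta>) + 2 * r * (sin \<theta> * C (pd 1 F) \<theta>)
        + r\<^sup>2 * (sin \<theta> * C (pd 2 (pd 1 F)) \<theta>)
        + 2 * (r - M) * (sin \<theta> * C (pd 2 F) \<theta>) + (r - M)\<^sup>2 * (sin \<theta> * C (pd 2 (pd 2 F)) \<theta>))
      = (\<lambda>\<theta>. sin \<theta> * CL \<theta>)"
    by (simp add: CL_def fun_eq_iff distrib_left mult.left_commute)
  finally have "r\<^sup>2 * sphere_integral (pd 1 (pd 2 F)) v r + 2 * r * sphere_integral (pd 1 F) v r
        + r\<^sup>2 * sphere_integral (pd 2 (pd 1 F)) v r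
        + 2 * (r - M) * sphere_integral (pd 2 F) v r + (r - M)\<^sup>2 * sphere_integral (pd 2 (pd 2 F)) v r = 0"
    by (rule has_integral_unique[OF _ 0])
  then show ?thesis unfolding sphere_integral_mixed[OF F vr] by simp
qed

end

section \<open>The measures on the sphere and on spacetime\<close>

lemma norm_sph [simp]: "norm (sph \<theta> \<phi>) = 1"
proof -
  have "sph \<theta> \<phi> \<bullet> sph \<theta> \<phi> = (sin \<theta>)\<^sup>2 * ((sin \<phi>)\<^sup>2 + (cos \<phi>)\<^sup>2) + (cos \<theta>)\<^sup>2"
    unfolding sph_def inner_vec_def sum_3 vector_3 inner_real_def by algebra
  then show ?thesis by (simp add: norm_eq_1)
qed

lemma continuous_on_sph: "continuous_on S (\<lambda>(\<theta>, \<phi>). sph \<theta> \<phi>)"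
proof -
  have "continuous_on S (\<lambda>p. sph (fst p) (snd p) $ j)" for j
  proof -
    consider "j = 1" | "j = 2" | "j = 3" using exhaust_3[of j] by blast
    then show ?thesis
      by cases (simp_all add: sph_def vector_3, (intro continuous_intros)+)
  qed
  then have "continuous_on S (\<lambda>p. \<chi> j. sph (fst p) (snd p) $ j)"
    by (rule continuous_on_vec_lambda)
  then show ?thesis by (simp add: case_prod_beta)
qed

text \<open>A real-valued form of the density, non-negative on the whole plane thanks to the
  cut-off, so that integrals of signed functions can be computed against it.\<close>

definition sphere_density :: "real \<times> real \<Rightarrow> real" where
  "sphere_density = (\<lambda>x. indicator ({0..pi} \<times> {0..2*pi}) x * sin (fst x))"

lemma sphere_density_nonneg: "0 \<le> sphere_density x"
  by (auto simp: sphere_density_def indicator_def sin_ge_zero)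

lemma sphere_density_measurable [measurable]: "sphere_density \<in> borel_measurable borel"
  unfolding sphere_density_def
  by (intro borel_measurable_times borel_measurable_indicator borel_closed closed_Times
      borel_measurable_continuous_onI continuous_intros)

lemma sph_measurable [measurable]: "(\<lambda>(\<theta>, \<phi>). sph \<theta> \<phi>) \<in> borel_measurable borel"
  by (rule borel_measurable_continuous_onI[OF continuous_on_sph])

lemma sphere_measure_eq:
  "sphere_measure = distr (density lborel (\<lambda>x. ennreal (sphere_density x))) borel (\<lambda>(\<theta>, \<phi>). sph \<theta> \<phi>)"
proof -
  have "(\<lambda>(\<theta>, \<phi>). ennreal (sin \<theta>) * indicator ({0..pi} \<times> {0..2*pi}) (\<theta>, \<phi>)) = (\<lambda>x. ennreal (sphere_density x))"
    by (auto simp: sphere_density_def indicator_def fun_eq_iff)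
  then show ?thesis by (simp add: sphere_measure_def)
qed

lemma sets_sphere_measure [measurable_cong, simp]: "sets sphere_measure = sets borel"
  by (simp add: sphere_measure_def)

lemma space_sphere_measure [simp]: "space sphere_measure = UNIV"
  by (simp add: sphere_measure_def)

lemma finite_measure_sphere_measure: "finite_measure sphere_measure"
proof
  have "emeasure sphere_measure (space sphere_measure) = (\<integral>\<^sup>+ x. ennreal (sphere_density x) \<partial>lborel)"
    unfolding sphere_measure_eq
    by (subst emeasure_distr) (auto simp: emeasure_density intro!: nn_integral_cong)
  also have "\<dots> \<le> (\<integral>\<^sup>+ x. indicator (cbox (0, 0) (pi, 2*pi)) x \<partial>lborel)"
    by (intro nn_integral_mono) (auto simp: sphere_density_def indicator_def cbox_Pair_eq)
  also have "\<dots> = emeasure lborel (cbox (0, 0) (pi, 2*pi) :: (real \<times> real) set)" by simp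
  also have "\<dots> < \<infinity>" by (rule emeasure_lborel_cbox_finite)
  finally show "emeasure sphere_measure (space sphere_measure) \<noteq> \<infinity>" by simp
qed

text \<open>Pulled back to the angles, the integrand is continuous on a compact rectangle, so the
  Lebesgue integral is an iterated one. As \<open>g\<close> is controlled only on the sphere, it is
  first extended by zero to a Borel function.\<close>

lemma
  fixes g :: "real^3 \<Rightarrow> real"
  assumes g: "continuous_on (sphere 0 1) g"
  shows set_integrable_sphere_measure: "set_integrable sphere_measure (sphere 0 1) g"
    and set_integral_sphere_measure: "(LINT \<omega>:sphere 0 1|sphere_measure. g \<omega>)
      = integral {0..pi} (\<lambda>\<theta>. sin \<theta> * integral {0..2*pi} (\<lambda>\<phi>. g (sph \<theta> \<phi>)))"
proof -
  define g' where "g' \<omega> = indicator (sphere 0 1) \<omega> *\<^sub>R g \<omega>" for \<omega>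
  define k where "k x = sin (fst x) * g (sph (fst x) (snd x))" for x :: "real \<times> real"
  let ?B = "cbox (0, 0) (pi, 2*pi) :: (real \<times> real) set"
  have g' [measurable]: "g' \<in> borel_measurable borel"
    unfolding g'_def by (intro borel_measurable_continuous_on_indicator g) simp
  have sphg: "g' (sph \<theta> \<phi>) = g (sph \<theta> \<phi>)" for \<theta> \<phi> by (simp add: g'_def)
  have k: "continuous_on ?B k"
    unfolding k_def using continuous_on_sph[of ?B]
    by (intro continuous_intros continuous_on_compose2[OF g]) (auto simp: case_prod_beta)
  have eq: "sphere_density x *\<^sub>R g' (case x of (\<theta>, \<phi>) \<Rightarrow> sph \<theta> \<phi>) = indicator ?B x *\<^sub>R k x" for x
    by (auto simp: sphere_density_def k_def indicator_def cbox_Pair_eq sphg split: prod.split)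
  have kB: "set_integrable lborel ?B k"
    by (rule borel_integrable_compact[OF compact_cbox k, folded set_integrable_def])
  have "integrable lborel (\<lambda>x. sphere_density x *\<^sub>R g' (case x of (\<theta>, \<phi>) \<Rightarrow> sph \<theta> \<phi>))"
    using kB unfolding eq set_integrable_def .
  then have "integrable (density lborel (\<lambda>x. ennreal (sphere_density x))) (\<lambda>x. g' (case x of (\<theta>, \<phi>) \<Rightarrow> sph \<theta> \<phi>))"
    by (subst integrable_density) (auto simp: sphere_density_nonneg)
  then show "set_integrable sphere_measure (sphere 0 1) g"
    unfolding set_integrable_def g'_def[symmetric] sphere_measure_eq
    by (subst integrable_distr_eq) auto
  have "(LINT \<omega>:sphere 0 1|sphere_measure. g \<omega>) = integral\<^sup>L sphere_measure g'"
    by (simp only: set_lebesgue_integral_def g'_def[abs_def])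
  also have "\<dots> = (LINT x|density lborel (\<lambda>x. ennreal (sphere_density x)). g' (case x of (\<theta>, \<phi>) \<Rightarrow> sph \<theta> \<phi>))"
    unfolding sphere_measure_eq by (subst integral_distr) auto
  also have "\<dots> = (LINT x|lborel. sphere_density x *\<^sub>R g' (case x of (\<theta>, \<phi>) \<Rightarrow> sph \<theta> \<phi>))"
    by (subst integral_density) (auto simp: sphere_density_nonneg)
  also have "\<dots> = (LINT x:?B|lborel. k x)" unfolding eq set_lebesgue_integral_def ..
  also have "\<dots> = integral ?B k" by (rule set_borel_integral_eq_integral(2)[OF kB])
  also have "\<dots> = integral {0..pi} (\<lambda>\<theta>. integral {0..2*pi} (\<lambda>\<phi>. k (\<theta>, \<phi>)))"
    using integral_prod_continuous[OF k] by simp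
  finally show "(LINT \<omega>:sphere 0 1|sphere_measure. g \<omega>)
      = integral {0..pi} (\<lambda>\<theta>. sin \<theta> * integral {0..2*pi} (\<lambda>\<phi>. g (sph \<theta> \<phi>)))"
    by (simp add: k_def)
qed

lemma nn_integral_sphere_measure:
  fixes g :: "real^3 \<Rightarrow> real"
  assumes g: "continuous_on (sphere 0 1) g" and nonneg: "\<And>\<omega>. \<omega> \<in> sphere 0 1 \<Longrightarrow> 0 \<le> g \<omega>"
  shows "(\<integral>\<^sup>+ \<omega>. indicator (sphere 0 1) \<omega> * ennreal (g \<omega>) \<partial>sphere_measure)
      = ennreal (integral {0..pi} (\<lambda>\<theta>. sin \<theta> * integral {0..2*pi} (\<lambda>\<phi>. g (sph \<theta> \<phi>))))"
proof -
  have "(\<integral>\<^sup>+ \<omega>. indicator (sphere 0 1) \<omega> * ennreal (g \<omega>) \<partial>sphere_measure)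
     = (\<integral>\<^sup>+ \<omega>. ennreal (indicator (sphere 0 1) \<omega> *\<^sub>R g \<omega>) \<partial>sphere_measure)"
    by (intro nn_integral_cong) (auto simp: indicator_def)
  also have "\<dots> = ennreal (integral\<^sup>L sphere_measure (\<lambda>\<omega>. indicator (sphere 0 1) \<omega> *\<^sub>R g \<omega>))"
    using set_integrable_sphere_measure[OF g] nonneg
    by (intro nn_integral_eq_integral) (auto simp: set_integrable_def indicator_def)
  finally show ?thesis
    using set_integral_sphere_measure[OF g] by (simp add: set_lebesgue_integral_def)
qed

lemma nn_integral_Icc_continuous:
  fixes g :: "real \<Rightarrow> real"
  assumes "continuous_on {a..b} g" "\<And>x. x \<in> {a..b} \<Longrightarrow> 0 \<le> g x"
  shows "(\<integral>\<^sup>+ x. indicator {a..b} x * ennreal (g x) \<partial>lborel) = ennreal (integral {a..b} g)"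
proof -
  have int: "set_integrable lborel {a..b} g"
    using assms(1) by (rule borel_integrable_atLeastAtMost')
  have "(\<integral>\<^sup>+ x. indicator {a..b} x * ennreal (g x) \<partial>lborel)
     = (\<integral>\<^sup>+ x. ennreal (indicator {a..b} x *\<^sub>R g x) \<partial>lborel)"
    by (intro nn_integral_cong) (auto simp: indicator_def)
  also have "\<dots> = ennreal (LINT x:{a..b}|lborel. g x)"
    unfolding set_lebesgue_integral_def using int assms(2)
    by (intro nn_integral_eq_integral) (auto simp: set_integrable_def indicator_def)
  finally show ?thesis by (simp add: set_borel_integral_eq_integral(2)[OF int])
qed

context coordinate_domain
begin

lemma sphere_integral_linear:
  assumes "continuous_on V g" "continuous_on V h" "(v, r) \<in> U"
  shows "sphere_integral (\<lambda>q. g q + c * h q) v r = sphere_integral g v r + c * sphere_integral h v r"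
proof -
  have "circle_integral (\<lambda>q. g q + c * h q) v r \<theta> = circle_integral g v r \<theta> + c * circle_integral h v r \<theta>" for \<theta>
    unfolding circle_integral_def[of "\<lambda>q. g q + c * h q"]
    by (intro integral_unique has_integral_add has_integral_mult_right has_integral_circle_integral assms)
  then have eq: "(\<lambda>\<theta>. sin \<theta> * circle_integral (\<lambda>q. g q + c * h q) v r \<theta>)
     = (\<lambda>\<theta>. sin \<theta> * circle_integral g v r \<theta> + c * (sin \<theta> * circle_integral h v r \<theta>))"
    by (simp add: fun_eq_iff algebra_simps)
  show ?thesis
    unfolding sphere_integral_def[of "\<lambda>q. g q + c * h q"] eq
    by (intro integral_unique has_integral_add has_integral_mult_right has_integral_sphere_integral assms)
qed

lemma sphere_integral_Cauchy_Schwarz: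
  assumes h: "continuous_on V h" and vr: "(v, r) \<in> U"
  shows "(sphere_integral h v r)\<^sup>2 \<le> 4 * pi * sphere_integral (\<lambda>q. (h q)\<^sup>2) v r"
proof -
  \<comment> \<open>The mean of \<open>h\<close> over the sphere of area 4 pi; the inequality is the
    non-negativity of the integral of (h - t)^2.\<close>
  define t where "t = sphere_integral h v r / (4 * pi)"
  have c2: "continuous_on V (\<lambda>q. (h q)\<^sup>2)" and c0: "continuous_on V (\<lambda>q. t\<^sup>2)"
    and c1: "continuous_on V (\<lambda>q. (h q - t)\<^sup>2)"
    by (intro continuous_intros h)+
  have circle: "circle_integral (\<lambda>q. (h q - t)\<^sup>2) v r \<theta> =
      circle_integral (\<lambda>q. (h q)\<^sup>2) v r \<theta> + (- 2 * t) * circle_integral h v r \<theta> + circle_integral (\<lambda>q. t\<^sup>2) v r \<theta>" for \<theta>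
  proof -
    have "((\<lambda>\<phi>. (h (coords v r \<theta> \<phi>))\<^sup>2 + (- 2 * t) * h (coords v r \<theta> \<phi>) + t\<^sup>2) has_integral
       circle_integral (\<lambda>q. (h q)\<^sup>2) v r \<theta> + (- 2 * t) * circle_integral h v r \<theta> + circle_integral (\<lambda>q. t\<^sup>2) v r \<theta>) {0..2*pi}"
      by (intro has_integral_add has_integral_mult_right has_integral_circle_integral[OF h vr]
          has_integral_circle_integral[OF c2 vr] has_integral_circle_integral[OF c0 vr])
    also have "(\<lambda>\<phi>. (h (coords v r \<theta> \<phi>))\<^sup>2 + (- 2 * t) * h (coords v r \<theta> \<phi>) + t\<^sup>2)
       = (\<lambda>\<phi>. (h (coords v r \<theta> \<phi>) - t)\<^sup>2)"
      by (simp add: fun_eq_iff power2_eq_square algebra_simps)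
    finally show ?thesis
      using has_integral_circle_integral[OF c1 vr] by (rule has_integral_unique[rotated])
  qed
  have "((\<lambda>\<theta>. sin \<theta> * circle_integral (\<lambda>q. (h q)\<^sup>2) v r \<theta> + (- 2 * t) * (sin \<theta> * circle_integral h v r \<theta>)
      + sin \<theta> * circle_integral (\<lambda>q. t\<^sup>2) v r \<theta>) has_integral
     sphere_integral (\<lambda>q. (h q)\<^sup>2) v r + (- 2 * t) * sphere_integral h v r + sphere_integral (\<lambda>q. t\<^sup>2) v r) {0..pi}"
    by (intro has_integral_add has_integral_mult_right has_integral_sphere_integral[OF h vr]
          has_integral_sphere_integral[OF c2 vr] has_integral_sphere_integral[OF c0 vr])
  moreover have "0 \<le> sin \<theta> * circle_integral (\<lambda>q. (h q)\<^sup>2) v r \<theta> + (- 2 * t) * (sin \<theta> * circle_integral h v r \<theta>)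
      + sin \<theta> * circle_integral (\<lambda>q. t\<^sup>2) v r \<theta>" if "\<theta> \<in> {0..pi}" for \<theta>
  proof -
    have "0 \<le> circle_integral (\<lambda>q. (h q - t)\<^sup>2) v r \<theta>"
      using has_integral_circle_integral[OF c1 vr] by (rule has_integral_nonneg) simp
    then have "0 \<le> sin \<theta> * circle_integral (\<lambda>q. (h q - t)\<^sup>2) v r \<theta>"
      using that by (intro mult_nonneg_nonneg sin_ge_zero) auto
    then show ?thesis unfolding circle by (simp add: algebra_simps)
  qed
  ultimately have "0 \<le> sphere_integral (\<lambda>q. (h q)\<^sup>2) v r + (- 2 * t) * sphere_integral h v r + sphere_integral (\<lambda>q. t\<^sup>2) v r"
    by (rule has_integral_nonneg)
  moreover have "sphere_integral (\<lambda>q. t\<^sup>2) v r = 4 * pi * t\<^sup>2"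
  proof -
    have "integral {0..pi} sin = - cos pi - - cos 0"
      by (intro integral_FTC) (auto intro!: derivative_eq_intros)
    then show ?thesis by (simp add: sphere_integral_def circle_integral_def)
  qed
  moreover have "sphere_integral h v r = 4 * pi * t" by (simp add: t_def)
  ultimately have "4 * pi * t\<^sup>2 \<le> sphere_integral (\<lambda>q. (h q)\<^sup>2) v r" by (simp add: power2_eq_square)
  then have "4 * pi * (4 * pi * t\<^sup>2) \<le> 4 * pi * sphere_integral (\<lambda>q. (h q)\<^sup>2) v r"
    by (intro mult_left_mono) auto
  then show ?thesis by (simp add: t_def power2_eq_square)
qed

end

section \<open>The radial derivative and the spheres contained in an open set\<close>

lemma Y_has_real_derivative:
  assumes "open W" "Ck_on (Suc 0) W \<psi>" "(v, r, \<omega>) \<in> W"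
  shows "((\<lambda>s. \<psi> (v, s, \<omega>)) has_real_derivative Y \<psi> (v, r, \<omega>)) (at r)"
    and "Y \<psi> (v, r, \<omega>) = frechet_derivative \<psi> (at (v, r, \<omega>)) (0, 1, 0)"
proof -
  let ?D = "frechet_derivative \<psi> (at (v, r, \<omega>))"
  have \<psi>: "(\<psi> has_derivative ?D) (at (v, r, \<omega>))"
    using assms by (intro has_derivative_if_differentiable_on) simp_all
  have "((\<lambda>s. (v, s, \<omega>)) has_derivative (\<lambda>h. (0, h, 0))) (at r)"
    by (auto intro!: derivative_eq_intros)
  from has_derivative_compose[OF this \<psi>]
  have "((\<lambda>s. \<psi> (v, s, \<omega>)) has_derivative (\<lambda>h. ?D (0, h, 0))) (at r)" .
  moreover have "(\<lambda>h. ?D (0, h, 0)) = (*) (?D (0, 1, 0))"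
  proof
    show "?D (0, h, 0) = ?D (0, 1, 0) * h" for h
      using linear_cmul[OF has_derivative_linear[OF \<psi>], of h "(0, 1, 0)"] by simp
  qed
  ultimately have d: "((\<lambda>s. \<psi> (v, s, \<omega>)) has_real_derivative ?D (0, 1, 0)) (at r)"
    by (simp only: has_field_derivative_def)
  then show Y: "Y \<psi> (v, r, \<omega>) = ?D (0, 1, 0)"
    by (simp only: Y_def prod.case DERIV_imp_deriv)
  show "((\<lambda>s. \<psi> (v, s, \<omega>)) has_real_derivative Y \<psi> (v, r, \<omega>)) (at r)"
    unfolding Y by (rule d)
qed

lemma continuous_on_Y:
  assumes "open W" "Ck_on (Suc 0) W \<psi>"
  shows "continuous_on W (Y \<psi>)"
proof -
  have "(0, 1, 0) \<in> (Basis :: point set)" by (simp add: Basis_prod_def)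
  then have "continuous_on W (\<lambda>p. frechet_derivative \<psi> (at p) (0, 1, 0))"
    using assms(2) by simp
  then show ?thesis
    by (rule continuous_on_cong[THEN iffD1, rotated 2]) (auto simp: Y_has_real_derivative(2)[OF assms])
qed

lemma pd_2_comp_EF:
  assumes "open W" "Ck_on (Suc 0) W \<psi>" "(v, r, sph \<theta> \<phi>) \<in> W"
  shows "pd 2 (\<psi> \<circ> EF) (coords v r \<theta> \<phi>) = Y \<psi> (v, r, sph \<theta> \<phi>)"
proof -
  have "((\<lambda>r. (\<psi> \<circ> EF) (coords v r \<theta> \<phi>)) has_real_derivative pd 2 (\<psi> \<circ> EF) (coords v r \<theta> \<phi>)) (at r)"
    using assms by (intro pd_partial(2)[OF open_vimage_EF Ck_on_comp_EF]) auto
  then show ?thesis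
    using Y_has_real_derivative(1)[OF assms] DERIV_unique by fastforce
qed

text \<open>Smoothness is given on a neighbourhood \<open>W\<close> that need not be spherically
  symmetric; spherical integrals make sense where the whole sphere fits into it.\<close>

definition sphere_tube :: "point set \<Rightarrow> (real \<times> real) set" where
  "sphere_tube W = {(v, r). \<forall>\<omega>\<in>sphere 0 1. (v, r, \<omega>) \<in> W}"

lemma coordinate_domain_sphere_tube:
  assumes "open W"
  shows "coordinate_domain (EF -` W) (sphere_tube W)"
proof
  show "open (EF -` W)" by (rule open_vimage_EF[OF assms])
  show "open (sphere_tube W)"
  proof (subst open_subopen, rule ballI)
    fix x assume x: "x \<in> sphere_tube W"
    have "open ((\<lambda>p :: (real \<times> real) \<times> (real^3). (fst (fst p), snd (fst p), snd p)) -` W)" (is "open ?W'")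
      by (intro open_vimage assms continuous_intros)
    moreover have "{x} \<times> sphere 0 1 \<subseteq> ?W'" using x by (auto simp: sphere_tube_def)
    ultimately have "\<exists>X. x \<in> X \<and> open X \<and> X \<times> sphere 0 1 \<subseteq> ?W'"
      by (rule Elementary_Topology.tube_lemma[OF compact_sphere])
    then obtain X where X: "x \<in> X" "open X" "X \<times> sphere 0 1 \<subseteq> ?W'" by (elim exE conjE)
    have "X \<subseteq> sphere_tube W" using X(3) by (auto simp: sphere_tube_def)
    with X show "\<exists>T. open T \<and> x \<in> T \<and> T \<subseteq> sphere_tube W" by (intro exI[of _ X] conjI)
  qed
  show "coords v r \<theta> \<phi> \<in> EF -` W" if "(v, r) \<in> sphere_tube W" for v r \<theta> \<phi>
    using that by (auto simp: sphere_tube_def)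
qed

section \<open>Iterated integration for the spacetime volume\<close>

lemma sets_product_sphere_measure:
  "sets (lborel \<Otimes>\<^sub>M (lborel \<Otimes>\<^sub>M sphere_measure)) = sets (borel :: point measure)"
proof -
  have "sets (lborel \<Otimes>\<^sub>M sphere_measure) = sets (borel :: (real \<times> (real^3)) measure)"
    unfolding borel_prod[symmetric] by (intro sets_pair_measure_cong) auto
  then show ?thesis
    unfolding borel_prod[symmetric, where 'b="real \<times> (real^3)"] by (intro sets_pair_measure_cong) auto
qed

lemma borel_measurable_product_sphere_measure:
  "borel_measurable (lborel \<Otimes>\<^sub>M (lborel \<Otimes>\<^sub>M sphere_measure)) = borel_measurable (borel :: point measure)"
  by (rule measurable_cong_sets[OF sets_product_sphere_measure refl])

lemma nn_integral_product_sphere_measure: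
  assumes h: "h \<in> borel_measurable (borel :: point measure)"
  shows "(\<integral>\<^sup>+ p. h p \<partial>(lborel \<Otimes>\<^sub>M (lborel \<Otimes>\<^sub>M sphere_measure)))
     = (\<integral>\<^sup>+ v. \<integral>\<^sup>+ r. \<integral>\<^sup>+ \<omega>. h (v, r, \<omega>) \<partial>sphere_measure \<partial>lborel \<partial>lborel)"
proof -
  interpret S: finite_measure sphere_measure by (rule finite_measure_sphere_measure)
  interpret P: pair_sigma_finite lborel sphere_measure ..
  have h': "h \<in> borel_measurable (lborel \<Otimes>\<^sub>M (lborel \<Otimes>\<^sub>M sphere_measure))"
    using h by (simp only: borel_measurable_product_sphere_measure)
  have "(\<integral>\<^sup>+ p. h p \<partial>(lborel \<Otimes>\<^sub>M (lborel \<Otimes>\<^sub>M sphere_measure)))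
     = (\<integral>\<^sup>+ v. \<integral>\<^sup>+ q. h (v, q) \<partial>(lborel \<Otimes>\<^sub>M sphere_measure) \<partial>lborel)"
    by (rule P.nn_integral_fst[OF h', symmetric])
  also have "\<dots> = (\<integral>\<^sup>+ v. \<integral>\<^sup>+ r. \<integral>\<^sup>+ \<omega>. h (v, r, \<omega>) \<partial>sphere_measure \<partial>lborel \<partial>lborel)"
    by (intro nn_integral_cong S.nn_integral_fst[symmetric] measurable_compose[OF measurable_Pair1' h']) simp
  finally show ?thesis .
qed

text \<open>Cauchy-Schwarz on each sphere costs the factor 4 pi, and the density r^2 is at least M^2
  on the box; this explains the constant.\<close>

lemma L2_le_volume_integral:
  fixes \<psi> :: "point \<Rightarrow> real"
  assumes W: "open W" and \<psi>: "\<And>k. Ck_on k W \<psi>" and "0 < M" "v0 \<le> v1"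
    and A: "{v0..v1} \<times> {M..R} \<times> sphere 0 1 \<subseteq> A \<inter> W"
  shows "ennreal (M\<^sup>2 / (4 * pi) * integral {v0..v1} (\<lambda>v. integral {M..R} (\<lambda>r.
        (sphere_integral (pd 2 (\<psi> \<circ> EF)) v r)\<^sup>2)))
     \<le> (\<integral>\<^sup>+ p \<in> A. ennreal ((Y \<psi> p)\<^sup>2) \<partial>volume_measure)"
proof -
  interpret coordinate_domain "EF -` W" "sphere_tube W" by (rule coordinate_domain_sphere_tube[OF W])
  \<comment> \<open>Measurability of \<open>A\<close> is not among the hypotheses, so iterated
    integration is carried out on this closed box inside it, and monotonicity does the rest.\<close>
  define K where "K = {v0..v1} \<times> {M..R} \<times> (sphere 0 1 :: (real^3) set)"
  define S where "S v r = sphere_integral (pd 2 (\<psi> \<circ> EF)) v r" for v r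
  define c where "c = M\<^sup>2 / (4 * pi)"
  have c: "0 \<le> c" by (simp add: c_def)
  have tube: "(v, r) \<in> sphere_tube W" if "v \<in> {v0..v1}" "r \<in> {M..R}" for v r
    using that A by (auto simp: sphere_tube_def)
  have contY: "continuous_on W (Y \<psi>)" by (rule continuous_on_Y[OF W \<psi>])
  have cont_pd2: "continuous_on (EF -` W) (pd 2 (\<psi> \<circ> EF))"
    by (intro cont_pd Ck_on_comp_EF W \<psi>)
  have contS: "continuous_on (sphere_tube W) (\<lambda>(v, r). c * (S v r)\<^sup>2)"
    using cont_sphere_integral[OF cont_pd2] unfolding S_def case_prod_beta by (intro continuous_intros)
  have contSr: "continuous_on {M..R} (\<lambda>r. c * (S v r)\<^sup>2)" if "v \<in> {v0..v1}" for v
  proof -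
    have "continuous_on {M..R} (\<lambda>r. (\<lambda>(v, r). c * (S v r)\<^sup>2) (v, r))"
      using tube[OF that] by (intro continuous_on_compose2[OF contS]) (auto intro!: continuous_intros)
    then show ?thesis by simp
  qed
  define g where "g p = ennreal (indicator K p *\<^sub>R (Y \<psi> p)\<^sup>2)" for p
  have "closed K" unfolding K_def by (intro closed_Times closed_atLeastAtMost closed_sphere)
  then have g: "g \<in> borel_measurable borel"
    unfolding g_def using A
    by (intro measurable_compose[OF borel_measurable_continuous_on_indicator measurable_ennreal]
        continuous_intros continuous_on_subset[OF contY]) (auto simp: K_def)
  have r2: "(\<lambda>(v, r, \<omega>). ennreal (r\<^sup>2)) \<in> borel_measurable (borel :: point measure)"
    unfolding case_prod_beta
    by (intro measurable_compose[OF borel_measurable_continuous_onI measurable_ennreal] continuous_intros)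
  have slice: "c * (S v r)\<^sup>2 \<le> M\<^sup>2 * sphere_integral (\<lambda>q. (pd 2 (\<psi> \<circ> EF) q)\<^sup>2) v r"
    if "v \<in> {v0..v1}" "r \<in> {M..R}" for v r
  proof -
    have "c * (S v r)\<^sup>2 \<le> c * (4 * pi * sphere_integral (\<lambda>q. (pd 2 (\<psi> \<circ> EF) q)\<^sup>2) v r)"
      unfolding S_def by (intro mult_left_mono c sphere_integral_Cauchy_Schwarz cont_pd2 tube that)
    then show ?thesis by (simp add: c_def)
  qed
  have inner: "indicator {v0..v1} v * (indicator {M..R} r * ennreal (c * (S v r)\<^sup>2))
       \<le> (\<integral>\<^sup>+ \<omega>. ennreal (r\<^sup>2) * g (v, r, \<omega>) \<partial>sphere_measure)" for v r
  proof (cases "v \<in> {v0..v1} \<and> r \<in> {M..R}")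
    case True
    then have vr: "v \<in> {v0..v1}" "r \<in> {M..R}" by auto
    have cY: "continuous_on (sphere 0 1) (\<lambda>\<omega>. M\<^sup>2 * (Y \<psi> (v, r, \<omega>))\<^sup>2)"
      using vr A by (intro continuous_intros continuous_on_compose2[OF contY]) auto
    have "ennreal (c * (S v r)\<^sup>2) \<le> ennreal (M\<^sup>2 * sphere_integral (\<lambda>q. (pd 2 (\<psi> \<circ> EF) q)\<^sup>2) v r)"
      by (intro ennreal_leI slice vr)
    also have "M\<^sup>2 * sphere_integral (\<lambda>q. (pd 2 (\<psi> \<circ> EF) q)\<^sup>2) v r
       = integral {0..pi} (\<lambda>\<theta>. sin \<theta> * integral {0..2*pi} (\<lambda>\<phi>. M\<^sup>2 * (Y \<psi> (v, r, sph \<theta> \<phi>))\<^sup>2))"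
    proof -
      have "pd 2 (\<psi> \<circ> EF) (coords v r \<theta> \<phi>) = Y \<psi> (v, r, sph \<theta> \<phi>)" for \<theta> \<phi>
        using tube[OF vr] by (intro pd_2_comp_EF[OF W \<psi>]) (auto simp: sphere_tube_def)
      then show ?thesis
        by (simp add: sphere_integral_def circle_integral_def mult.left_commute[of "sin _" "M\<^sup>2"])
    qed
    also have "ennreal \<dots> = (\<integral>\<^sup>+ \<omega>. indicator (sphere 0 1) \<omega> * ennreal (M\<^sup>2 * (Y \<psi> (v, r, \<omega>))\<^sup>2) \<partial>sphere_measure)"
      by (rule nn_integral_sphere_measure[OF cY, symmetric]) simp
    also have "\<dots> \<le> (\<integral>\<^sup>+ \<omega>. ennreal (r\<^sup>2) * g (v, r, \<omega>) \<partial>sphere_measure)"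
    proof (intro nn_integral_mono)
      fix \<omega> :: "real^3"
      have "M\<^sup>2 * (Y \<psi> (v, r, \<omega>))\<^sup>2 \<le> r\<^sup>2 * (Y \<psi> (v, r, \<omega>))\<^sup>2"
        using vr \<open>0 < M\<close> by (intro mult_right_mono power_mono) auto
      then have "ennreal (M\<^sup>2 * (Y \<psi> (v, r, \<omega>))\<^sup>2) \<le> ennreal (r\<^sup>2) * ennreal ((Y \<psi> (v, r, \<omega>))\<^sup>2)"
        by (simp add: ennreal_leI flip: ennreal_mult)
      then show "indicator (sphere 0 1) \<omega> * ennreal (M\<^sup>2 * (Y \<psi> (v, r, \<omega>))\<^sup>2) \<le> ennreal (r\<^sup>2) * g (v, r, \<omega>)"
        using vr by (auto simp: g_def K_def indicator_def)
    qed
    finally show ?thesis using vr by simp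
  qed auto
  have "ennreal (c * integral {v0..v1} (\<lambda>v. integral {M..R} (\<lambda>r. (S v r)\<^sup>2)))
     = ennreal (integral {v0..v1} (\<lambda>v. integral {M..R} (\<lambda>r. c * (S v r)\<^sup>2)))" by simp
  also have "\<dots> = (\<integral>\<^sup>+ v. indicator {v0..v1} v * ennreal (integral {M..R} (\<lambda>r. c * (S v r)\<^sup>2)) \<partial>lborel)"
  proof (rule nn_integral_Icc_continuous[symmetric])
    have "continuous_on ({v0..v1} \<times> cbox M R) (\<lambda>(v, r). c * (S v r)\<^sup>2)"
      using contS by (rule continuous_on_subset) (use tube in auto)
    from integral_continuous_on_param[OF this]
    show "continuous_on {v0..v1} (\<lambda>v. integral {M..R} (\<lambda>r. c * (S v r)\<^sup>2))" by simp
    show "0 \<le> integral {M..R} (\<lambda>r. c * (S v r)\<^sup>2)" if "v \<in> {v0..v1}" for v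
      using c by (intro integral_nonneg integrable_continuous_real contSr that) simp
  qed
  also have "\<dots> = (\<integral>\<^sup>+ v. indicator {v0..v1} v * (\<integral>\<^sup>+ r. indicator {M..R} r * ennreal (c * (S v r)\<^sup>2) \<partial>lborel) \<partial>lborel)"
  proof (intro nn_integral_cong)
    fix v
    have "ennreal (integral {M..R} (\<lambda>r. c * (S v r)\<^sup>2)) = (\<integral>\<^sup>+ r. indicator {M..R} r * ennreal (c * (S v r)\<^sup>2) \<partial>lborel)"
      if "v \<in> {v0..v1}"
      using c by (intro nn_integral_Icc_continuous[symmetric] contSr that) simp
    then show "indicator {v0..v1} v * ennreal (integral {M..R} (\<lambda>r. c * (S v r)\<^sup>2))
      = indicator {v0..v1} v * (\<integral>\<^sup>+ r. indicator {M..R} r * ennreal (c * (S v r)\<^sup>2) \<partial>lborel)"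
      by (cases "v \<in> {v0..v1}") auto
  qed
  also have "\<dots> \<le> (\<integral>\<^sup>+ v. \<integral>\<^sup>+ r. \<integral>\<^sup>+ \<omega>. ennreal (r\<^sup>2) * g (v, r, \<omega>) \<partial>sphere_measure \<partial>lborel \<partial>lborel)"
  proof (intro nn_integral_mono)
    fix v
    show "indicator {v0..v1} v * (\<integral>\<^sup>+ r. indicator {M..R} r * ennreal (c * (S v r)\<^sup>2) \<partial>lborel)
       \<le> (\<integral>\<^sup>+ r. \<integral>\<^sup>+ \<omega>. ennreal (r\<^sup>2) * g (v, r, \<omega>) \<partial>sphere_measure \<partial>lborel)"
    proof (cases "v \<in> {v0..v1}")
      case True
      then show ?thesis using inner[of v] by (auto intro!: nn_integral_mono)
    qed simp
  qed
  also have "\<dots> = (\<integral>\<^sup>+ p. (case p of (v, r, \<omega>) \<Rightarrow> ennreal (r\<^sup>2)) * g p \<partial>(lborel \<Otimes>\<^sub>M (lborel \<Otimes>\<^sub>M sphere_measure)))"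
    by (subst nn_integral_product_sphere_measure[OF borel_measurable_times_ennreal[OF r2 g]]) simp
  also have "\<dots> = (\<integral>\<^sup>+ p. g p \<partial>volume_measure)"
    unfolding volume_measure_def
    by (rule nn_integral_density[symmetric]) (simp_all only: borel_measurable_product_sphere_measure g r2)
  also have "\<dots> \<le> (\<integral>\<^sup>+ p \<in> A. ennreal ((Y \<psi> p)\<^sup>2) \<partial>volume_measure)"
    using A by (intro nn_integral_mono) (auto simp: g_def K_def indicator_def)
  finally show ?thesis by (simp add: c_def S_def)
qed

section \<open>Causal curves and the outgoing cone\<close>

lemma straight_line_in_causal_future:
  assumes "p \<in> S" "p \<noteq> q"
    and "closed_segment p q \<subseteq> spacetime M"
    and "\<And>x. x \<in> closed_segment p q \<Longrightarrow> future_causal M x (q - p)"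
  shows "q \<in> causal_future M S"
proof -
  have "valid_path (linepath p q) \<and> pathstart (linepath p q) \<in> S \<and> pathfinish (linepath p q) = q \<and>
      path_image (linepath p q) \<subseteq> spacetime M \<and> finite {} \<and>
      (\<forall>t\<in>{0..1} - {}. linepath p q differentiable (at t) \<and>
         future_causal M (linepath p q t) (vector_derivative (linepath p q) (at t)))"
    using assms
    by (auto simp: vector_derivative_linepath_at linepath_in_path[unfolded path_image_linepath])
  then show ?thesis unfolding causal_future_def by blast
qed

text \<open>The radial coordinate vector is null, and its negative has product -1 with the field
  that fixes the time orientation.\<close>

lemma ingoing_null_line_in_causal_future:
  assumes "(v, s, \<omega>) \<in> S" "M \<le> r" "r \<le> s" "0 < M" "\<omega> \<in> sphere 0 1"
  shows "(v, r, \<omega>) \<in> causal_future M S"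
proof (cases "r = s")
  case True then show ?thesis using assms by (simp add: causal_future_def)
next
  case False
  have seg: "\<exists>x. p = (v, x, \<omega>) \<and> r \<le> x" if p: "p \<in> closed_segment (v, s, \<omega>) (v, r, \<omega>)" for p
  proof -
    obtain u where u: "0 \<le> u" "u \<le> 1" "p = (1 - u) *\<^sub>R (v, s, \<omega>) + u *\<^sub>R (v, r, \<omega>)"
      using p by (auto simp: closed_segment_def)
    have "r \<le> (1 - u) * s + u * r"
      using mult_left_mono[OF assms(3), of "1 - u"] u by (simp add: algebra_simps)
    moreover have "p = (v, (1 - u) * s + u * r, \<omega>)"
      using u by (auto simp: algebra_simps simp flip: scaleR_add_left)
    ultimately show ?thesis by blast
  qed
  show ?thesis
  proof (rule straight_line_in_causal_future[OF assms(1)])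
    show "closed_segment (v, s, \<omega>) (v, r, \<omega>) \<subseteq> spacetime M"
      using seg assms by (fastforce simp: spacetime_def)
    show "future_causal M x ((v, r, \<omega>) - (v, s, \<omega>))" if "x \<in> closed_segment (v, s, \<omega>) (v, r, \<omega>)" for x
      using seg[OF that] False assms by (auto simp: future_causal_def)
  qed (use False in auto)
qed

lemma D_nonneg: "0 \<le> D M r" by (simp add: D_def)

text \<open>The \<open>v\<close>-coordinate vector has square norm \<open>- D M r\<close>, so it is
  timelike outside the horizon and null on it; its product with the orientation field is -(D +
  1).\<close>

lemma advanced_time_line_in_causal_future:
  assumes "(v, r, \<omega>) \<in> S" "M \<le> r" "v \<le> w" "0 < M" "\<omega> \<in> sphere 0 1"
  shows "(w, r, \<omega>) \<in> causal_future M S"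
proof (cases "v = w")
  case True then show ?thesis using assms by (simp add: causal_future_def)
next
  case False
  have seg: "\<exists>x. p = (x, r, \<omega>)" if p: "p \<in> closed_segment (v, r, \<omega>) (w, r, \<omega>)" for p
    using p by (auto simp: closed_segment_def algebra_simps simp flip: scaleR_add_left)
  show ?thesis
  proof (rule straight_line_in_causal_future[OF assms(1)])
    show "closed_segment (v, r, \<omega>) (w, r, \<omega>) \<subseteq> spacetime M"
      using seg assms by (fastforce simp: spacetime_def)
    show "future_causal M x ((w, r, \<omega>) - (v, r, \<omega>))" if x: "x \<in> closed_segment (v, r, \<omega>) (w, r, \<omega>)" for x
    proof -
      have "0 < w - v" using assms False by simp
      then have "0 \<le> D M r * (w - v)" by (intro mult_nonneg_nonneg D_nonneg) simp
      then have "0 \<le> D M r * (w - v) * (w - v)" "0 < D M r * (w - v) + (w - v)"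
        using \<open>0 < w - v\<close> by simp_all
      then show ?thesis using seg[OF x] by (auto simp: future_causal_def zero_prod_def algebra_simps)
    qed
  qed (use False in auto)
qed

text \<open>On the cone v is a function \<open>\<tau>\<close> of the radius with slope 2 / D, which
  is at least 2 because D is at most 1. Hence \<open>\<tau>\<close> is injective and takes every
  value from \<open>v0\<close> on; its inverse is \<open>\<rho>\<close>, with slope D / 2.\<close>

lemma outgoing_cone_radius:
  assumes "tortoise M rs" "0 < M" "M < s" "v0 - 2 * rs s = u"
  obtains \<rho> where "\<And>v. v0 \<le> v \<Longrightarrow> s \<le> \<rho> v \<and> v - 2 * rs (\<rho> v) = u"
    and "\<And>v. v0 \<le> v \<Longrightarrow> (\<rho> has_real_derivative D M (\<rho> v) / 2) (at v)"
    and "filterlim \<rho> at_top at_top"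
proof -
  define \<tau> where "\<tau> r = u + 2 * rs r" for r
  have \<tau>s: "\<tau> s = v0" using assms(4) by (simp add: \<tau>_def)
  have D: "0 < D M r" "D M r \<le> 1" if "M < r" for r
    using that assms(2) by (auto simp: D_def field_simps intro!: power_mono)
  have \<tau>: "(\<tau> has_real_derivative 2 / D M r) (at r)" if "M < r" for r
    using assms(1) that unfolding tortoise_def \<tau>_def[abs_def]
    by (auto intro!: derivative_eq_intros)
  have growth: "2 * (r' - r) \<le> \<tau> r' - \<tau> r" if "M < r" "r \<le> r'" for r r'
  proof (cases "r = r'")
    case False
    then have "r < r'" using that by simp
    moreover have "(\<tau> has_real_derivative 2 / D M x) (at x)" if "r \<le> x" for x
      using that \<open>M < r\<close> by (intro \<tau>) simp
    ultimately obtain z where z: "r < z" "z < r'" "\<tau> r' - \<tau> r = (r' - r) * (2 / D M z)"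
      using MVT2[of r r' \<tau> "\<lambda>r. 2 / D M r"] by blast
    have "2 \<le> 2 / D M z" using D[of z] z that by (simp add: field_simps)
    then have "(r' - r) * 2 \<le> (r' - r) * (2 / D M z)" using that by (intro mult_left_mono) auto
    then show ?thesis using z by simp
  qed simp
  have inj: "inj_on \<tau> {M<..}"
  proof (rule linorder_inj_onI)
    fix x y assume "x < y" "x \<in> {M<..}" "y \<in> {M<..}"
    then show "\<tau> x \<noteq> \<tau> y" using growth[of x y] by auto
  qed auto
  have cont: "continuous_on {M<..} \<tau>"
    by (intro DERIV_continuous_on[of _ _ "\<lambda>r. 2 / D M r"] has_field_derivative_at_within[OF \<tau>]) auto
  define \<rho> where "\<rho> = inv_into {M<..} \<tau>"
  have \<rho>\<tau>: "\<rho> (\<tau> r) = r" if "M < r" for r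
    unfolding \<rho>_def using that inj by simp
  have \<rho>: "s \<le> \<rho> v \<and> \<tau> (\<rho> v) = v" if v: "v0 \<le> v" for v
  proof -
    \<comment> \<open>Upper bracket for the intermediate value theorem: with slope at least 2,
      \<open>\<tau>\<close> has passed \<open>v\<close> at this radius.\<close>
    have "v \<le> \<tau> (s + (v - v0))" using growth[of s "s + (v - v0)"] assms(3) v \<tau>s by simp
    then obtain x where x: "s \<le> x" "\<tau> x = v"
      using IVT'[of \<tau> s v "s + (v - v0)"] v \<tau>s assms(3) continuous_on_subset[OF cont]
      by (auto simp: subset_eq)
    then show ?thesis using \<rho>\<tau>[of x] assms(3) by auto
  qed
  show thesis
  proof
    show "s \<le> \<rho> v \<and> v - 2 * rs (\<rho> v) = u" if "v0 \<le> v" for v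
      using \<rho>[OF that] by (simp add: \<tau>_def)
    show "(\<rho> has_real_derivative D M (\<rho> v) / 2) (at v)" if "v0 \<le> v" for v
    proof -
      have M\<rho>: "M < \<rho> v" using \<rho>[OF that] assms(3) by simp
      show ?thesis
        unfolding has_field_derivative_def
      proof (rule has_derivative_inverse_strong_x[of "{M<..}" \<rho> v \<tau>])
        show "(\<tau> has_derivative (*) (2 / D M (\<rho> v))) (at (\<rho> v))"
          using \<tau>[OF M\<rho>] by (simp add: has_field_derivative_def)
        show "(*) (2 / D M (\<rho> v)) \<circ> (*) (D M (\<rho> v) / 2) = id"
          using D[OF M\<rho>] by (auto simp: fun_eq_iff)
      qed (use M\<rho> \<rho>[OF that] \<rho>\<tau> cont in auto)
    qed
    show "filterlim \<rho> at_top at_top"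
      unfolding filterlim_at_top
    proof
      fix Z
      have "Z \<le> \<rho> v" if v: "max v0 (\<tau> (max s Z)) \<le> v" for v
      proof (rule ccontr)
        assume Z: "\<not> Z \<le> \<rho> v"
        have "s \<le> \<rho> v" "\<tau> (\<rho> v) = v" using \<rho>[of v] v by auto
        then show False using growth[of "\<rho> v" "max s Z"] Z v assms(3) by auto
      qed
      then show "\<forall>\<^sub>F v in at_top. Z \<le> \<rho> v"
        using eventually_ge_at_top[of "max v0 (\<tau> (max s Z))"] by (rule eventually_mono[rotated])
    qed
  qed
qed

theorem theorem3p2:
  fixes M R R\<^sub>2 :: real and v\<^sub>\<Sigma> rs :: "real \<Rightarrow> real" and \<psi> :: "point \<Rightarrow> real"
  assumes "0 < M" and "M < R" and "R < R\<^sub>2" and "R < 2 * M"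
    and "tortoise M rs"
    and "spacelike_graph M v\<^sub>\<Sigma>" and "asymptotically_flat_graph M v\<^sub>\<Sigma>"
    and "smooth_near (causal_future M (Sigma0 M R R\<^sub>2 v\<^sub>\<Sigma> rs)) \<psi>"
    and "solves_wave M (causal_future M (Sigma0 M R R\<^sub>2 v\<^sub>\<Sigma> rs)) \<psi>"
    and "compactly_supported_on (Sigma0 M R R\<^sub>2 v\<^sub>\<Sigma> rs) \<psi>"
    and "horizon_charge M (v\<^sub>\<Sigma> R) \<psi> \<noteq> 0"
  shows "(\<integral>\<^sup>+ p \<in> region_A M R R\<^sub>2 v\<^sub>\<Sigma> rs. ennreal ((Y \<psi> p)\<^sup>2) \<partial>volume_measure) = \<infinity>"
proof (rule ccontr)
  assume finite: "\<not> ?thesis"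
  define \<Sigma> where "\<Sigma> = Sigma0 M R R\<^sub>2 v\<^sub>\<Sigma> rs"
  define J where "J = causal_future M \<Sigma>"
  obtain W where W: "open W" "J \<subseteq> W" and \<psi>: "\<And>k. Ck_on k W \<psi>"
    using assms(8) unfolding smooth_near_def J_def \<Sigma>_def by blast
  interpret coordinate_domain "EF -` W" "sphere_tube W"
    by (rule coordinate_domain_sphere_tube[OF W(1)])
  define F where "F = \<psi> \<circ> EF"
  have F: "Ck_on k (EF -` W) F" for k unfolding F_def by (intro Ck_on_comp_EF W \<psi>)
  have pdF: "Ck_on k (EF -` W) (pd \<mu> F)" for k \<mu> by (intro Ck_on_pd F)
  have ppdF: "Ck_on k (EF -` W) (pd \<nu> (pd \<mu> F))" for k \<mu> \<nu> by (intro Ck_on_pd F)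
  have contF: "continuous_on (EF -` W) F" "continuous_on (EF -` W) (pd \<mu> F)"
    "continuous_on (EF -` W) (pd \<nu> (pd \<mu> F))" for \<mu> \<nu>
    using F[of 0] pdF[of 0] ppdF[of 0] by simp_all
  have "v\<^sub>\<Sigma> R\<^sub>2 - 2 * rs R\<^sub>2 = v\<^sub>\<Sigma> R\<^sub>2 - 2 * rs R\<^sub>2" "M < R\<^sub>2" using assms by auto
  then obtain \<rho> where \<rho>: "\<And>v. v\<^sub>\<Sigma> R\<^sub>2 \<le> v \<Longrightarrow> R\<^sub>2 \<le> \<rho> v \<and> v - 2 * rs (\<rho> v) = v\<^sub>\<Sigma> R\<^sub>2 - 2 * rs R\<^sub>2"
    and \<rho>_deriv: "\<And>v. v\<^sub>\<Sigma> R\<^sub>2 \<le> v \<Longrightarrow> (\<rho> has_real_derivative D M (\<rho> v) / 2) (at v)"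
    and \<rho>_top: "filterlim \<rho> at_top at_top"
    using outgoing_cone_radius[OF assms(5,1)] by metis
  have cone: "(v, \<rho> v, \<omega>) \<in> \<Sigma>" if "v\<^sub>\<Sigma> R\<^sub>2 \<le> v" "\<omega> \<in> sphere 0 1" for v \<omega>
    using \<rho>[OF that(1)] that assms(2,3) by (auto simp: \<Sigma>_def Sigma0_def)
  \<comment> \<open>Everything between the horizon and the cone is reached from the cone by ingoing
    null lines.\<close>
  have J_cone: "(v, r, \<omega>) \<in> J" if "v\<^sub>\<Sigma> R\<^sub>2 \<le> v" "M \<le> r" "r \<le> \<rho> v" "\<omega> \<in> sphere 0 1" for v r \<omega>
    unfolding J_def using that assms(1) by (intro ingoing_null_line_in_causal_future[OF cone])
  \<comment> \<open>Lines of constant radius starting on the ingoing null piece of the initial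
    hypersurface cover the part near the horizon from its first moment on; this serves the boxes
    inside \<open>region_A\<close> and the transport of the charge up to \<open>v0\<close>.\<close>
  have J_near: "(v, r, \<omega>) \<in> J" if "v\<^sub>\<Sigma> R \<le> v" "M \<le> r" "r \<le> R" "\<omega> \<in> sphere 0 1" for v r \<omega>
    unfolding J_def
  proof (rule advanced_time_line_in_causal_future[OF _ that(2,1) assms(1) that(4)])
    show "(v\<^sub>\<Sigma> R, r, \<omega>) \<in> \<Sigma>" using that by (auto simp: \<Sigma>_def Sigma0_def)
  qed
  have "bounded {p \<in> \<Sigma>. \<psi> p \<noteq> 0}"
    using assms(10) unfolding compactly_supported_on_def \<Sigma>_def
    by (meson bounded_subset closure_subset compact_imp_bounded)
  then obtain B where B: "\<And>p. p \<in> \<Sigma> \<Longrightarrow> \<psi> p \<noteq> 0 \<Longrightarrow> norm p \<le> B"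
    unfolding bounded_iff by blast
  \<comment> \<open>The norm of a point is at least |v|, so the data vanish on the cone once v
    exceeds \<open>B\<close>; the 0 secures \<open>v0_nonneg\<close>.\<close>
  define v0 where "v0 = max 0 (max (v\<^sub>\<Sigma> R) (max (v\<^sub>\<Sigma> R\<^sub>2) (B + 1)))"
  have v0: "0 \<le> v0" "v\<^sub>\<Sigma> R \<le> v0" "v\<^sub>\<Sigma> R\<^sub>2 \<le> v0" "B < v0" by (auto simp: v0_def)
  have wave_J: "2 * r\<^sup>2 * sphere_integral (pd 1 (pd 2 F)) v r + 2 * r * sphere_integral (pd 1 F) v r
       + (r - M)\<^sup>2 * sphere_integral (pd 2 (pd 2 F)) v r + 2 * (r - M) * sphere_integral (pd 2 F) v r = 0"
    if r: "M \<le> r" and vr: "\<And>\<omega>. \<omega> \<in> sphere 0 1 \<Longrightarrow> (v, r, \<omega>) \<in> J" for v r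
  proof (rule sphere_integral_wave[OF F])
    show "(v, r) \<in> sphere_tube W" using vr W(2) by (auto simp: sphere_tube_def)
    show "F (coords v r \<theta> (\<phi> + 2 * pi)) = F (coords v r \<theta> \<phi>)" for \<theta> \<phi>
      by (simp add: F_def sph_def)
    show "box (metric_EF M) F (coords v r \<theta> \<phi>) = 0" if "0 < \<theta>" "\<theta> < pi" for \<theta> \<phi>
      using assms(9) that vr[of "sph \<theta> \<phi>"] unfolding solves_wave_def F_def J_def \<Sigma>_def by simp
  qed (use r assms(1) in auto)
  have tube_J: "(v, r) \<in> sphere_tube W" if "\<And>\<omega>. \<omega> \<in> sphere 0 1 \<Longrightarrow> (v, r, \<omega>) \<in> J" for v r
    using that W(2) by (auto simp: sphere_tube_def)
  interpret horizon_energy M R v0 \<rho> "sphere_tube W" "sphere_integral F" "sphere_integral (pd 1 F)"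
    "sphere_integral (pd 2 F)" "sphere_integral (pd 1 (pd 2 F))" "sphere_integral (pd 2 (pd 2 F))"
  proof
    show "(v, r) \<in> sphere_tube W" if "v0 \<le> v" "M \<le> r" "r \<le> \<rho> v" for v r
      using that v0 by (intro tube_J J_cone) auto
    show "(\<rho> has_real_derivative (\<rho> v - M)\<^sup>2 / (2 * (\<rho> v)\<^sup>2)) (at v)" if "v0 \<le> v" for v
      using \<rho>_deriv[of v] v0 that by (simp add: D_def mult.commute)
    show "R < \<rho> v0" using \<rho>[of v0] v0 assms(3) by simp
    show "((\<lambda>r. sphere_integral (pd 1 F) v r) has_real_derivative sphere_integral (pd 1 (pd 2 F)) v r) (at r)"
      if "(v, r) \<in> sphere_tube W" for v r
      using sphere_integral_deriv_r[OF pdF[of _ 1] that] by (simp add: sphere_integral_mixed[OF F that])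
    show "2 * r\<^sup>2 * sphere_integral (pd 1 (pd 2 F)) v r + 2 * r * sphere_integral (pd 1 F) v r
       + (r - M)\<^sup>2 * sphere_integral (pd 2 (pd 2 F)) v r + 2 * (r - M) * sphere_integral (pd 2 F) v r = 0"
      if "v0 \<le> v" "M \<le> r" "r \<le> \<rho> v" for v r
      using that v0 by (intro wave_J J_cone) auto
    show "sphere_integral F v (\<rho> v) = 0" if "v0 \<le> v" for v
    proof -
      have "\<psi> (v, \<rho> v, \<omega>) = 0" if "\<omega> \<in> sphere 0 1" for \<omega>
      proof (rule ccontr)
        assume "\<psi> (v, \<rho> v, \<omega>) \<noteq> 0"
        then have "norm (v, \<rho> v, \<omega>) \<le> B" using \<open>v0 \<le> v\<close> v0 that by (intro B cone) auto
        moreover have "\<bar>v\<bar> \<le> norm (v, \<rho> v, \<omega>)" using norm_fst_le[of v "(\<rho> v, \<omega>)"] by simp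
        ultimately show False using \<open>v0 \<le> v\<close> v0 by simp
      qed
      then show ?thesis by (simp add: sphere_integral_def circle_integral_def F_def)
    qed
  qed (use assms(1,2) v0 W in \<open>auto intro!: open_U \<rho>_top cont_sphere_integral contF
        sphere_integral_deriv_v sphere_integral_deriv_r F pdF\<close>)
  obtain I where I: "0 \<le> I" "(\<integral>\<^sup>+ p \<in> region_A M R R\<^sub>2 v\<^sub>\<Sigma> rs. ennreal ((Y \<psi> p)\<^sup>2) \<partial>volume_measure) = ennreal I"
    using finite by (cases rule: ennreal_cases) auto
  have "charge = 0"
  proof (rule charge_eq_0_if_L2)
    fix V assume V: "v0 \<le> V"
    have "{v0..V} \<times> {M..R} \<times> sphere 0 1 \<subseteq> region_A M R R\<^sub>2 v\<^sub>\<Sigma> rs \<inter> W"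
      using J_near v0 W(2) unfolding region_A_def \<Sigma>_def[symmetric] J_def[symmetric] by fastforce
    from L2_le_volume_integral[OF W(1) \<psi> assms(1) V this, folded F_def]
    have "ennreal (M\<^sup>2 / (4 * pi) * integral {v0..V} q) \<le> ennreal I"
      unfolding I(2) q_def[abs_def] .
    then have "M\<^sup>2 / (4 * pi) * integral {v0..V} q \<le> I" using I(1) by (simp add: ennreal_le_iff)
    then show "integral {v0..V} q \<le> I * (4 * pi) / M\<^sup>2"
      using assms(1) by (simp add: field_simps)
  qed
  \<comment> \<open>\<open>charge\<close> is evaluated at the late time \<open>v0\<close>, the
    hypothesis at the section where the initial hypersurface meets the horizon. The horizon between
    them lies in \<open>J\<close>, so conservation joins the two.\<close>
  moreover have "2 * M\<^sup>2 * sphere_integral (pd 2 F) v0 M + 2 * M * sphere_integral F v0 M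
     = 2 * M\<^sup>2 * sphere_integral (pd 2 F) (v\<^sub>\<Sigma> R) M + 2 * M * sphere_integral F (v\<^sub>\<Sigma> R) M"
  proof -
    let ?k = "\<lambda>v. 2 * M\<^sup>2 * sphere_integral (pd 2 F) v M + 2 * M * sphere_integral F v M"
    have "integral {v\<^sub>\<Sigma> R..v0} (\<lambda>v. 0) = ?k v0 - ?k (v\<^sub>\<Sigma> R)"
    proof (rule integral_FTC[OF v0(2)])
      fix v assume v: "v \<in> {v\<^sub>\<Sigma> R..v0}"
      have J: "(v, M, \<omega>) \<in> J" if "\<omega> \<in> sphere 0 1" for \<omega> using that v assms(2) by (intro J_near) auto
      have "(?k has_real_derivative 2 * M\<^sup>2 * sphere_integral (pd 1 (pd 2 F)) v M
          + 2 * M * sphere_integral (pd 1 F) v M) (at v)"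
        by (intro DERIV_add DERIV_cmult sphere_integral_deriv_v F pdF tube_J J)
      then show "(?k has_real_derivative 0) (at v within {v\<^sub>\<Sigma> R..v0})"
        using wave_J[OF order_refl J] by (simp add: has_field_derivative_at_within)
    qed
    then show ?thesis by simp
  qed
  moreover have "horizon_charge M (v\<^sub>\<Sigma> R) \<psi>
     = sphere_integral (pd 2 F) (v\<^sub>\<Sigma> R) M + 1 / M * sphere_integral F (v\<^sub>\<Sigma> R) M"
  proof -
    have J: "(v\<^sub>\<Sigma> R, M, \<omega>) \<in> W" if "\<omega> \<in> sphere 0 1" for \<omega>
      using that J_near[of "v\<^sub>\<Sigma> R" M \<omega>] assms(2) W(2) by auto
    then have vr: "(v\<^sub>\<Sigma> R, M) \<in> sphere_tube W" by (auto simp: sphere_tube_def)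
    have comp: "continuous_on (sphere 0 1) (\<lambda>\<omega>. h (v\<^sub>\<Sigma> R, M, \<omega>))"
      if "continuous_on W h" for h :: "point \<Rightarrow> real"
      by (rule continuous_on_compose2[OF that]) (use J in \<open>auto intro!: continuous_intros\<close>)
    have "continuous_on W \<psi>" using \<psi>[of 0] by simp
    then have cont: "continuous_on (sphere 0 1) (\<lambda>\<omega>. Y \<psi> (v\<^sub>\<Sigma> R, M, \<omega>) + 1 / M * \<psi> (v\<^sub>\<Sigma> R, M, \<omega>))"
      by (intro continuous_on_add continuous_on_mult_left comp continuous_on_Y[OF W(1) \<psi>])
    have "horizon_charge M (v\<^sub>\<Sigma> R) \<psi>
       = integral {0..pi} (\<lambda>\<theta>. sin \<theta> * integral {0..2*pi} (\<lambda>\<phi>.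
           Y \<psi> (v\<^sub>\<Sigma> R, M, sph \<theta> \<phi>) + 1 / M * \<psi> (v\<^sub>\<Sigma> R, M, sph \<theta> \<phi>)))"
      unfolding horizon_charge_def by (rule set_integral_sphere_measure[OF cont])
    also have "\<dots> = sphere_integral (\<lambda>q. pd 2 F q + 1 / M * F q) (v\<^sub>\<Sigma> R) M"
      unfolding sphere_integral_def circle_integral_def F_def
      using pd_2_comp_EF[OF W(1) \<psi> J] by simp
    also have "\<dots> = sphere_integral (pd 2 F) (v\<^sub>\<Sigma> R) M + 1 / M * sphere_integral F (v\<^sub>\<Sigma> R) M"
      by (rule sphere_integral_linear[OF contF(2,1) vr])
    finally show ?thesis .
  qed
  ultimately have "M * horizon_charge M (v\<^sub>\<Sigma> R) \<psi> * (2 * M) = 0"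
    using assms(1) by (simp add: charge_def field_simps power2_eq_square)
  then show False using assms(1,11) by simp
qed

end
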